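(* The function $\Phi:(\mathscr{D}_{\mathbb X}'(\Omega_{\mathbb X})/\!\equiv)\ \to\ \mathscr{D}'(\Omega)$ defined by $$\langle \Phi([f]),\varphi\rangle_{\mathscr D(\Omega)} = {}^\circ\langle f,{}^*\varphi\rangle\qquad (\varphi\in\mathscr D(\Omega))$$ is an isomorphism of real vector spaces.
   Context: Work in a $|\mathscr D'(\Omega)|$-saturated nonstandard extension $A\mapsto{}^*A$ of the standard universe. ${}^*\mathbb R_{fin}$ is the ring of finite hyperreals; $x\approx y$ means $x-y$ is infinitesimal; ${}^\circ x$ is the standard part of a finite $x$ (componentwise in ${}^*\mathbb R^k$), and for a set $X\subseteq{}^*\mathbb R^k$, ${}^\circ X$ is the set of the standard parts of the finite elements of $X$. Fix an infinite $N_0\in{}^*\mathbb N$, let $N=N_0!$, $\varepsilon=1/N$, and $\mathbb X=\{n\varepsilon: n\in{}^*\mathbb Z,\ -N^2\le n\le N^2\}$. Let $\Omega\subseteq\mathbb R^k$ be open and $\Omega_{\mathbb X}={}^*\Omega\cap\mathbb X^k$. $\mathbb G(\Omega_{\mathbb X})$ is the set of internal functions $\Omega_{\mathbb X}\to{}^*\mathbb R$ (grid functions). $\mathscr D(\Omega)$ is the space of smooth functions with compact support in $\Omega$, and $\mathscr D'(\Omega)$ is the space of real distributions on $\Omega$ (continuous linear functionals on $\mathscr D(\Omega)$). Inner product: $\langle f,g\rangle=\varepsilon^k\sum_{x\in\mathbb X^k}f(x)g(x)$, functions being set to $0$ outside their domain; $\langle f,{}^*\varphi\rangle$ uses the values of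 ${}^*\varphi$ on the grid. Finite differences: $\mathbb D_if(x)=\varepsilon^{-1}(f(x+\varepsilon e_i)-f(x))$ and $\mathbb D^\alpha=\mathbb D_1^{\alpha_1}\cdots\mathbb D_k^{\alpha_k}$ (at the points where they are defined). A point $x\in\Omega_{\mathbb X}$ is nearstandard in $\Omega$ if $x\approx y$ for some $y\in\Omega$. A grid function $f$ is of class $S^0$ if $f(x)$ is finite for some nearstandard $x$, and $f(x)\approx f(y)$ for all nearstandard $x\approx y$. It is of class $S^\infty$ if $\mathbb D^\alpha f$ is of class $S^0$ for every standard multi-index $\alpha$. Test functions: $\mathscr D_{\mathbb X}(\Omega_{\mathbb X})=\{f\in\mathbb G(\Omega_{\mathbb X}): f\text{ is of class }S^\infty\text{ and }{}^\circ(\mathrm{supp}\, f)\subset\subset\Omega\}$, where $\mathrm{supp}\,f=\{x\in\Omega_{\mathbb X}:f(x)\neq0\}$ and $\subset\subset\Omega$ means compactly contained in $\Omega$. Grid distributions: $\mathscr D_{\mathbb X}'(\Omega_{\mathbb X})=\{f\in\mathbb G(\Omega_{\mathbb X}):\langle f,\varphi\rangle\in{}^*\mathbb R_{fin}\text{ for all }\varphi\in\mathscr D_{\mathbb X}(\Omega_{\mathbb X})\}$. Equivalence: $f\equiv g$ iff $\langle f,\varphi\rangle\approx\langle g,\varphi\rangle$ for all $\varphi\in\mathscr D_{\mathbb X}(\Omega_{\mathbb X})$; $[f]$ is the class of $f$. The quotient is a real vector space under the pointwise operations.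
   Formalization: Test functions are also required to have no infinite points in their support (automatic for bounded Ω); since ° ignores infinite points, for unbounded Ω the literal definition would force grid distributions to vanish at infinity, and φ ↦ ∫φ would not be in the image of Φ. *)

theory Defs
  imports "HOL-Analysis.Analysis" "HOL-Algebra.Module"
begin

unbundle cardinal_syntax

section \<open>Nonstandard extensions\<close>

text \<open>
  First-order formulas over a standard universe of type \<open>'u\<close>. Every finitary relation on the
  universe is an atomic relation symbol, a relation being a set of argument lists; variables are
  natural numbers. The formulas are read in the standard universe with every symbol denoting itself,
  and in the nonstandard universe with \<open>R\<close> denoting its extension \<open>*R\<close>. Constants and
  functions of the standard universe are covered through singletons and graphs.
\<close>

datatype 'u formula =
    Rel "'u list set" "nat list"
  | Eq nat nat
  | Neg "'u formula"
  | Conj "'u formula" "'u formula"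
  | All nat "'u formula"

primrec holds :: "('u list set \<Rightarrow> 'w list set) \<Rightarrow> 'u formula \<Rightarrow> (nat \<Rightarrow> 'w) \<Rightarrow> bool" where
  "holds I (Rel R is) e \<longleftrightarrow> map e is \<in> I R"
| "holds I (Eq i j) e \<longleftrightarrow> e i = e j"
| "holds I (Neg p) e \<longleftrightarrow> \<not> holds I p e"
| "holds I (Conj p q) e \<longleftrightarrow> holds I p e \<and> holds I q e"
| "holds I (All i p) e \<longleftrightarrow> (\<forall>a. holds I p (e(i := a)))"

text \<open>
  The standard universe is an arbitrary type \<open>'u\<close> in which the real numbers, the points of
  \<open>\<real>\<^sup>k\<close> and the functions \<open>\<real>\<^sup>k \<rightarrow> \<real>\<close> occur as
  objects (a superstructure over \<open>\<real>\<close>, for instance); the three injections say which objects they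
  are. The ranges may overlap. The elements of \<open>'v\<close> are the internal objects, and \<open>star R\<close>
  is \<open>*R\<close>.
\<close>

record ('u, 'v, 'k::finite) extension =
  real_in :: "real \<Rightarrow> 'u"
  pt_in :: "real ^ 'k \<Rightarrow> 'u"
  fun_in :: "(real ^ 'k \<Rightarrow> real) \<Rightarrow> 'u"
  star :: "'u list set \<Rightarrow> 'v list set"

text \<open>
  The last conjunct is the transfer principle: a sentence (here: the universal closure of \<open>p\<close>)
  is true in the standard universe iff its *-transform is true in the nonstandard one.
\<close>

definition nonstandard_extension :: "('u, 'v, 'k::finite) extension \<Rightarrow> bool" where
  "nonstandard_extension E \<longleftrightarrow>
     inj (real_in E) \<and> inj (pt_in E) \<and> inj (fun_in E) \<and>
     (\<forall>p. (\<forall>e. holds (\<lambda>R. R) p e) \<longleftrightarrow> (\<forall>e. holds (star E) p e))"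

text \<open>
  Internal sets are the sections of the sets \<open>*R\<close> at internal parameters. If the universe
  contains the subsets of a set \<open>A\<close>, membership is one of the relations \<open>R\<close>, and the
  elements of \<open>*P(A)\<close> are obtained in this way.
\<close>

definition internal_set :: "('u, 'v, 'k::finite) extension \<Rightarrow> 'v set \<Rightarrow> bool" where
  "internal_set E A \<longleftrightarrow> (\<exists>R ps. A = {v. v # ps \<in> star E R})"

text \<open>
  Saturation for a cardinal \<open>\<kappa>\<close>, in the convention that bounds the families by strictly
  fewer than \<open>\<kappa>\<close> members.
\<close>

definition saturated :: "('u, 'v, 'k::finite) extension \<Rightarrow> 'c rel \<Rightarrow> bool" where
  "saturated E \<kappa> \<longleftrightarrow>
     (\<forall>\<A>. (\<forall>A\<in>\<A>. internal_set E A) \<longrightarrow> ( |\<A>| <o \<kappa> ) \<longrightarrow>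
          (\<forall>\<F>. \<F> \<subseteq> \<A> \<longrightarrow> finite \<F> \<longrightarrow> \<Inter>\<F> \<noteq> {}) \<longrightarrow> \<Inter>\<A> \<noteq> {})"

definition std :: "('u, 'v, 'k::finite) extension \<Rightarrow> 'u \<Rightarrow> 'v" where
  "std E a = (THE v. [v] \<in> star E {[a]})"

text \<open>The value at the internal arguments \<open>vs\<close> of the extension of the standard function
  with graph \<open>G\<close>.\<close>

definition star_app :: "('u, 'v, 'k::finite) extension \<Rightarrow> 'u list set \<Rightarrow> 'v list \<Rightarrow> 'v" where
  "star_app E G vs = (THE w. vs @ [w] \<in> star E G)"

section \<open>Hyperreal numbers and points\<close>

definition hyperpoints :: "('u, 'v, 'k::finite) extension \<Rightarrow> 'v set" where
  "hyperpoints E = {x. [x] \<in> star E {[pt_in E a] | a. True}}"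

definition hzero :: "('u, 'v, 'k::finite) extension \<Rightarrow> 'v" where
  "hzero E = std E (real_in E 0)"

definition hfinite :: "('u, 'v, 'k::finite) extension \<Rightarrow> 'v \<Rightarrow> bool" where
  "hfinite E x \<longleftrightarrow> (\<exists>r::real. [x] \<in> star E {[real_in E a] | a. \<bar>a\<bar> \<le> r})"

text \<open>\<open>|x - y| < r\<close> for every standard \<open>r > 0\<close>; both hold only for hyperreals
  and hyperpoints, respectively.\<close>

definition near :: "('u, 'v, 'k::finite) extension \<Rightarrow> 'v \<Rightarrow> 'v \<Rightarrow> bool" where
  "near E x y \<longleftrightarrow> (\<forall>r>0. [x, y] \<in> star E {[real_in E a, real_in E b] | a b. \<bar>a - b\<bar> < r})"

definition hfinite_pt :: "('u, 'v, 'k::finite) extension \<Rightarrow> 'v \<Rightarrow> bool" where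
  "hfinite_pt E x \<longleftrightarrow> (\<exists>r::real. [x] \<in> star E {[pt_in E a] | a. norm a \<le> r})"

definition near_pt :: "('u, 'v, 'k::finite) extension \<Rightarrow> 'v \<Rightarrow> 'v \<Rightarrow> bool" where
  "near_pt E x y \<longleftrightarrow> (\<forall>r>0. [x, y] \<in> star E {[pt_in E a, pt_in E b] | a b. dist a b < r})"

definition st :: "('u, 'v, 'k::finite) extension \<Rightarrow> 'v \<Rightarrow> real" where
  "st E x = (THE r. near E x (std E (real_in E r)))"

text \<open>The standard parts of the finite elements of a set of hyperpoints.\<close>

definition st_set :: "('u, 'v, 'k::finite) extension \<Rightarrow> 'v set \<Rightarrow> (real ^ 'k) set" where
  "st_set E X = {y. \<exists>x\<in>X. near_pt E x (std E (pt_in E y))}"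

definition infinite_hypernat :: "('u, 'v, 'k::finite) extension \<Rightarrow> 'v \<Rightarrow> bool" where
  "infinite_hypernat E n0 \<longleftrightarrow>
     (\<forall>m::nat. [n0] \<in> star E {[real_in E (of_nat n)] | n. m < n})"

section \<open>The grid and grid functions\<close>

text \<open>
  The objects depending on \<open>N\<^sub>0\<close> are the values at \<open>N\<^sub>0\<close> of the extensions of the
  following standard families, indexed by \<open>n \<in> \<nat>\<close>: the step \<open>1/n!\<close>, the grid
  \<open>{j/n! : j \<in> \<int>, -(n!)\<^sup>2 \<le> j \<le> (n!)\<^sup>2}\<^sup>k\<close>, the inner product and the
  forward differences.
\<close>

definition step :: "nat \<Rightarrow> real" where
  "step n = 1 / fact n"

definition std_grid :: "nat \<Rightarrow> (real ^ 'k::finite) set" where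
  "std_grid n = {x. \<forall>i. \<exists>j::int. - ((fact n)\<^sup>2) \<le> j \<and> j \<le> (fact n)\<^sup>2 \<and> x $ i = of_int j * step n}"

definition std_inner :: "nat \<Rightarrow> (real ^ 'k::finite \<Rightarrow> real) \<Rightarrow> (real ^ 'k \<Rightarrow> real) \<Rightarrow> real" where
  "std_inner n f g = step n ^ CARD('k) * (\<Sum>x\<in>std_grid n. f x * g x)"

definition std_diff :: "nat \<Rightarrow> 'k \<Rightarrow> (real ^ 'k::finite \<Rightarrow> real) \<Rightarrow> real ^ 'k \<Rightarrow> real" where
  "std_diff n i f = (\<lambda>x. (f (x + step n *\<^sub>R axis i 1) - f x) / step n)"

definition grid :: "('u, 'v, 'k::finite) extension \<Rightarrow> 'v \<Rightarrow> 'v set" where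
  "grid E n0 = {x. [n0, x] \<in> star E {[real_in E (of_nat n), pt_in E a] | n a. a \<in> std_grid n}}"

definition Omega_grid :: "('u, 'v, 'k::finite) extension \<Rightarrow> 'v \<Rightarrow> (real ^ 'k) set \<Rightarrow> 'v set" where
  "Omega_grid E n0 \<Omega> = {x. [x] \<in> star E {[pt_in E a] | a. a \<in> \<Omega>}} \<inter> grid E n0"

text \<open>Internal functions \<open>*\<real>\<^sup>k \<rightarrow> *\<real>\<close> are the elements of the extension of the set of
  all functions \<open>\<real>\<^sup>k \<rightarrow> \<real>\<close>.\<close>

definition internal_funs :: "('u, 'v, 'k::finite) extension \<Rightarrow> 'v set" where
  "internal_funs E = {F. [F] \<in> star E {[fun_in E f] | f. True}}"

definition happ :: "('u, 'v, 'k::finite) extension \<Rightarrow> 'v \<Rightarrow> 'v \<Rightarrow> 'v" where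
  "happ E F x = star_app E {[fun_in E f, pt_in E a, real_in E (f a)] | f a. True} [F, x]"

definition hplus :: "('u, 'v, 'k::finite) extension \<Rightarrow> 'v \<Rightarrow> 'v \<Rightarrow> 'v" where
  "hplus E F G = star_app E {[fun_in E f, fun_in E g, fun_in E (\<lambda>x. f x + g x)] | f g. True} [F, G]"

definition hscale :: "('u, 'v, 'k::finite) extension \<Rightarrow> real \<Rightarrow> 'v \<Rightarrow> 'v" where
  "hscale E r F = star_app E {[fun_in E f, fun_in E (\<lambda>x. r * f x)] | f. True} [F]"

text \<open>
  An internal function with domain \<open>\<Omega>\<^sub>X\<close> is represented by its extension by zero to
  \<open>*\<real>\<^sup>k\<close>. Every such function has exactly one representative.
\<close>

definition grid_functions ::
    "('u, 'v, 'k::finite) extension \<Rightarrow> 'v \<Rightarrow> (real ^ 'k) set \<Rightarrow> 'v set" where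
  "grid_functions E n0 \<Omega> =
     {F \<in> internal_funs E. \<forall>x \<in> hyperpoints E - Omega_grid E n0 \<Omega>. happ E F x = hzero E}"

definition grid_inner :: "('u, 'v, 'k::finite) extension \<Rightarrow> 'v \<Rightarrow> 'v \<Rightarrow> 'v \<Rightarrow> 'v" where
  "grid_inner E n0 F G =
     star_app E {[real_in E (of_nat n), fun_in E f, fun_in E g, real_in E (std_inner n f g)] | n f g. True}
       [n0, F, G]"

text \<open>
  \<open>\<D>\<^sup>\<alpha>\<close>, the multi-index \<open>\<alpha>\<close> being given as a list of directions in which
  \<open>i\<close> occurs \<open>\<alpha>\<^sub>i\<close> times; forward differences commute, so the order is irrelevant.
  The result is only ever evaluated at points nearstandard in \<open>\<Omega>\<close>. There every grid point
  used lies in \<open>\<Omega>\<^sub>X\<close>, so that the extension by zero plays no role.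
\<close>

definition grid_diff :: "('u, 'v, 'k::finite) extension \<Rightarrow> 'v \<Rightarrow> 'k list \<Rightarrow> 'v \<Rightarrow> 'v" where
  "grid_diff E n0 is F =
     star_app E {[real_in E (of_nat n), fun_in E f, fun_in E (foldr (std_diff n) is f)] | n f. True}
       [n0, F]"

definition nearstandard :: "('u, 'v, 'k::finite) extension \<Rightarrow> 'v \<Rightarrow> (real ^ 'k) set \<Rightarrow> 'v set" where
  "nearstandard E n0 \<Omega> = {x \<in> Omega_grid E n0 \<Omega>. \<exists>y\<in>\<Omega>. near_pt E x (std E (pt_in E y))}"

definition class_S0 :: "('u, 'v, 'k::finite) extension \<Rightarrow> 'v \<Rightarrow> (real ^ 'k) set \<Rightarrow> 'v \<Rightarrow> bool" where
  "class_S0 E n0 \<Omega> F \<longleftrightarrow>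
     (\<exists>x \<in> nearstandard E n0 \<Omega>. hfinite E (happ E F x)) \<and>
     (\<forall>x \<in> nearstandard E n0 \<Omega>. \<forall>y \<in> nearstandard E n0 \<Omega>.
        near_pt E x y \<longrightarrow> near E (happ E F x) (happ E F y))"

definition class_Sinf :: "('u, 'v, 'k::finite) extension \<Rightarrow> 'v \<Rightarrow> (real ^ 'k) set \<Rightarrow> 'v \<Rightarrow> bool" where
  "class_Sinf E n0 \<Omega> F \<longleftrightarrow> (\<forall>is. class_S0 E n0 \<Omega> (grid_diff E n0 is F))"

definition grid_supp :: "('u, 'v, 'k::finite) extension \<Rightarrow> 'v \<Rightarrow> (real ^ 'k) set \<Rightarrow> 'v \<Rightarrow> 'v set" where
  "grid_supp E n0 \<Omega> F = {x \<in> Omega_grid E n0 \<Omega>. happ E F x \<noteq> hzero E}"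

text \<open>
  Compact containment of the support in \<open>\<Omega>\<close> includes that the support has no infinite
  points, which the set of the standard parts does not see. If \<open>\<Omega>\<close> is bounded this holds
  automatically. For unbounded \<open>\<Omega>\<close> it cannot be dropped: arbitrarily large multiples of the
  indicator of an infinite grid point would be test functions, all grid distributions would vanish
  outside some standard ball, and the distributions without compact support would not be represented.
\<close>

definition grid_test_functions ::
    "('u, 'v, 'k::finite) extension \<Rightarrow> 'v \<Rightarrow> (real ^ 'k) set \<Rightarrow> 'v set" where
  "grid_test_functions E n0 \<Omega> =
     {F \<in> grid_functions E n0 \<Omega>. class_Sinf E n0 \<Omega> F \<and>
        (\<forall>x \<in> grid_supp E n0 \<Omega> F. hfinite_pt E x) \<and>
        compact (closure (st_set E (grid_supp E n0 \<Omega> F))) \<and>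
        closure (st_set E (grid_supp E n0 \<Omega> F)) \<subseteq> \<Omega>}"

definition grid_distributions ::
    "('u, 'v, 'k::finite) extension \<Rightarrow> 'v \<Rightarrow> (real ^ 'k) set \<Rightarrow> 'v set" where
  "grid_distributions E n0 \<Omega> =
     {F \<in> grid_functions E n0 \<Omega>. \<forall>G \<in> grid_test_functions E n0 \<Omega>. hfinite E (grid_inner E n0 F G)}"

definition grid_equiv ::
    "('u, 'v, 'k::finite) extension \<Rightarrow> 'v \<Rightarrow> (real ^ 'k) set \<Rightarrow> 'v rel" where
  "grid_equiv E n0 \<Omega> =
     {(F, G). F \<in> grid_distributions E n0 \<Omega> \<and> G \<in> grid_distributions E n0 \<Omega> \<and>
        (\<forall>H \<in> grid_test_functions E n0 \<Omega>. near E (grid_inner E n0 F H) (grid_inner E n0 G H))}"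

section \<open>Test functions and distributions\<close>

definition partial :: "'k \<Rightarrow> (real ^ 'k::finite \<Rightarrow> real) \<Rightarrow> real ^ 'k \<Rightarrow> real" where
  "partial i f = (\<lambda>x. frechet_derivative f (at x) (axis i 1))"

definition smooth :: "(real ^ 'k::finite \<Rightarrow> real) \<Rightarrow> bool" where
  "smooth f \<longleftrightarrow> (\<forall>is x. foldr partial is f differentiable (at x))"

text \<open>Functions with compact support in \<open>\<Omega>\<close>, regarded as functions on all of
  \<open>\<real>\<^sup>k\<close>. The definition is also used with a compact set in place of \<open>\<Omega>\<close>.\<close>

definition test_functions :: "(real ^ 'k::finite) set \<Rightarrow> (real ^ 'k \<Rightarrow> real) set" where
  "test_functions \<Omega> =
     {\<phi>. smooth \<phi> \<and> compact (closure {x. \<phi> x \<noteq> 0}) \<and> closure {x. \<phi> x \<noteq> 0} \<subseteq> \<Omega>}"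

text \<open>
  The usual inductive limit topology of \<open>\<D>(\<Omega>)\<close>: the basic neighbourhoods of zero are the
  absolutely convex sets that meet every \<open>\<D>\<^sub>K\<close>, \<open>K \<subseteq> \<Omega>\<close> compact, in a
  neighbourhood of zero for the topology of uniform convergence of all derivatives.
\<close>

definition zero_nbhd :: "(real ^ 'k::finite) set \<Rightarrow> (real ^ 'k \<Rightarrow> real) set \<Rightarrow> bool" where
  "zero_nbhd \<Omega> W \<longleftrightarrow>
     W \<subseteq> test_functions \<Omega> \<and>
     (\<forall>\<phi>\<in>W. \<forall>\<psi>\<in>W. \<forall>a b. \<bar>a\<bar> + \<bar>b\<bar> \<le> 1 \<longrightarrow> (\<lambda>x. a * \<phi> x + b * \<psi> x) \<in> W) \<and>
     (\<forall>K. compact K \<longrightarrow> K \<subseteq> \<Omega> \<longrightarrow>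
        (\<exists>m::nat. \<exists>\<delta>>0. \<forall>\<phi> \<in> test_functions K.
           (\<forall>is. length is \<le> m \<longrightarrow> (\<forall>x. \<bar>foldr partial is \<phi> x\<bar> \<le> \<delta>)) \<longrightarrow> \<phi> \<in> W))"

definition D_open :: "(real ^ 'k::finite) set \<Rightarrow> (real ^ 'k \<Rightarrow> real) set \<Rightarrow> bool" where
  "D_open \<Omega> U \<longleftrightarrow>
     U \<subseteq> test_functions \<Omega> \<and>
     (\<forall>\<phi>\<in>U. \<exists>W. zero_nbhd \<Omega> W \<and> (\<forall>\<psi>\<in>W. (\<lambda>x. \<phi> x + \<psi> x) \<in> U))"

definition D_topology :: "(real ^ 'k::finite) set \<Rightarrow> (real ^ 'k \<Rightarrow> real) topology" where
  "D_topology \<Omega> = topology (D_open \<Omega>)"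

lemma zero_nbhd_Int:
  assumes "zero_nbhd \<Omega> V" "zero_nbhd \<Omega> W"
  shows "zero_nbhd \<Omega> (V \<inter> W)"
proof -
  have "\<exists>m. \<exists>\<delta>>0. \<forall>\<phi> \<in> test_functions K.
           (\<forall>is. length is \<le> m \<longrightarrow> (\<forall>x. \<bar>foldr partial is \<phi> x\<bar> \<le> \<delta>)) \<longrightarrow> \<phi> \<in> V \<inter> W"
    if K: "compact K" "K \<subseteq> \<Omega>" for K
  proof -
    obtain m1 d1 where 1: "d1 > 0" "\<And>\<phi>. \<phi> \<in> test_functions K \<Longrightarrow>
        (\<forall>is. length is \<le> m1 \<longrightarrow> (\<forall>x. \<bar>foldr partial is \<phi> x\<bar> \<le> d1)) \<Longrightarrow> \<phi> \<in> V"
      using assms(1) K unfolding zero_nbhd_def by meson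
    obtain m2 d2 where 2: "d2 > 0" "\<And>\<phi>. \<phi> \<in> test_functions K \<Longrightarrow>
        (\<forall>is. length is \<le> m2 \<longrightarrow> (\<forall>x. \<bar>foldr partial is \<phi> x\<bar> \<le> d2)) \<Longrightarrow> \<phi> \<in> W"
      using assms(2) K unfolding zero_nbhd_def by meson
    show ?thesis
      by (rule exI[of _ "max m1 m2"], rule exI[of _ "min d1 d2"]) (use 1 2 in auto)
  qed
  then show ?thesis
    using assms unfolding zero_nbhd_def by auto
qed

lemma openin_D_topology: "openin (D_topology \<Omega>) = D_open \<Omega>"
proof -
  have "istopology (D_open \<Omega>)"
    unfolding istopology_def
  proof (intro conjI allI impI)
    fix S T assume S: "D_open \<Omega> S" and T: "D_open \<Omega> T"
    have "\<exists>W. zero_nbhd \<Omega> W \<and> (\<forall>\<psi>\<in>W. (\<lambda>x. \<phi> x + \<psi> x) \<in> S \<inter> T)" if \<phi>: "\<phi> \<in> S \<inter> T" for \<phi>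
    proof -
      obtain V where V: "zero_nbhd \<Omega> V" "\<forall>\<psi>\<in>V. (\<lambda>x. \<phi> x + \<psi> x) \<in> S"
        using S \<phi> unfolding D_open_def by blast
      obtain W where W: "zero_nbhd \<Omega> W" "\<forall>\<psi>\<in>W. (\<lambda>x. \<phi> x + \<psi> x) \<in> T"
        using T \<phi> unfolding D_open_def by blast
      show ?thesis using V W zero_nbhd_Int by blast
    qed
    then show "D_open \<Omega> (S \<inter> T)"
      using S unfolding D_open_def by blast
  next
    fix \<K> assume "\<forall>K\<in>\<K>. D_open \<Omega> K"
    then show "D_open \<Omega> (\<Union>\<K>)"
      unfolding D_open_def by (meson Sup_least UnionE UnionI)
  qed
  then show ?thesis
    by (simp add: D_topology_def topology_inverse')
qed

definition distributions :: "(real ^ 'k::finite) set \<Rightarrow> ((real ^ 'k \<Rightarrow> real) \<Rightarrow> real) set" where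
  "distributions \<Omega> =
     {T \<in> extensional (test_functions \<Omega>).
        (\<forall>\<phi> \<in> test_functions \<Omega>. \<forall>\<psi> \<in> test_functions \<Omega>. T (\<lambda>x. \<phi> x + \<psi> x) = T \<phi> + T \<psi>) \<and>
        (\<forall>\<phi> \<in> test_functions \<Omega>. \<forall>r. T (\<lambda>x. r * \<phi> x) = r * T \<phi>) \<and>
        continuous_map (D_topology \<Omega>) euclideanreal T}"

section \<open>The two vector spaces and the map between them\<close>

definition real_field :: "real ring" where
  "real_field = \<lparr>carrier = UNIV, mult = (*), one = 1, zero = 0, add = (+)\<rparr>"

lemma field_real_field: "field real_field"
proof -
  have "cring real_field"
    by (unfold_locales)
      (auto simp: real_field_def algebra_simps Units_def intro: exI[of _ "- x" for x])
  moreover have "Units real_field = carrier real_field - {\<zero>\<^bsub>real_field\<^esub>}"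
    by (auto simp: real_field_def Units_def intro: exI[of _ "1 / x" for x])
  ultimately show ?thesis by (rule cring.cring_fieldI)
qed

text \<open>The ring multiplication and unit in a module record are irrelevant for vector spaces.\<close>

definition distribution_space ::
    "(real ^ 'k::finite) set \<Rightarrow> (real, (real ^ 'k \<Rightarrow> real) \<Rightarrow> real) module" where
  "distribution_space \<Omega> =
     \<lparr>carrier = distributions \<Omega>, mult = undefined, one = undefined,
      zero = (\<lambda>\<phi> \<in> test_functions \<Omega>. 0),
      add = (\<lambda>S T. \<lambda>\<phi> \<in> test_functions \<Omega>. S \<phi> + T \<phi>),
      smult = (\<lambda>r T. \<lambda>\<phi> \<in> test_functions \<Omega>. r * T \<phi>)\<rparr>"

abbreviation grid_class ::
    "('u, 'v, 'k::finite) extension \<Rightarrow> 'v \<Rightarrow> (real ^ 'k) set \<Rightarrow> 'v \<Rightarrow> 'v set" where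
  "grid_class E n0 \<Omega> F \<equiv> grid_equiv E n0 \<Omega> `` {F}"

definition grid_quotient ::
    "('u, 'v, 'k::finite) extension \<Rightarrow> 'v \<Rightarrow> (real ^ 'k) set \<Rightarrow> (real, 'v set) module" where
  "grid_quotient E n0 \<Omega> =
     \<lparr>carrier = grid_distributions E n0 \<Omega> // grid_equiv E n0 \<Omega>,
      mult = undefined, one = undefined,
      zero = grid_class E n0 \<Omega> (std E (fun_in E (\<lambda>x. 0))),
      add = (\<lambda>A B. \<Union>F\<in>A. \<Union>G\<in>B. grid_class E n0 \<Omega> (hplus E F G)),
      smult = (\<lambda>r A. \<Union>F\<in>A. grid_class E n0 \<Omega> (hscale E r F))\<rparr>"

definition real_vector_space_iso :: "(real, 'a) module \<Rightarrow> (real, 'b) module \<Rightarrow> ('a \<Rightarrow> 'b) \<Rightarrow> bool" where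
  "real_vector_space_iso V W h \<longleftrightarrow>
     Module.module real_field V \<and> Module.module real_field W \<and>
     bij_betw h (carrier V) (carrier W) \<and>
     (\<forall>x \<in> carrier V. \<forall>y \<in> carrier V. h (x \<oplus>\<^bsub>V\<^esub> y) = h x \<oplus>\<^bsub>W\<^esub> h y) \<and>
     (\<forall>r. \<forall>x \<in> carrier V. h (r \<odot>\<^bsub>V\<^esub> x) = r \<odot>\<^bsub>W\<^esub> h x)"

text \<open>
  \<open>the_elem\<close> picks the common value of \<open>\<langle>f, *\<phi>\<rangle>\<close>'s standard part over all
  representatives \<open>f\<close> of the class; that there is a common value is part of the theorem.
\<close>

definition Phi :: "('u, 'v, 'k::finite) extension \<Rightarrow> 'v \<Rightarrow> (real ^ 'k) set \<Rightarrow>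
    'v set \<Rightarrow> (real ^ 'k \<Rightarrow> real) \<Rightarrow> real" where
  "Phi E n0 \<Omega> A =
     (\<lambda>\<phi> \<in> test_functions \<Omega>. the_elem ((\<lambda>F. st E (grid_inner E n0 F (std E (fun_in E \<phi>)))) ` A))"

end

theory Submission
  imports Defs
begin

text \<open>
  Finitely many internal objects \<open>v\<^sub>1, \<dots>, v\<^sub>m\<close> determine an ultrafilter on the standard
  \<open>m\<close>-tuples (the sets \<open>R\<close> with \<open>(v\<^sub>1, \<dots>, v\<^sub>m) \<in> *R\<close>), and modulo it internal objects are
  functions of the tuple. Nearness is convergence along the ultrafilter, and overspill becomes a
  diagonal argument along the infinite number \<open>N\<^sub>0\<close>.

  A grid test function \<open>g\<close> has bounded difference quotients of all orders (walk out of its support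
  in finitely many small steps), so its standard part \<open>\<phi>\<close> is smooth and all difference
  quotients of \<open>g - *\<phi>\<close> are infinitesimal. Hence \<open>\<lambda> (g - *\<phi>)\<close> is a test function for some
  infinite \<open>\<lambda>\<close>, and \<open>\<langle>f, g\<rangle> \<approx> \<langle>f, *\<phi>\<rangle>\<close> for every grid distribution \<open>f\<close>; this gives
  injectivity. The same scaling argument gives the continuity of \<open>\<phi> \<mapsto> \<degree>\<langle>f, *\<phi>\<rangle>\<close>.

  For surjectivity let \<open>b\<^sub>x\<close>, \<open>x\<close> in the grid of mesh \<open>1/n!\<close>, be a smooth partition of unity by bumps of
  radius about \<open>1/n\<close>, and put \<open>f\<^sub>n(x) = n!\<^sup>k T(b\<^sub>x)\<close>. Then \<open>\<langle>f\<^sub>n, g\<rangle> = T(\<Sum>\<^sub>x g(x) b\<^sub>x)\<close>. The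
  difference quotients of \<open>\<Sum>\<^sub>x g(x) b\<^sub>x\<close> are the averages \<open>\<Sum>\<^sub>x (D\<^sup>\<alpha>g)(x) b\<^sub>x\<close>, and they agree with the
  derivatives up to an error \<open>O(n\<^sup>p / n!)\<close>. Hence \<open>f\<^sub>n\<close> at \<open>n = N\<^sub>0\<close> is a grid distribution
  that represents \<open>T\<close>.
\<close>

section \<open>Internal objects as functions modulo an ultrafilter\<close>

text \<open>The standard universe is only known to contain reals, points and functions, so internal
  sequences of functions need not be objects of \<open>E\<close>; such arguments are carried out
  with ordinary functions on the index set of an ultrafilter. A model represents only the objects it
  was built from, and statements about all hyperpoints or all grid test functions reach beyond it:
  they are proved by passing to a new model in which the further object is represented too. What
  survives the passage are properties at N_0 of pairs (n, f) and statements formulated with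
  \<open>E\<close> alone. The two scales 1/n and 1/n! are what makes the representation of T work. T
  sees derivatives of smooth functions, whereas a grid test function controls only its difference
  quotients. Bumps of width about 1/n! would vary too much over one step for the two to be compared;
  bumps of width 1/n lose only a power of n with each derivative, and 1/n! outweighs every power of
  n. At n = N_0 the width 1/n is still infinitesimal, so that smearing leaves the standard part of a
  test function unchanged.\<close>

abbreviation partials :: "'k::finite list \<Rightarrow> (real ^ 'k \<Rightarrow> real) \<Rightarrow> real ^ 'k \<Rightarrow> real" where
  "partials \<equiv> foldr partial"

abbreviation diffs :: "nat \<Rightarrow> 'k::finite list \<Rightarrow> (real ^ 'k \<Rightarrow> real) \<Rightarrow> real ^ 'k \<Rightarrow> real" where
  "diffs n \<equiv> foldr (std_diff n)"

abbreviation Imp :: "'u formula \<Rightarrow> 'u formula \<Rightarrow> 'u formula" where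
  "Imp p q \<equiv> Neg (Conj p (Neg q))"

abbreviation Iff :: "'u formula \<Rightarrow> 'u formula \<Rightarrow> 'u formula" where
  "Iff p q \<equiv> Conj (Imp p q) (Imp q p)"

locale nonstandard =
  fixes E :: "('u, 'v, 'k::finite) extension"
  assumes ne: "nonstandard_extension E"
begin

lemma transfer: "(\<And>e. holds (\<lambda>R. R) p e) \<Longrightarrow> holds (star E) p e"
  using ne unfolding nonstandard_extension_def by blast

text \<open>Reads a list of internal objects as the values of the variables 0, 1, ..., so that facts
  about lists can be transferred as formulas in these variables.\<close>

lemma env: "\<exists>e. vs = map e [0..<length vs]"
  by (rule exI[of _ "(!) vs"]) (simp add: map_nth)

lemma star_UNIV: "vs \<in> star E UNIV"
proof -
  obtain e where e: "vs = map e [0..<length vs]" using env by blast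
  show ?thesis
    using transfer[of "Rel UNIV [0..<length vs]" e] by (simp flip: e)
qed

lemma star_Int: "vs \<in> star E (R \<inter> S) \<longleftrightarrow> vs \<in> star E R \<and> vs \<in> star E S"
proof -
  obtain e where e: "vs = map e [0..<length vs]" using env by blast
  let ?l = "[0..<length vs]"
  show ?thesis
    using transfer[of "Iff (Rel (R \<inter> S) ?l) (Conj (Rel R ?l) (Rel S ?l))" e]
    by (auto simp flip: e)
qed

lemma star_Compl: "vs \<in> star E (- R) \<longleftrightarrow> vs \<notin> star E R"
proof -
  obtain e where e: "vs = map e [0..<length vs]" using env by blast
  let ?l = "[0..<length vs]"
  show ?thesis
    using transfer[of "Iff (Rel (- R) ?l) (Neg (Rel R ?l))" e]
    by (auto simp flip: e)
qed

text \<open>An atomic formula may list its variables in any order and with repetitions. Selecting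
  the entries by \<open>is\<close> can thus be done in the formula or in the relation, and the
  equivalence of the two transfers.\<close>

lemma star_reindex:
  assumes "set is \<subseteq> {..<length vs}"
  shows "map ((!) vs) is \<in> star E R \<longleftrightarrow> vs \<in> star E {us. map ((!) us) is \<in> R}"
proof -
  obtain e where e: "vs = map e [0..<length vs]" using env by blast
  let ?l = "[0..<length vs]"
  have nth: "map ((!) (map e' ?l)) is = map e' is" for e' :: "nat \<Rightarrow> 'c"
    using assms by auto
  have sel: "map e is = map ((!) vs) is"
    using nth[of e] by (simp flip: e)
  have "holds (star E) (Iff (Rel R is) (Rel {us. map ((!) us) is \<in> R} ?l)) e"
    by (rule transfer) (simp only: holds.simps mem_Collect_eq nth, blast)
  then show ?thesis
    unfolding holds.simps sel e[symmetric] by blast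
qed

text \<open>The quantified variable is the fresh one, numbered \<open>length vs\<close>. This
  supplies the values of standard functions at internal arguments in \<open>ex_los\<close>.\<close>

lemma star_Ex: "vs \<in> star E {us. \<exists>a. us @ [a] \<in> R} \<longleftrightarrow> (\<exists>w. vs @ [w] \<in> star E R)"
proof -
  obtain e where e: "vs = map e [0..<length vs]" using env by blast
  let ?n = "length vs"
  let ?l = "[0..<length vs]"
  have upd: "map (e'(?n := a)) ?l = map e' ?l" for e' :: "nat \<Rightarrow> 'c" and a
    by auto
  show ?thesis
    using transfer[of "Iff (Rel {us. \<exists>a. us @ [a] \<in> R} ?l) (Neg (All ?n (Neg (Rel R (?l @ [?n])))))" e]
    by (simp add: upd flip: e) blast
qed

text \<open>The relation symbol for the diagonal and the logical symbol \<open>Eq\<close> agree in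
  the standard universe, hence also in the other one. This is how equality almost everywhere becomes
  equality of internal objects.\<close>

lemma star_eq: "[a, b] \<in> star E {[x, x] | x. True} \<longleftrightarrow> a = b"
  using transfer[of "Iff (Rel {[x, x] | x. True} [0, 1]) (Eq 0 1)" "\<lambda>i. if i = 0 then a else b"]
  by auto

lemma star_functional:
  assumes "\<And>us a b. us @ [a] \<in> G \<Longrightarrow> us @ [b] \<in> G \<Longrightarrow> a = b"
    and "vs @ [v] \<in> star E G" "vs @ [w] \<in> star E G"
  shows "v = w"
proof -
  define e where "e = (\<lambda>i. if i < length vs then vs ! i else if i = length vs then v else w)"
  let ?n = "length vs"
  let ?l = "[0..<length vs]"
  have vs: "map e ?l = vs"
    unfolding e_def by (rule nth_equalityI) auto
  have "holds (star E) (Imp (Conj (Rel G (?l @ [?n])) (Rel G (?l @ [?n + 1]))) (Eq ?n (?n + 1))) e"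
    by (rule transfer) (use assms(1) in auto)
  moreover have "e ?n = v" "e (Suc ?n) = w"
    by (auto simp: e_def)
  ultimately show ?thesis
    using assms(2,3) by (simp add: vs)
qed

lemma star_app_eq:
  assumes "\<And>us a b. us @ [a] \<in> G \<Longrightarrow> us @ [b] \<in> G \<Longrightarrow> a = b" "vs @ [v] \<in> star E G"
  shows "star_app E G vs = v"
  unfolding star_app_def
  by (rule the_equality) (use star_functional assms in blast)+

text \<open>\<open>type_filter vs\<close> is the complete type of \<open>vs\<close> over the standard universe.\<close>

definition type_filter :: "'v list \<Rightarrow> 'u list filter" where
  "type_filter vs = Abs_filter (\<lambda>P. vs \<in> star E {us. P us})"

lemma eventually_type_filter: "eventually P (type_filter vs) \<longleftrightarrow> vs \<in> star E {us. P us}"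
  unfolding type_filter_def
proof (rule eventually_Abs_filter, rule is_filter.intro)
  show "vs \<in> star E {us. True}" using star_UNIV by simp
  show "vs \<in> star E {us. P us \<and> Q us}" if "vs \<in> star E {us. P us}" "vs \<in> star E {us. Q us}" for P Q
    using that star_Int[of vs "Collect P" "Collect Q"] by (simp add: Collect_conj_eq)
  show "vs \<in> star E {us. Q us}" if "\<forall>us. P us \<longrightarrow> Q us" "vs \<in> star E {us. P us}" for P Q
  proof -
    have "Collect P = Collect P \<inter> Collect Q" using that(1) by auto
    then show ?thesis using that(2) star_Int[of vs "Collect P" "Collect Q"] by simp
  qed
qed

text \<open>The ultrapower modulo \<open>U\<close>, restricted to the functions on the index type, embeds in
  the nonstandard universe by \<open>j\<close>.\<close>

definition los :: "'i filter \<Rightarrow> (('i \<Rightarrow> 'u) \<Rightarrow> 'v) \<Rightarrow> bool" where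
  "los U j \<longleftrightarrow> (\<forall>P. eventually P U \<or> eventually (\<lambda>i. \<not> P i) U) \<and> U \<noteq> bot \<and>
     (\<forall>R Xs. map j Xs \<in> star E R \<longleftrightarrow> (\<forall>\<^sub>F i in U. map (\<lambda>X. X i) Xs \<in> R))"

text \<open>The indices are the standard lists, \<open>U\<close> is the type of \<open>vs\<close>,
  and \<open>j X\<close> is the value at \<open>vs\<close> of the extension of the standard function
  \<open>X\<close>. Los's theorem holds for \<open>j\<close> because whether values of standard
  functions satisfy a relation can be decided on the arguments, that is, in the type of
  \<open>vs\<close>.\<close>

lemma ex_los: "\<exists>(U :: 'u list filter) j. los U j \<and> set vs \<subseteq> range j"
proof -
  let ?n = "length vs"
  \<comment> \<open>Every standard list can be prolonged by its value under \<open>X\<close>, hence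
    so can \<open>vs\<close>.\<close>
  have "\<exists>w. vs @ [w] \<in> star E {us @ [X us] | us. True}" for X
  proof -
    have "vs \<in> star E {us. \<exists>a. us @ [a] \<in> {us @ [X us] | us. True}}"
      using star_UNIV[of vs] by simp
    then show ?thesis unfolding star_Ex .
  qed
  note ex = this
  define j where "j = (\<lambda>X. SOME w. vs @ [w] \<in> star E {us @ [X us] | us. True})"
  have j: "vs @ [j X] \<in> star E {us @ [X us] | us. True}" for X
    unfolding j_def using ex[of X] by (rule someI_ex)
  \<comment> \<open>The type of a selection of entries of \<open>ws\<close> is the image of the type
    of \<open>ws\<close> under the same selection.\<close>
  have reindex: "eventually P (type_filter (map ((!) ws) is)) \<longleftrightarrow>
      eventually (\<lambda>us. P (map ((!) us) is)) (type_filter ws)" if "set is \<subseteq> {..<length ws}" for P ws "is"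
    unfolding eventually_type_filter using star_reindex[OF that, of "Collect P"] by simp
  have len: "eventually (\<lambda>us. length us = length ws) (type_filter ws)" for ws
  proof -
    obtain e where e: "ws = map e [0..<length ws]" using env by blast
    show ?thesis
      using transfer[of "Rel {us. length us = length ws} [0..<length ws]" e]
      unfolding eventually_type_filter by (simp flip: e)
  qed
  \<comment> \<open>Each entry behind the arguments is tied to them by its own graph, and finitely
    many such conditions hold jointly.\<close>
  have app: "eventually (\<lambda>us. length us = ?n + length Xs \<and>
      drop ?n us = map (\<lambda>X. X (take ?n us)) Xs) (type_filter (vs @ map j Xs))" for Xs
  proof -
    let ?ws = "vs @ map j Xs"
    have "eventually (\<lambda>us. us ! (?n + m) = (Xs ! m) (take ?n us)) (type_filter ?ws)"
      if m: "m < length Xs" for m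
    proof -
      let ?is = "[0..<?n] @ [?n + m]"
      have ws: "map ((!) ?ws) ?is = vs @ [j (Xs ! m)]"
        using m by (intro nth_equalityI) (auto simp: nth_append nth_Cons split: nat.splits)
      have "eventually (\<lambda>us. map ((!) us) ?is \<in> {us @ [(Xs ! m) us] | us. True}) (type_filter ?ws)"
      proof (subst reindex[symmetric])
        show "set ?is \<subseteq> {..<length ?ws}" using m by auto
        show "eventually (\<lambda>us. us \<in> {us @ [(Xs ! m) us] | us. True}) (type_filter (map ((!) ?ws) ?is))"
          unfolding ws eventually_type_filter using j[of "Xs ! m"] by simp
      qed
      with len[of ?ws] show ?thesis
      proof eventually_elim
        case (elim us)
        have "map ((!) us) [0..<?n] = take ?n us"
          using elim(1) by (intro nth_equalityI) auto
        then show ?case using elim(2) by auto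
      qed
    qed
    then have "eventually (\<lambda>us. \<forall>m\<in>{..<length Xs}. us ! (?n + m) = (Xs ! m) (take ?n us)) (type_filter ?ws)"
      by (intro eventually_ball_finite) auto
    with len[of ?ws] show ?thesis
    proof eventually_elim
      case (elim us)
      then show ?case by (auto intro!: nth_equalityI)
    qed
  qed
  have take: "eventually P (type_filter vs) \<longleftrightarrow>
      eventually (\<lambda>us. P (take ?n us)) (type_filter (vs @ map j Xs))" for P Xs
  proof -
    let ?ws = "vs @ map j Xs"
    have ws: "map ((!) ?ws) [0..<?n] = vs"
      by (intro nth_equalityI) (auto simp: nth_append nth_Cons split: nat.splits)
    have "eventually P (type_filter vs) \<longleftrightarrow>
        eventually (\<lambda>us. P (map ((!) us) [0..<?n])) (type_filter ?ws)"
      by (subst reindex[symmetric]) (auto simp: ws simp del: map_append)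
    also have "\<dots> \<longleftrightarrow> eventually (\<lambda>us. P (take ?n us)) (type_filter ?ws)"
    proof (rule eventually_cong[OF len[of ?ws]])
      fix us :: "'u list" assume "length us = length ?ws"
      then have "map ((!) us) [0..<?n] = take ?n us"
        by (intro nth_equalityI) auto
      then show "P (map ((!) us) [0..<?n]) = P (take ?n us)" by simp
    qed
    finally show ?thesis .
  qed
  have drop: "map j Xs \<in> star E R \<longleftrightarrow>
      eventually (\<lambda>us. drop ?n us \<in> R) (type_filter (vs @ map j Xs))" for Xs R
  proof -
    let ?ws = "vs @ map j Xs"
    let ?is = "[?n..<?n + length Xs]"
    have ws: "map ((!) ?ws) ?is = map j Xs"
      by (intro nth_equalityI) (auto simp: nth_append nth_Cons split: nat.splits)
    have "map j Xs \<in> star E R \<longleftrightarrow> eventually (\<lambda>us. map ((!) us) ?is \<in> R) (type_filter ?ws)"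
      by (subst reindex[of ?is ?ws "\<lambda>us. us \<in> R", symmetric])
        (auto simp: ws eventually_type_filter simp del: map_append)
    also have "\<dots> \<longleftrightarrow> eventually (\<lambda>us. drop ?n us \<in> R) (type_filter ?ws)"
    proof (rule eventually_cong[OF len[of ?ws]])
      fix us :: "'u list" assume "length us = length ?ws"
      then have "map ((!) us) ?is = drop ?n us"
        by (intro nth_equalityI) auto
      then show "(map ((!) us) ?is \<in> R) = (drop ?n us \<in> R)" by simp
    qed
    finally show ?thesis .
  qed
  have los: "map j Xs \<in> star E R \<longleftrightarrow> eventually (\<lambda>us. map (\<lambda>X. X us) Xs \<in> R) (type_filter vs)" for Xs R
    unfolding drop take[of _ Xs]
    by (rule eventually_cong[OF app]) auto
  have "los (type_filter vs) j"
    unfolding los_def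
  proof (intro conjI allI)
    show "eventually P (type_filter vs) \<or> eventually (\<lambda>us. \<not> P us) (type_filter vs)" for P
      using star_Compl[of vs "Collect P"] unfolding eventually_type_filter
      by (auto simp: Collect_neg_eq)
    show "type_filter vs \<noteq> bot"
      using star_Compl[of vs UNIV] star_UNIV[of vs]
      by (auto simp: trivial_limit_def eventually_type_filter)
  qed (rule los)
  \<comment> \<open>The entries of \<open>vs\<close> are the values at \<open>vs\<close> of the
    coordinate functions.\<close>
  moreover have "vs ! m = j (\<lambda>us. us ! m)" if m: "m < ?n" for m
  proof -
    let ?ws = "vs @ [j (\<lambda>us. us ! m)]"
    have ws: "map ((!) ?ws) [m, ?n] = [vs ! m, j (\<lambda>us. us ! m)]"
      using m by (auto simp: nth_append)
    have "eventually (\<lambda>us. us ! ?n = us ! m) (type_filter (vs @ map j [\<lambda>us. us ! m]))"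
      using app[of "[\<lambda>us. us ! m]"]
    proof eventually_elim
      case (elim us)
      have "us ! ?n = drop ?n us ! 0" using elim by (subst nth_drop) simp_all
      also have "\<dots> = take ?n us ! m" by (simp only: conjunct2[OF elim] nth_Cons_0 list.map)
      finally show ?case using m by simp
    qed
    then have "eventually (\<lambda>us. map ((!) us) [m, ?n] \<in> {[x, x] | x. True}) (type_filter ?ws)"
      by (simp add: eq_commute)
    then have "[vs ! m, j (\<lambda>us. us ! m)] \<in> star E {[x, x] | x. True}"
      using reindex[of "[m, ?n]" ?ws "\<lambda>us. us \<in> {[x, x] | x. True}"] m
      unfolding ws by (auto simp: eventually_type_filter)
    then show ?thesis by (simp only: star_eq)
  qed
  then have "set vs \<subseteq> range j"
    by (auto simp: in_set_conv_nth)
  ultimately show ?thesis by blast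
qed

end

lemma diagonal:
  fixes n :: "'i \<Rightarrow> nat" and P :: "nat \<Rightarrow> 'i \<Rightarrow> bool"
  assumes n: "filterlim n at_top U" and P: "\<And>m. \<forall>\<^sub>F i in U. P m i"
  shows "\<exists>M. (\<forall>\<^sub>F i in U. P (M i) i) \<and> filterlim M at_top U"
proof -
  define S where "S i = {m. m \<le> n i \<and> P m i}" for i
  define M where "M i = (if S i = {} then 0 else Max (S i))" for i
  have fin: "finite (S i)" for i
    by (rule finite_subset[of _ "{..n i}"]) (auto simp: S_def)
  have ev: "\<forall>\<^sub>F i in U. m \<in> S i" for m
    using filterlim_at_top[THEN iffD1, OF n, rule_format, of m] P[of m]
    by eventually_elim (simp add: S_def)
  have "\<forall>\<^sub>F i in U. P (M i) i"
    using ev[of 0]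
  proof eventually_elim
    case (elim i)
    then have "M i \<in> S i" using fin Max_in[of "S i"] by (auto simp: M_def)
    then show ?case by (simp add: S_def)
  qed
  moreover have "filterlim M at_top U"
    unfolding filterlim_at_top
  proof
    show "\<forall>\<^sub>F i in U. m \<le> M i" for m
      using ev[of m] by eventually_elim (use fin in \<open>auto simp: M_def\<close>)
  qed
  ultimately show ?thesis by blast
qed

definition ultra :: "'i filter \<Rightarrow> bool" where
  "ultra U \<longleftrightarrow> (\<forall>P. eventually P U \<or> eventually (\<lambda>i. \<not> P i) U) \<and> U \<noteq> bot"

lemma ultra_not: "ultra U \<Longrightarrow> (\<not> (\<forall>\<^sub>F i in U. P i)) \<longleftrightarrow> (\<forall>\<^sub>F i in U. \<not> P i)"
  unfolding ultra_def trivial_limit_def using eventually_conj[of P U "\<lambda>i. \<not> P i"] by auto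

text \<open>A filter living on a compact set has a cluster point, and an ultrafilter converges to
  its cluster points because it decides every open set. This takes the place of the nearstandardness
  of the points in the extension of a compact set.\<close>

lemma ultra_compact:
  fixes x :: "'i \<Rightarrow> 'a::topological_space"
  assumes "ultra U" "compact C" "\<forall>\<^sub>F i in U. x i \<in> C"
  shows "\<exists>y\<in>C. (x \<longlongrightarrow> y) U"
proof -
  have "filtermap x U \<noteq> bot"
    using assms(1) by (simp add: ultra_def filtermap_bot_iff)
  moreover have "eventually (\<lambda>y. y \<in> C) (filtermap x U)"
    using assms(3) by (simp add: eventually_filtermap)
  ultimately obtain y where y: "y \<in> C" "inf (nhds y) (filtermap x U) \<noteq> bot"
    using assms(2) unfolding compact_filter by blast
  have "eventually (\<lambda>i. x i \<in> S) U" if S: "open S" "y \<in> S" for S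
  proof (rule ccontr)
    assume "\<not> ?thesis"
    then have "eventually (\<lambda>i. x i \<notin> S) U"
      using assms(1) by (simp add: ultra_not)
    then have "eventually (\<lambda>z. z \<notin> S) (filtermap x U)"
      by (simp add: eventually_filtermap)
    moreover have "eventually (\<lambda>z. z \<in> S) (nhds y)"
      using S by (simp add: eventually_nhds_in_open)
    ultimately have "eventually (\<lambda>z. False) (inf (nhds y) (filtermap x U))"
      unfolding eventually_inf by blast
    then show False using y(2) by (simp add: trivial_limit_def)
  qed
  then have "(x \<longlongrightarrow> y) U"
    by (auto intro: topological_tendstoI)
  then show ?thesis using y(1) by blast
qed

lemma ultra_bounded_convergent:
  fixes a :: "'i \<Rightarrow> real"
  assumes "ultra U" "\<forall>\<^sub>F i in U. \<bar>a i\<bar> \<le> C"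
  shows "\<exists>l. (a \<longlongrightarrow> l) U"
proof -
  have "\<forall>\<^sub>F i in U. a i \<in> {-C..C}"
    using assms(2) by eventually_elim auto
  then show ?thesis using ultra_compact[OF assms(1), of "{-C..C}" a] by blast
qed

text \<open>For checking that the graphs behind \<open>happ\<close>, \<open>grid_inner\<close> and
  the other operations are single-valued.\<close>

lemma snoc_eq:
  "us @ [a] = [x, y] \<longleftrightarrow> us = [x] \<and> a = y"
  "us @ [a] = [x, y, z] \<longleftrightarrow> us = [x, y] \<and> a = z"
  "us @ [a] = [x, y, z, w] \<longleftrightarrow> us = [x, y, z] \<and> a = w"
  using append1_eq_conv[of us a "[x]" y] append1_eq_conv[of us a "[x, y]" z]
    append1_eq_conv[of us a "[x, y, z]" w] by simp_all

section \<open>Grid notions computed in a model\<close>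

locale grid_model = nonstandard E
  for E :: "('u, 'v, 'k::finite) extension" +
  fixes n0 :: 'v and U :: "'i filter" and j :: "('i \<Rightarrow> 'u) \<Rightarrow> 'v" and n :: "'i \<Rightarrow> nat"
  assumes los: "los U j"
    and n0_def: "n0 = j (\<lambda>i. real_in E (of_nat (n i)))"
    and n_inf: "filterlim n at_top U"
begin

abbreviation jr :: "('i \<Rightarrow> real) \<Rightarrow> 'v" where "jr a \<equiv> j (\<lambda>i. real_in E (a i))"
abbreviation jp :: "('i \<Rightarrow> real ^ 'k) \<Rightarrow> 'v" where "jp x \<equiv> j (\<lambda>i. pt_in E (x i))"
abbreviation jf :: "('i \<Rightarrow> real ^ 'k \<Rightarrow> real) \<Rightarrow> 'v" where "jf f \<equiv> j (\<lambda>i. fun_in E (f i))"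

lemma U_ultra: "ultra U"
  using los by (simp add: los_def ultra_def)

lemma U_nontrivial: "U \<noteq> bot"
  using los by (simp add: los_def)

lemmas not_eventually_U = ultra_not[OF U_ultra]

lemma inj_eqs [simp]:
  "real_in E a = real_in E b \<longleftrightarrow> a = b"
  "pt_in E x = pt_in E y \<longleftrightarrow> x = y"
  "fun_in E f = fun_in E g \<longleftrightarrow> f = g"
  using ne by (auto simp: nonstandard_extension_def inj_eq)

lemma los_list: "map j Xs \<in> star E R \<longleftrightarrow> (\<forall>\<^sub>F i in U. map (\<lambda>X. X i) Xs \<in> R)"
  using los by (simp add: los_def)

lemma los1: "[j X] \<in> star E R \<longleftrightarrow> (\<forall>\<^sub>F i in U. [X i] \<in> R)"
  using los_list[of "[X]"] by simp

lemma los2: "[j X, j Y] \<in> star E R \<longleftrightarrow> (\<forall>\<^sub>F i in U. [X i, Y i] \<in> R)"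
  using los_list[of "[X, Y]"] by simp

lemma j_eq: "j X = j Y \<longleftrightarrow> (\<forall>\<^sub>F i in U. X i = Y i)"
proof -
  have "(\<forall>\<^sub>F i in U. X i = Y i) \<longleftrightarrow> (\<forall>\<^sub>F i in U. [X i, Y i] \<in> {[x, x] | x. True})"
    by (rule eventually_cong[OF always_eventually]) auto
  then show ?thesis by (simp only: star_eq flip: los2)
qed

lemma star_app_j:
  assumes "\<And>us a b. us @ [a] \<in> G \<Longrightarrow> us @ [b] \<in> G \<Longrightarrow> a = b"
    and "\<forall>\<^sub>F i in U. map (\<lambda>X. X i) Xs @ [Y i] \<in> G"
  shows "star_app E G (map j Xs) = j Y"
  using star_app_eq[OF assms(1), where vs = "map j Xs" and v = "j Y"]
    los_list[of "Xs @ [Y]" G] assms(2) by simp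

lemma std_j: "std E a = j (\<lambda>_. a)"
proof -
  have "star_app E {[a]} (map j []) = j (\<lambda>_. a)"
    by (rule star_app_j) auto
  then show ?thesis by (simp add: std_def star_app_def)
qed

lemma hzero_j: "hzero E = jr (\<lambda>_. 0)"
  by (simp add: hzero_def std_j)

lemma hfinite_jr: "hfinite E (jr a) \<longleftrightarrow> (\<exists>r. \<forall>\<^sub>F i in U. \<bar>a i\<bar> \<le> r)"
  by (simp add: hfinite_def los1)

lemma near_jr: "near E (jr a) (jr b) \<longleftrightarrow> (\<forall>r>0. \<forall>\<^sub>F i in U. \<bar>a i - b i\<bar> < r)"
  by (simp add: near_def los2)

lemma near_jr_tendsto: "near E (jr a) (jr b) \<longleftrightarrow> ((\<lambda>i. a i - b i) \<longlongrightarrow> 0) U"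
  by (simp add: near_jr tendsto_iff)

lemma hfinite_pt_jp: "hfinite_pt E (jp x) \<longleftrightarrow> (\<exists>r. \<forall>\<^sub>F i in U. norm (x i) \<le> r)"
  by (simp add: hfinite_pt_def los1)

lemma near_pt_jp: "near_pt E (jp x) (jp y) \<longleftrightarrow> (\<forall>r>0. \<forall>\<^sub>F i in U. dist (x i) (y i) < r)"
  by (simp add: near_pt_def los2)

lemma near_pt_std: "near_pt E (jp x) (std E (pt_in E y)) \<longleftrightarrow> (x \<longlongrightarrow> y) U"
  by (simp add: std_j near_pt_jp tendsto_iff)

lemma st_jr:
  assumes "(a \<longlongrightarrow> l) U"
  shows "st E (jr a) = l"
  unfolding st_def
proof (rule the_equality)
  show "near E (jr a) (std E (real_in E l))"
    using assms unfolding std_j near_jr by (simp add: tendsto_iff dist_real_def)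
next
  fix r assume "near E (jr a) (std E (real_in E r))"
  then have "(a \<longlongrightarrow> r) U"
    unfolding std_j near_jr by (simp add: tendsto_iff dist_real_def)
  then show "r = l"
    using assms tendsto_unique U_nontrivial by blast
qed

lemma hyperpoints_jp: "jp x \<in> hyperpoints E"
  by (simp add: hyperpoints_def los1)

lemma grid_jp: "jp x \<in> grid E n0 \<longleftrightarrow> (\<forall>\<^sub>F i in U. x i \<in> std_grid (n i))"
  unfolding grid_def n0_def mem_Collect_eq los2
  by (rule eventually_cong[OF always_eventually]) auto

lemma Omega_grid_jp: "jp x \<in> Omega_grid E n0 \<Omega> \<longleftrightarrow> (\<forall>\<^sub>F i in U. x i \<in> \<Omega> \<inter> std_grid (n i))"
  by (simp add: Omega_grid_def grid_jp los1 eventually_conj_iff)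

lemma hyperpoints_range:
  assumes "v \<in> hyperpoints E" "v \<in> range j"
  shows "\<exists>x. v = jp x"
proof -
  obtain X where X: "v = j X" using assms(2) by blast
  then have "\<forall>\<^sub>F i in U. \<exists>a. X i = pt_in E a"
    using assms(1) by (simp add: hyperpoints_def los1)
  then have "\<forall>\<^sub>F i in U. X i = pt_in E (inv_into UNIV (pt_in E) (X i))"
    by eventually_elim (auto simp: f_inv_into_f)
  then show ?thesis unfolding X j_eq by (rule exI[of _ "\<lambda>i. inv_into UNIV (pt_in E) (X i)"])
qed

lemma Omega_grid_hyperpoints: "Omega_grid E n0 \<Omega> \<subseteq> hyperpoints E"
proof -
  have "[v] \<in> star E {[pt_in E a] |a. True}" if "[v] \<in> star E {[pt_in E a] |a. a \<in> \<Omega>}" for v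
  proof -
    have "{[pt_in E a] |a. a \<in> \<Omega>} \<inter> {[pt_in E a] |a. True} = {[pt_in E a] |a. a \<in> \<Omega>}"
      by auto
    then show ?thesis
      using that star_Int[of "[v]" "{[pt_in E a] |a. a \<in> \<Omega>}" "{[pt_in E a] |a. True}"] by simp
  qed
  then show ?thesis by (auto simp: Omega_grid_def hyperpoints_def)
qed

lemma internal_funs_jf: "jf f \<in> internal_funs E"
  by (simp add: internal_funs_def los1)

lemma internal_funs_range:
  assumes "v \<in> internal_funs E" "v \<in> range j"
  shows "\<exists>f. v = jf f"
proof -
  obtain X where X: "v = j X" using assms(2) by blast
  then have "\<forall>\<^sub>F i in U. \<exists>a. X i = fun_in E a"
    using assms(1) by (simp add: internal_funs_def los1)
  then have "\<forall>\<^sub>F i in U. X i = fun_in E (inv_into UNIV (fun_in E) (X i))"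
    by eventually_elim (auto simp: f_inv_into_f)
  then show ?thesis unfolding X j_eq by (rule exI[of _ "\<lambda>i. inv_into UNIV (fun_in E) (X i)"])
qed

lemma happ_jf: "happ E (jf f) (jp x) = jr (\<lambda>i. f i (x i))"
proof -
  have "star_app E {[fun_in E f, pt_in E a, real_in E (f a)] | f a. True} (map j [\<lambda>i. fun_in E (f i), \<lambda>i. pt_in E (x i)]) =
      j (\<lambda>i. real_in E (f i (x i)))"
    by (rule star_app_j) (auto simp: snoc_eq)
  then show ?thesis by (simp add: happ_def)
qed

lemma hplus_jf: "hplus E (jf f) (jf g) = jf (\<lambda>i x. f i x + g i x)"
proof -
  have "star_app E {[fun_in E f, fun_in E g, fun_in E (\<lambda>x. f x + g x)] | f g. True} (map j [\<lambda>i. fun_in E (f i), \<lambda>i. fun_in E (g i)]) =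
      j (\<lambda>i. fun_in E (\<lambda>x. f i x + g i x))"
    by (rule star_app_j) (auto simp: snoc_eq)
  then show ?thesis by (simp add: hplus_def)
qed

lemma hscale_jf: "hscale E r (jf f) = jf (\<lambda>i x. r * f i x)"
proof -
  have "star_app E {[fun_in E f, fun_in E (\<lambda>x. r * f x)] | f. True} (map j [\<lambda>i. fun_in E (f i)]) =
      j (\<lambda>i. fun_in E (\<lambda>x. r * f i x))"
    by (rule star_app_j) (auto simp: snoc_eq)
  then show ?thesis by (simp add: hscale_def)
qed

lemma grid_inner_jf: "grid_inner E n0 (jf f) (jf g) = jr (\<lambda>i. std_inner (n i) (f i) (g i))"
proof -
  have "star_app E {[real_in E (of_nat n), fun_in E f, fun_in E g, real_in E (std_inner n f g)] | n f g. True} (map j [\<lambda>i. real_in E (of_nat (n i)), \<lambda>i. fun_in E (f i), \<lambda>i. fun_in E (g i)]) =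
      j (\<lambda>i. real_in E (std_inner (n i) (f i) (g i)))"
    by (rule star_app_j) (auto simp: snoc_eq)
  then show ?thesis by (simp add: grid_inner_def n0_def)
qed

lemma grid_diff_jf: "grid_diff E n0 is (jf f) = jf (\<lambda>i. diffs (n i) is (f i))"
proof -
  have "star_app E {[real_in E (of_nat n), fun_in E f, fun_in E (diffs n is f)] | n f. True} (map j [\<lambda>i. real_in E (of_nat (n i)), \<lambda>i. fun_in E (f i)]) =
      j (\<lambda>i. fun_in E (diffs (n i) is (f i)))"
    by (rule star_app_j) (auto simp: snoc_eq)
  then show ?thesis by (simp add: grid_diff_def n0_def)
qed

end

text \<open>Properties in this form do not mention the ultrafilter, so they carry over from one model
  to a larger one in which further internal objects are represented.\<close>

definition holds_at :: "('u, 'v, 'k::finite) extension \<Rightarrow> 'v \<Rightarrow> 'v \<Rightarrow> (nat \<Rightarrow> (real ^ 'k \<Rightarrow> real) \<Rightarrow> bool) \<Rightarrow> bool"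
  where "holds_at E n0 F P \<longleftrightarrow> [n0, F] \<in> star E {[real_in E (of_nat n), fun_in E f] | n f. P n f}"

lemma (in grid_model) holds_at_jf: "holds_at E n0 (jf f) P \<longleftrightarrow> (\<forall>\<^sub>F i in U. P (n i) (f i))"
  unfolding holds_at_def n0_def los2
  by (rule eventually_cong[OF always_eventually]) auto

text \<open>N_0 is added to the represented objects. Off a null set its representative takes natural
  numbers as values, and that N_0 is infinite says that each standard m is eventually
  exceeded.\<close>

lemma ex_model:
  fixes E :: "('u, 'v, 'k::finite) extension"
  assumes "nonstandard_extension E" "infinite_hypernat E n0"
  shows "\<exists>(U :: 'u list filter) j n. grid_model E n0 U j n \<and> set vs \<subseteq> range j"
proof -
  interpret nonstandard E by unfold_locales fact
  obtain U :: "'u list filter" and j where j: "los U j" "set (n0 # vs) \<subseteq> range j"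
    using ex_los by blast
  obtain X where X: "n0 = j X" using j(2) by auto
  have ev: "\<forall>\<^sub>F i in U. \<exists>n. X i = real_in E (of_nat n) \<and> m < n" for m
  proof -
    have "map j [X] \<in> star E {[real_in E (of_nat n)] | n. m < n}"
      using assms(2) X by (simp add: infinite_hypernat_def)
    then have "\<forall>\<^sub>F i in U. map (\<lambda>X. X i) [X] \<in> {[real_in E (of_nat n)] | n. m < n}"
      using j(1) unfolding los_def by blast
    then show ?thesis by eventually_elim auto
  qed
  have inj: "real_in E a = real_in E b \<longleftrightarrow> a = b" for a b
    using ne by (auto simp: nonstandard_extension_def inj_eq)
  define n where "n i = (SOME n. X i = real_in E (of_nat n))" for i
  have n: "\<forall>\<^sub>F i in U. X i = real_in E (of_nat (n i))"
    using ev[of 0] unfolding n_def by eventually_elim (rule someI_ex, blast)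
  have "map j [X, \<lambda>i. real_in E (of_nat (n i))] \<in> star E {[x, x] | x. True}"
    using n by (subst j(1)[unfolded los_def, THEN conjunct2, THEN conjunct2, rule_format]) (auto elim: eventually_mono)
  then have "n0 = j (\<lambda>i. real_in E (of_nat (n i)))"
    unfolding X using star_eq by simp
  moreover have "filterlim n at_top U"
    unfolding filterlim_at_top
  proof
    show "\<forall>\<^sub>F i in U. m \<le> n i" for m
      using ev[of m] n by eventually_elim (auto simp: inj)
  qed
  ultimately have "grid_model E n0 U j n"
    using j(1) by unfold_locales
  then show ?thesis using j(2) by auto
qed

section \<open>Functions of several variables\<close>

text \<open>Coordinates are exchanged one at a time, by induction on the set of those in which the
  points may differ. The closure condition keeps the intermediate points in \<open>L\<close>; it
  holds for the whole space, for boxes and for lattices.\<close>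

lemma coordinate_chain:
  fixes f :: "real ^ 'k::finite \<Rightarrow> real"
  assumes L: "\<And>x y i. x \<in> L \<Longrightarrow> y \<in> L \<Longrightarrow> (\<chi> k. if k = i then x $ k else y $ k) \<in> L"
    and step: "\<And>x y i. x \<in> L \<Longrightarrow> y \<in> L \<Longrightarrow> (\<And>k. k \<noteq> i \<Longrightarrow> x $ k = y $ k) \<Longrightarrow>
      \<bar>f x - f y\<bar> \<le> C * \<bar>x $ i - y $ i\<bar>"
    and "x \<in> L" "y \<in> L"
  shows "\<bar>f x - f y\<bar> \<le> C * (\<Sum>i\<in>UNIV. \<bar>x $ i - y $ i\<bar>)"
proof -
  have "\<bar>f x - f y\<bar> \<le> C * (\<Sum>i\<in>S. \<bar>x $ i - y $ i\<bar>)"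
    if "finite S" "x \<in> L" "y \<in> L" "\<And>k. k \<notin> S \<Longrightarrow> x $ k = y $ k" for S x y
    using that
  proof (induction S arbitrary: y rule: finite_induct)
    case empty
    then have "x = y" by (simp add: vec_eq_iff)
    then show ?case by simp
  next
    case (insert i S)
    define z where "z = (\<chi> k. if k = i then x $ k else y $ k)"
    have z: "z \<in> L" unfolding z_def using insert.prems by (intro L) auto
    have "\<bar>f x - f z\<bar> \<le> C * (\<Sum>i\<in>S. \<bar>x $ i - z $ i\<bar>)"
      using insert.prems z by (intro insert.IH) (auto simp: z_def)
    also have "(\<Sum>i\<in>S. \<bar>x $ i - z $ i\<bar>) = (\<Sum>i\<in>S. \<bar>x $ i - y $ i\<bar>)"
      using insert.hyps by (intro sum.cong) (auto simp: z_def)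
    moreover have "\<bar>f z - f y\<bar> \<le> C * \<bar>z $ i - y $ i\<bar>"
      using insert.prems z by (intro step) (auto simp: z_def)
    ultimately show ?case
      using insert.hyps by (simp add: z_def distrib_left)
  qed
  then show ?thesis using assms by auto
qed

text \<open>The increment may have either sign; \<open>\<theta> * h \<ge> 0\<close> together with
  the bound puts \<theta> between 0 and h.\<close>

lemma MVT_abs:
  fixes f f' :: "real \<Rightarrow> real"
  assumes "\<And>t. (f has_real_derivative f' t) (at t)"
  shows "\<exists>\<theta>. \<bar>\<theta>\<bar> \<le> \<bar>h\<bar> \<and> \<theta> * h \<ge> 0 \<and> f h - f 0 = h * f' \<theta>"
proof (cases h "0 :: real" rule: linorder_cases)
  case less
  obtain z where "h < z" "z < 0" "f 0 - f h = (0 - h) * f' z"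
    using MVT2[OF less, of f f'] assms by blast
  then show ?thesis by (intro exI[of _ z]) (auto simp: mult_nonpos_nonpos)
next
  case equal
  then show ?thesis by (intro exI[of _ 0]) auto
next
  case greater
  obtain z where "0 < z" "z < h" "f h - f 0 = (h - 0) * f' z"
    using MVT2[OF greater, of f f'] assms by blast
  then show ?thesis by (intro exI[of _ z]) auto
qed

lemma coordinate_MVT:
  fixes f :: "real ^ 'k::finite \<Rightarrow> real"
  assumes d: "\<And>x. ((\<lambda>t. f (x + t *\<^sub>R axis i 1)) has_real_derivative g x) (at 0)"
    and eq: "\<And>k. k \<noteq> i \<Longrightarrow> x $ k = y $ k"
  shows "\<exists>\<xi>. f x - f y = (x $ i - y $ i) * g \<xi> \<and> (\<forall>k. k \<noteq> i \<longrightarrow> \<xi> $ k = y $ k) \<and>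
    \<bar>\<xi> $ i - y $ i\<bar> \<le> \<bar>x $ i - y $ i\<bar> \<and> \<bar>\<xi> $ i - x $ i\<bar> \<le> \<bar>x $ i - y $ i\<bar>"
proof -
  define h where "h = x $ i - y $ i"
  have x: "x = y + h *\<^sub>R axis i 1"
    using eq by (auto simp: vec_eq_iff h_def axis_def)
  have "((\<lambda>t. f (y + t *\<^sub>R axis i 1)) has_real_derivative g (y + s *\<^sub>R axis i 1)) (at s)" for s
  proof -
    have "((\<lambda>t. f (y + s *\<^sub>R axis i 1 + t *\<^sub>R axis i 1)) has_real_derivative g (y + s *\<^sub>R axis i 1)) (at 0)"
      by (rule d)
    then have "((\<lambda>t. f (y + (t + s) *\<^sub>R axis i 1)) has_real_derivative g (y + s *\<^sub>R axis i 1)) (at 0)"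
      by (simp add: algebra_simps)
    then show ?thesis
      using DERIV_shift[of "\<lambda>t. f (y + t *\<^sub>R axis i 1)" "g (y + s *\<^sub>R axis i 1)" 0 s] by simp
  qed
  from MVT_abs[of "\<lambda>t. f (y + t *\<^sub>R axis i 1)", OF this, of h]
  obtain \<theta> where \<theta>: "\<bar>\<theta>\<bar> \<le> \<bar>h\<bar>" "\<theta> * h \<ge> 0" "f (y + h *\<^sub>R axis i 1) - f y = h * g (y + \<theta> *\<^sub>R axis i 1)"
    by auto
  have "\<bar>\<theta> - h\<bar> \<le> \<bar>h\<bar>"
    using \<theta>(1,2) by (auto simp: zero_le_mult_iff abs_if split: if_splits)
  then show ?thesis
    using \<theta> x by (intro exI[of _ "y + \<theta> *\<^sub>R axis i 1"]) (auto simp: axis_def)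
qed

text \<open>Subtracting the candidate for the differential leaves a function \<open>F\<close> with
  small partial derivatives near x; the mean value theorem is applied to it along a path parallel to
  the axes.\<close>

lemma continuous_partials_has_derivative:
  fixes f :: "real ^ 'k::finite \<Rightarrow> real" and g :: "'k \<Rightarrow> real ^ 'k \<Rightarrow> real"
  assumes d: "\<And>x i. ((\<lambda>t. f (x + t *\<^sub>R axis i 1)) has_real_derivative g i x) (at 0)"
    and c: "\<And>i. continuous_on UNIV (g i)"
  shows "(f has_derivative (\<lambda>h. \<Sum>i\<in>UNIV. h $ i * g i x)) (at x)"
  unfolding has_derivative_at_alt
proof (intro conjI allI impI)
  show "bounded_linear (\<lambda>h. \<Sum>i\<in>UNIV. h $ i * g i x)"
    by (intro bounded_linear_sum bounded_linear_mult_const bounded_linear_vec_nth)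
next
  fix e :: real assume e: "e > 0"
  \<comment> \<open>The sum of the coordinate differences is at most CARD('k) times the
    norm.\<close>
  define e' where "e' = e / real CARD('k)"
  have e': "e' > 0" using e by (simp add: e'_def)
  have "\<forall>\<^sub>F z in nhds x. \<bar>g i z - g i x\<bar> < e'" for i
  proof -
    have "isCont (g i) x" using c[of i] by (simp add: continuous_on_eq_continuous_at)
    then have "(g i \<longlongrightarrow> g i x) (nhds x)"
      by (simp add: isCont_def tendsto_at_iff_tendsto_nhds)
    then show ?thesis
      using e' by (simp add: tendsto_iff dist_real_def)
  qed
  then have "\<forall>\<^sub>F z in nhds x. \<forall>i. \<bar>g i z - g i x\<bar> < e'"
    by (rule eventually_all_finite)
  then obtain D where D: "D > 0" "\<And>z i. dist z x < D \<Longrightarrow> \<bar>g i z - g i x\<bar> < e'"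
    unfolding eventually_nhds_metric by blast
  show "\<exists>D>0. \<forall>y. norm (y - x) < D \<longrightarrow>
      norm (f y - f x - (\<Sum>i\<in>UNIV. (y - x) $ i * g i x)) \<le> e * norm (y - x)"
  proof (intro exI[of _ D] conjI allI impI D)
    fix y assume y: "norm (y - x) < D"
    \<comment> \<open>The box centred at x with y as a corner is closed under exchange of
      coordinates and lies in the ball of radius \<open>norm (y - x)\<close>, where the functions
      \<open>g i\<close> are almost constant.\<close>
    define L where "L = {z. \<forall>k. \<bar>z $ k - x $ k\<bar> \<le> \<bar>y $ k - x $ k\<bar>}"
    define F where "F z = f z - (\<Sum>i\<in>UNIV. z $ i * g i x)" for z
    have "\<bar>F y - F x\<bar> \<le> e' * (\<Sum>i\<in>UNIV. \<bar>y $ i - x $ i\<bar>)"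
    proof (rule coordinate_chain[of L])
      fix a b i assume ab: "a \<in> L" "b \<in> L" and eq: "\<And>k. k \<noteq> i \<Longrightarrow> a $ k = b $ k"
      from coordinate_MVT[of f i "g i", OF d eq] obtain \<xi> where
        \<xi>: "f a - f b = (a $ i - b $ i) * g i \<xi>" "\<And>k. k \<noteq> i \<Longrightarrow> \<xi> $ k = b $ k"
          "\<bar>\<xi> $ i - b $ i\<bar> \<le> \<bar>a $ i - b $ i\<bar>" "\<bar>\<xi> $ i - a $ i\<bar> \<le> \<bar>a $ i - b $ i\<bar>" by blast
      have "\<bar>a $ i - x $ i\<bar> \<le> \<bar>y $ i - x $ i\<bar>" "\<bar>b $ i - x $ i\<bar> \<le> \<bar>y $ i - x $ i\<bar>"
        using ab by (auto simp: L_def)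
      then have i: "\<bar>\<xi> $ i - x $ i\<bar> \<le> \<bar>y $ i - x $ i\<bar>"
        using \<xi>(3,4) by linarith
      have "\<bar>\<xi> $ k - x $ k\<bar> \<le> \<bar>y $ k - x $ k\<bar>" for k
        using i \<xi>(2)[of k] ab by (cases "k = i") (auto simp: L_def)
      then have "norm (\<xi> - x) \<le> norm (y - x)"
        by (intro norm_le_componentwise_cart) simp
      then have *: "\<bar>g i \<xi> - g i x\<bar> \<le> e'"
        using D(2)[of \<xi> i] y by (simp add: dist_norm)
      have "(\<Sum>k\<in>UNIV. a $ k * g k x) - (\<Sum>k\<in>UNIV. b $ k * g k x) = (\<Sum>k\<in>UNIV. if k = i then (a $ i - b $ i) * g i x else 0)"
        unfolding sum_subtractf[symmetric] using eq by (intro sum.cong) (auto simp: algebra_simps)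
      then have "F a - F b = (a $ i - b $ i) * (g i \<xi> - g i x)"
        using \<xi>(1) by (simp add: F_def algebra_simps)
      then show "\<bar>F a - F b\<bar> \<le> e' * \<bar>a $ i - b $ i\<bar>"
        using mult_left_mono[OF *, of "\<bar>a $ i - b $ i\<bar>"] by (simp add: abs_mult mult.commute)
    qed (auto simp: L_def)
    also have "\<dots> \<le> e' * (\<Sum>i\<in>(UNIV :: 'k set). norm (y - x))"
      using e' component_le_norm_cart[of "y - x"] by (intro mult_left_mono sum_mono) auto
    also have "\<dots> = e * norm (y - x)" by (simp add: e'_def)
    finally show "norm (f y - f x - (\<Sum>i\<in>UNIV. (y - x) $ i * g i x)) \<le> e * norm (y - x)"
      by (simp add: F_def algebra_simps sum_subtractf)
  qed
qed

text \<open>The usual route to smoothness below: all iterated partial derivatives are exhibited at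
  once, as a family of continuous functions indexed by lists whose head is the last direction taken.
  Continuity turns partial into total differentiability.\<close>

lemma smooth_tower:
  fixes \<Phi> :: "'k::finite list \<Rightarrow> real ^ 'k \<Rightarrow> real"
  assumes d: "\<And>is i x. ((\<lambda>t. \<Phi> is (x + t *\<^sub>R axis i 1)) has_real_derivative \<Phi> (i # is) x) (at 0)"
    and c: "\<And>is. continuous_on UNIV (\<Phi> is)"
  shows "smooth (\<Phi> [])" "partials is (\<Phi> []) = \<Phi> is"
proof -
  have hd: "(\<Phi> is has_derivative (\<lambda>h. \<Sum>i\<in>UNIV. h $ i * \<Phi> (i # is) x)) (at x)" for "is" x
    by (rule continuous_partials_has_derivative) (rule d c)+
  have p: "partial i (\<Phi> is) = \<Phi> (i # is)" for "is" i
  proof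
    fix x
    have "frechet_derivative (\<Phi> is) (at x) = (\<lambda>h. \<Sum>i\<in>UNIV. h $ i * \<Phi> (i # is) x)"
      using hd by (rule frechet_derivative_at[symmetric])
    then have "partial i (\<Phi> is) x = (\<Sum>k\<in>UNIV. axis i 1 $ k * \<Phi> (k # is) x)"
      by (simp add: partial_def)
    also have "\<dots> = (\<Sum>k\<in>UNIV. if k = i then \<Phi> (i # is) x else 0)"
      by (intro sum.cong) (auto simp: axis_def)
    finally show "partial i (\<Phi> is) x = \<Phi> (i # is) x" by simp
  qed
  show f: "partials is (\<Phi> []) = \<Phi> is" for "is"
    by (induction "is") (auto simp: p)
  show "smooth (\<Phi> [])"
    unfolding smooth_def f using hd by (auto simp: differentiable_def)
qed

lemma smooth_differentiable: "smooth f \<Longrightarrow> partials is f differentiable (at x)"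
  by (simp add: smooth_def)

lemma smooth_continuous: "smooth f \<Longrightarrow> continuous_on UNIV (partials is f)"
  using smooth_differentiable differentiable_imp_continuous_within
  by (metis continuous_on_eq_continuous_within UNIV_I)

lemma smooth_deriv:
  assumes "smooth f"
  shows "((\<lambda>t. partials is f (x + t *\<^sub>R axis i 1)) has_real_derivative partials (i # is) f x) (at 0)"
proof -
  let ?g = "partials is f"
  have "(?g has_derivative frechet_derivative ?g (at x)) (at x)"
    using smooth_differentiable[OF assms] by (simp add: frechet_derivative_works)
  then have g: "(?g has_derivative frechet_derivative ?g (at x)) (at (x + 0 *\<^sub>R axis i 1))" by simp
  have a: "((\<lambda>t. x + t *\<^sub>R axis i 1) has_derivative (\<lambda>t. t *\<^sub>R axis i 1)) (at (0::real))"
    by (auto intro!: derivative_eq_intros)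
  have "((\<lambda>t. ?g (x + t *\<^sub>R axis i 1)) has_derivative (\<lambda>t. frechet_derivative ?g (at x) (t *\<^sub>R axis i 1))) (at 0)"
    using has_derivative_compose[OF a, of ?g "frechet_derivative ?g (at x)"] g by simp
  moreover have "frechet_derivative ?g (at x) (t *\<^sub>R axis i 1) = partials (i # is) f x * t" for t
    using linear_frechet_derivative[OF smooth_differentiable[OF assms, of "is" x]]
    by (simp add: partial_def linear_cmul mult.commute)
  ultimately show ?thesis
    by (simp add: has_field_derivative_def)
qed

lemma smooth_partial: "smooth f \<Longrightarrow> smooth (partial i f)"
  unfolding smooth_def
proof (intro allI)
  fix "is" x assume "\<forall>is x. partials is f differentiable at x"
  then have "partials (is @ [i]) f differentiable at x" by blast
  then show "partials is (partial i f) differentiable at x" by simp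
qed

lemma smooth_partials: "smooth f \<Longrightarrow> smooth (partials is f)"
  by (induction "is") (auto intro: smooth_partial)

lemma smooth_linear:
  assumes "smooth f" "smooth g"
  shows "smooth (\<lambda>x. a * f x + b * g x)"
    "partials is (\<lambda>x. a * f x + b * g x) = (\<lambda>x. a * partials is f x + b * partials is g x)"
proof -
  let ?\<Phi> = "\<lambda>is x. a * partials is f x + b * partials is g x"
  have "((\<lambda>t. ?\<Phi> is (x + t *\<^sub>R axis i 1)) has_real_derivative ?\<Phi> (i # is) x) (at 0)" for "is" i x
    by (intro DERIV_add DERIV_cmult smooth_deriv assms)
  moreover have "continuous_on UNIV (?\<Phi> is)" for "is"
    by (intro continuous_intros smooth_continuous assms)
  ultimately show "smooth (\<lambda>x. a * f x + b * g x)"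
    "partials is (\<lambda>x. a * f x + b * g x) = ?\<Phi> is"
    using smooth_tower[of ?\<Phi>] by auto
qed

lemma partials_scale: "smooth f \<Longrightarrow> partials is (\<lambda>x. a * f x) = (\<lambda>x. a * partials is f x)"
  using smooth_linear(2)[of f f "is" a 0] by simp

lemma smooth_zero: "smooth (\<lambda>x. 0)"
  and partials_zero: "partials is (\<lambda>x. 0) = (\<lambda>x. 0)"
  using smooth_tower[of "\<lambda>_ _. 0"] by auto

lemma smooth_sum:
  assumes "finite S" "\<And>s. s \<in> S \<Longrightarrow> smooth (F s)"
  shows "smooth (\<lambda>x. \<Sum>s\<in>S. c s * F s x) \<and>
    partials is (\<lambda>x. \<Sum>s\<in>S. c s * F s x) = (\<lambda>x. \<Sum>s\<in>S. c s * partials is (F s) x)"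
  using assms
proof (induction S rule: finite_induct)
  case empty
  show ?case by (simp add: smooth_zero partials_zero)
next
  case (insert s S)
  then show ?case
    using smooth_linear(1)[of "F s" "\<lambda>x. \<Sum>s\<in>S. c s * F s x" "c s" 1] 
      smooth_linear(2)[of "F s" "\<lambda>x. \<Sum>s\<in>S. c s * F s x" "is" "c s" 1] by simp
qed

lemma smooth_shift:
  assumes "smooth f"
  shows "smooth (\<lambda>x. f (x + v))" "partials is (\<lambda>x. f (x + v)) = (\<lambda>x. partials is f (x + v))"
proof -
  let ?\<Phi> = "\<lambda>is x. partials is f (x + v)"
  have "((\<lambda>t. ?\<Phi> is (x + t *\<^sub>R axis i 1)) has_real_derivative ?\<Phi> (i # is) x) (at 0)" for "is" i x
    using smooth_deriv[OF assms, of "is" "x + v" i] by (simp add: algebra_simps)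
  moreover have "continuous_on UNIV (?\<Phi> is)" for "is"
    by (rule continuous_on_compose2[OF smooth_continuous[OF assms]]) (auto intro!: continuous_intros)
  ultimately show "smooth (\<lambda>x. f (x + v))" "partials is (\<lambda>x. f (x + v)) = ?\<Phi> is"
    using smooth_tower[of ?\<Phi>] by auto
qed

lemma smooth_std_diff: "smooth f \<Longrightarrow> smooth (std_diff n i f)"
  and partials_std_diff: "smooth f \<Longrightarrow> partials is (std_diff n i f) = std_diff n i (partials is f)"
proof -
  have eq: "std_diff n i f = (\<lambda>x. (1 / step n) * f (x + step n *\<^sub>R axis i 1) + (- 1 / step n) * f x)"
    for f :: "real ^ 'a \<Rightarrow> real"
    by (auto simp: std_diff_def diff_divide_distrib)
  show "smooth f \<Longrightarrow> smooth (std_diff n i f)"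
    unfolding eq by (intro smooth_linear smooth_shift)
  show "smooth f \<Longrightarrow> partials is (std_diff n i f) = std_diff n i (partials is f)"
    unfolding eq by (subst smooth_linear) (auto simp: smooth_shift)
qed

lemma step_pos [simp]: "step n > 0"
  by (simp add: step_def)

lemma step_nonzero [simp]: "step n \<noteq> 0"
  by (simp add: step_def)

lemma smooth_std_diffs: "smooth f \<Longrightarrow> smooth (diffs n is f)"
  by (induction "is") (auto intro: smooth_std_diff)

lemma partial_std_diffs:
  "smooth f \<Longrightarrow> partial i (diffs n is f) = diffs n is (partial i f)"
proof (induction "is")
  case (Cons k "is")
  then show ?case
    using partials_std_diff[of "diffs n is f" "[i]" n k] by (simp add: smooth_std_diffs)
qed simp

lemma smooth_coordinate_MVT:
  fixes f :: "real ^ 'k::finite \<Rightarrow> real"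
  assumes "smooth f" "\<And>k. k \<noteq> i \<Longrightarrow> x $ k = y $ k"
  shows "\<exists>\<xi>. f x - f y = (x $ i - y $ i) * partial i f \<xi> \<and> (\<forall>k. k \<noteq> i \<longrightarrow> \<xi> $ k = y $ k) \<and>
    \<bar>\<xi> $ i - y $ i\<bar> \<le> \<bar>x $ i - y $ i\<bar> \<and> \<bar>\<xi> $ i - x $ i\<bar> \<le> \<bar>x $ i - y $ i\<bar>"
  by (rule coordinate_MVT) (use smooth_deriv[OF assms(1), of "[]"] assms(2) in auto)

text \<open>The mean value theorem turns the outermost difference into a derivative, which commutes
  with the remaining differences and is carried inside. The outermost direction thus becomes the
  innermost derivative, whence \<open>rev\<close>. Each use moves the point by at most one
  step.\<close>

lemma std_diffs_MVT:
  fixes f :: "real ^ 'k::finite \<Rightarrow> real"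
  assumes "smooth f"
  shows "\<exists>\<xi>. diffs n is f x = partials (rev is) f \<xi> \<and> norm (\<xi> - x) \<le> length is * step n"
  using assms
proof (induction "is" arbitrary: f x)
  case Nil
  then show ?case by (intro exI[of _ x]) simp
next
  case (Cons i "is")
  let ?g = "diffs n is f"
  let ?y = "x + step n *\<^sub>R axis i 1"
  obtain \<xi> where \<xi>: "?g ?y - ?g x = (?y $ i - x $ i) * partial i ?g \<xi>"
      "\<And>k. k \<noteq> i \<Longrightarrow> \<xi> $ k = x $ k" "\<bar>\<xi> $ i - x $ i\<bar> \<le> \<bar>?y $ i - x $ i\<bar>"
    using smooth_coordinate_MVT[of ?g i ?y x] Cons.prems smooth_std_diffs by (auto simp: axis_def)
  have "diffs n (i # is) f x = partial i ?g \<xi>"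
    using \<xi>(1) by (simp add: std_diff_def axis_def)
  also have "\<dots> = diffs n is (partial i f) \<xi>"
    by (simp add: partial_std_diffs Cons.prems)
  finally have 1: "diffs n (i # is) f x = diffs n is (partial i f) \<xi>" .
  obtain \<eta> where \<eta>: "diffs n is (partial i f) \<xi> = partials (rev is) (partial i f) \<eta>"
      "norm (\<eta> - \<xi>) \<le> length is * step n"
    using Cons.IH[OF smooth_partial[OF Cons.prems]] by blast
  have "\<bar>(\<xi> - x) $ k\<bar> \<le> \<bar>(step n *\<^sub>R axis i 1 :: real ^ 'k) $ k\<bar>" for k
    using \<xi>(2,3) by (cases "k = i") (auto simp: axis_def)
  then have "norm (\<xi> - x) \<le> norm (step n *\<^sub>R axis i 1 :: real ^ 'k)"
    by (intro norm_le_componentwise_cart) simp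
  then have "norm (\<xi> - x) \<le> step n"
    using step_pos[of n] by (simp add: norm_axis_1 less_imp_le)
  then have "norm (\<eta> - x) \<le> length (i # is) * step n"
    using \<eta>(2) norm_triangle_ineq[of "\<eta> - \<xi>" "\<xi> - x"] by (simp add: algebra_simps)
  then show ?case using 1 \<eta>(1) by (intro exI[of _ \<eta>]) simp
qed

lemma smooth_Lipschitz:
  fixes f :: "real ^ 'k::finite \<Rightarrow> real"
  assumes "smooth f" "\<And>i x. \<bar>partial i f x\<bar> \<le> C"
  shows "\<bar>f x - f y\<bar> \<le> C * CARD('k) * norm (x - y)"
proof -
  have C: "C \<ge> 0" using assms(2)[of undefined 0] by linarith
  have "\<bar>f x - f y\<bar> \<le> C * (\<Sum>i\<in>UNIV. \<bar>x $ i - y $ i\<bar>)"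
  proof (rule coordinate_chain[of UNIV])
    fix a b :: "real ^ 'k" and i assume "\<And>k. k \<noteq> i \<Longrightarrow> a $ k = b $ k"
    with smooth_coordinate_MVT[OF assms(1)] obtain \<xi> where
      "f a - f b = (a $ i - b $ i) * partial i f \<xi>" by metis
    then show "\<bar>f a - f b\<bar> \<le> C * \<bar>a $ i - b $ i\<bar>"
      using assms(2)[of i \<xi>] by (simp add: abs_mult mult.commute mult_right_mono)
  qed auto
  also have "\<dots> \<le> C * (\<Sum>i\<in>(UNIV :: 'k set). norm (x - y))"
    using C component_le_norm_cart[of "x - y"] by (intro mult_left_mono sum_mono) auto
  finally show ?thesis by (simp add: mult.assoc)
qed

lemma partials_support:
  fixes f :: "real ^ 'k::finite \<Rightarrow> real"
  assumes "x \<notin> closure {x. f x \<noteq> 0}"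
  shows "partials is f x = 0"
  using assms
proof (induction "is" arbitrary: x)
  case Nil
  then show ?case using closure_subset[of "{x. f x \<noteq> 0}"] by auto
next
  case (Cons i "is")
  let ?V = "- closure {x. f x \<noteq> 0}"
  have "(partials is f has_derivative (\<lambda>h. 0)) (at x)"
  proof (rule has_derivative_transform_within_open)
    show "((\<lambda>x. 0) has_derivative (\<lambda>h. 0)) (at x)" by simp
    show "open ?V" by auto
  qed (use Cons in auto)
  then have "frechet_derivative (partials is f) (at x) = (\<lambda>h. 0)"
    by (rule frechet_derivative_at[symmetric])
  then show ?case by (simp add: partial_def[of i])
qed

section \<open>Test functions and their supports\<close>

lemma test_functions_mono: "A \<subseteq> B \<Longrightarrow> test_functions A \<subseteq> test_functions B"
  by (auto simp: test_functions_def)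

lemma test_function_smooth: "f \<in> test_functions A \<Longrightarrow> smooth f"
  by (simp add: test_functions_def)

lemma test_functionI:
  assumes "smooth f" "compact K" "K \<subseteq> A" "\<And>x. f x \<noteq> 0 \<Longrightarrow> x \<in> K"
  shows "f \<in> test_functions A"
proof -
  have "closure {x. f x \<noteq> 0} \<subseteq> K"
    using assms by (intro closure_minimal) (auto simp: compact_imp_closed)
  then show ?thesis
    using assms compact_imp_bounded[OF assms(2)] unfolding test_functions_def
    by (auto simp: compact_eq_bounded_closed intro: bounded_subset)
qed

lemma test_function_support:
  assumes "f \<in> test_functions A"
  shows "\<exists>K. compact K \<and> K \<subseteq> A \<and> f \<in> test_functions K \<and> (\<forall>is x. partials is f x \<noteq> 0 \<longrightarrow> x \<in> K)"
  using assms partials_support[of _ f]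
  by (intro exI[of _ "closure {x. f x \<noteq> 0}"]) (auto simp: test_functions_def)

lemma test_function_partial_bounded:
  assumes "f \<in> test_functions A"
  shows "\<exists>B. \<forall>x. \<bar>partials is f x\<bar> \<le> B"
proof -
  obtain K where K: "compact K" "\<And>x. partials is f x \<noteq> 0 \<Longrightarrow> x \<in> K"
    using test_function_support[OF assms] by blast
  have "compact (partials is f ` K)"
    using continuous_on_subset[OF smooth_continuous[OF test_function_smooth[OF assms]]] K(1)
    by (intro compact_continuous_image) auto
  then obtain B where B: "\<And>x. x \<in> K \<Longrightarrow> \<bar>partials is f x\<bar> \<le> B"
    using compact_imp_bounded bounded_iff by (metis imageI real_norm_def)
  show ?thesis
  proof (intro exI[of _ "max B 0"] allI)
    show "\<bar>partials is f x\<bar> \<le> max B 0" for x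
      using K(2)[of x] B[of x] by (cases "partials is f x = 0") auto
  qed
qed

lemma test_functions_linear:
  assumes "f \<in> test_functions A" "g \<in> test_functions A"
  shows "(\<lambda>x. a * f x + b * g x) \<in> test_functions A"
proof -
  obtain K L where K: "compact K" "K \<subseteq> A" "\<And>x. partials [] f x \<noteq> 0 \<Longrightarrow> x \<in> K"
    and L: "compact L" "L \<subseteq> A" "\<And>x. partials [] g x \<noteq> 0 \<Longrightarrow> x \<in> L"
    using test_function_support[OF assms(1)] test_function_support[OF assms(2)] by metis
  show ?thesis
  proof (rule test_functionI[of _ "K \<union> L"])
    show "smooth (\<lambda>x. a * f x + b * g x)"
      using assms by (intro smooth_linear test_function_smooth)
    show "x \<in> K \<union> L" if "a * f x + b * g x \<noteq> 0" for x
      using that K(3)[of x] L(3)[of x] by (cases "f x = 0") auto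
  qed (use K L in \<open>auto intro!: compact_Un\<close>)
qed

lemma test_functions_add: "f \<in> test_functions A \<Longrightarrow> g \<in> test_functions A \<Longrightarrow> (\<lambda>x. f x + g x) \<in> test_functions A"
  using test_functions_linear[of f A g 1 1] by simp

lemma test_functions_scale: "f \<in> test_functions A \<Longrightarrow> (\<lambda>x. a * f x) \<in> test_functions A"
  using test_functions_linear[of f A f a 0] by simp

lemma test_functions_zero: "(\<lambda>x. 0) \<in> test_functions A"
  by (rule test_functionI[of _ "{}"]) (auto simp: smooth_zero)

section \<open>The standard grids\<close>

text \<open>The grid of mesh 1/n! without the cut-off at n!. Unlike \<open>std_grid n\<close> it is
  invariant under steps, as finite differences require.\<close>

definition step_lattice :: "nat \<Rightarrow> (real ^ 'k::finite) set" where
  "step_lattice n = {x. \<forall>i. \<exists>j::int. x $ i = of_int j * step n}"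

lemma std_grid_iff: "x \<in> std_grid n \<longleftrightarrow> x \<in> step_lattice n \<and> (\<forall>i. \<bar>x $ i\<bar> \<le> fact n)"
proof -
  have "\<bar>of_int j * step n\<bar> \<le> fact n \<longleftrightarrow> - ((fact n)\<^sup>2) \<le> j \<and> j \<le> (fact n)\<^sup>2" for j :: int
  proof -
    have "\<bar>of_int j * step n\<bar> \<le> fact n \<longleftrightarrow> \<bar>real_of_int j\<bar> \<le> fact n * fact n"
      by (simp add: step_def abs_mult divide_le_eq)
    also have "\<dots> \<longleftrightarrow> real_of_int \<bar>j\<bar> \<le> real_of_int ((fact n)\<^sup>2)"
      by (simp add: power2_eq_square)
    also have "\<dots> \<longleftrightarrow> - ((fact n)\<^sup>2) \<le> j \<and> j \<le> (fact n)\<^sup>2"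
      unfolding of_int_le_iff by linarith
    finally show ?thesis .
  qed
  then show ?thesis
    unfolding std_grid_def step_lattice_def by (simp; metis)
qed

lemma step_nonneg [simp]: "0 \<le> step n"
  by (simp add: step_def)

lemma abs_step [simp]: "\<bar>step n\<bar> = step n"
  by simp

lemma step_le: "step n \<le> 1"
  by (simp add: step_def)

text \<open>The sequence is the product of the two null sequences n^p/e^n and e^n/n!. This is the
  comparison between the scales 1/n and 1/n!.\<close>

lemma power_step_LIMSEQ: "(\<lambda>n. real n ^ p * step n) \<longlonglongrightarrow> 0"
proof -
  have 1: "(\<lambda>n. real n ^ p / exp (real n)) \<longlonglongrightarrow> 0"
    by (rule filterlim_compose[OF tendsto_power_div_exp_0 filterlim_real_sequentially])
  have "(\<lambda>n. exp 1 ^ n /\<^sub>R fact n) \<longlonglongrightarrow> (0::real)"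
    by (rule summable_LIMSEQ_zero[OF summable_exp_generic])
  then have "(\<lambda>n. exp (real n) / fact n) \<longlonglongrightarrow> 0"
    by (simp add: exp_of_nat_mult[of _ 1, simplified] divide_inverse mult.commute)
  from tendsto_mult[OF 1 this] show ?thesis
    by (simp add: step_def)
qed

lemma step_LIMSEQ: "step \<longlonglongrightarrow> 0"
  using power_step_LIMSEQ[of 0] by simp

lemma lattice_shift: "x + step n *\<^sub>R axis i 1 \<in> step_lattice n \<longleftrightarrow> x \<in> step_lattice n"
proof -
  have "(\<exists>j::int. x $ k + step n * axis i 1 $ k = of_int j * step n) \<longleftrightarrow> (\<exists>j::int. x $ k = of_int j * step n)" for k
  proof (cases "k = i")
    case True
    then show ?thesis
      by (auto simp: axis_def algebra_simps intro: exI[of _ "_ + 1 :: int"] exI[of _ "_ - 1 :: int"])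
  qed (simp add: axis_def)
  then show ?thesis by (simp add: step_lattice_def)
qed

text \<open>The one-dimensional grid, enumerated increasingly by natural numbers so that sums over
  it can telescope.\<close>

definition grid_points :: "nat \<Rightarrow> real set" where
  "grid_points n = (\<lambda>l::nat. (of_nat l - (fact n)\<^sup>2) * step n) ` {..2 * (fact n)\<^sup>2}"

lemma finite_grid_points: "finite (grid_points n)"
  by (simp add: grid_points_def)

lemma std_grid_eq: "std_grid n = vec_lambda ` (UNIV \<rightarrow>\<^sub>E grid_points n)"
proof -
  have "(\<exists>j::int. - ((fact n)\<^sup>2) \<le> j \<and> j \<le> (fact n)\<^sup>2 \<and> a = of_int j * step n) \<longleftrightarrow> a \<in> grid_points n" for a
  proof
    assume "\<exists>j::int. - ((fact n)\<^sup>2) \<le> j \<and> j \<le> (fact n)\<^sup>2 \<and> a = of_int j * step n"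
    then obtain j :: int where "- ((fact n)\<^sup>2) \<le> j" "j \<le> (fact n)\<^sup>2" "a = of_int j * step n" by blast
    moreover define l where "l = nat (j + (fact n)\<^sup>2)"
    ultimately have "int l = j + (fact n)\<^sup>2" by simp
    then have "real_of_int (int l) = real_of_int (j + (fact n)\<^sup>2)" by simp
    moreover have "int l \<le> int (2 * (fact n)\<^sup>2)"
      using \<open>int l = j + (fact n)\<^sup>2\<close> \<open>j \<le> (fact n)\<^sup>2\<close> by simp
    then have "l \<le> 2 * (fact n)\<^sup>2" by linarith
    ultimately show "a \<in> grid_points n"
      using \<open>a = of_int j * step n\<close> by (auto simp: grid_points_def intro!: image_eqI[of _ _ l])
  next
    assume "a \<in> grid_points n"
    then obtain l :: nat where l: "l \<le> 2 * (fact n)\<^sup>2" "a = (of_nat l - (fact n)\<^sup>2) * step n"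
      by (auto simp: grid_points_def)
    then have "int l \<le> int (2 * (fact n)\<^sup>2)" by linarith
    then show "\<exists>j::int. - ((fact n)\<^sup>2) \<le> j \<and> j \<le> (fact n)\<^sup>2 \<and> a = of_int j * step n"
      using l(2) by (intro exI[of _ "int l - (fact n)\<^sup>2"]) auto
  qed
  then have "std_grid n = {x. \<forall>i. x $ i \<in> grid_points n}"
    by (simp add: std_grid_def)
  also have "\<dots> = vec_lambda ` (UNIV \<rightarrow>\<^sub>E grid_points n)"
    by (auto simp: image_iff intro!: bexI[of _ "vec_nth _"])
  finally show ?thesis .
qed

lemma finite_std_grid: "finite (std_grid n)"
  unfolding std_grid_eq by (intro finite_imageI finite_PiE) (auto simp: finite_grid_points)

lemma sum_std_grid_prod:
  "(\<Sum>x\<in>std_grid n. \<Prod>i\<in>UNIV. h i (x $ i)) = (\<Prod>i\<in>(UNIV :: 'k::finite set). \<Sum>t\<in>grid_points n. h i t :: real)"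
proof -
  have "inj_on vec_lambda (UNIV \<rightarrow>\<^sub>E grid_points n :: ('k \<Rightarrow> real) set)"
    by (auto simp: inj_on_def vec_lambda_inject)
  then have "(\<Sum>x\<in>std_grid n. \<Prod>i\<in>UNIV. h i (x $ i)) = (\<Sum>f\<in>(UNIV :: 'k set) \<rightarrow>\<^sub>E grid_points n. \<Prod>i\<in>UNIV. h i (f i))"
    unfolding std_grid_eq by (subst sum.reindex) (auto simp: o_def)
  also have "\<dots> = (\<Prod>i\<in>(UNIV :: 'k set). \<Sum>t\<in>grid_points n. h i t)"
    by (rule prod_sum_PiE[symmetric]) (auto simp: finite_grid_points)
  finally show ?thesis .
qed

definition grid_round :: "nat \<Rightarrow> real ^ 'k::finite \<Rightarrow> real ^ 'k" where
  "grid_round n y = (\<chi> i. of_int \<lfloor>y $ i * fact n\<rfloor> * step n)"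

lemma grid_round_lattice: "grid_round n y \<in> step_lattice n"
  by (auto simp: grid_round_def step_lattice_def)

lemma grid_round_component: "\<bar>grid_round n y $ i - y $ i\<bar> \<le> step n"
proof -
  have "\<bar>of_int \<lfloor>y $ i * fact n\<rfloor> - y $ i * fact n\<bar> \<le> 1" by linarith
  then have "\<bar>(of_int \<lfloor>y $ i * fact n\<rfloor> - y $ i * fact n) * step n\<bar> \<le> 1 * step n"
    unfolding abs_mult by (intro mult_mono) auto
  moreover have "grid_round n y $ i - y $ i = (of_int \<lfloor>y $ i * fact n\<rfloor> - y $ i * fact n) * step n"
    by (simp add: grid_round_def step_def field_simps)
  ultimately show ?thesis by (simp only: mult_1)
qed

lemma norm_le_sum_components:
  fixes x :: "real ^ 'k::finite" and r :: real
  assumes "\<And>i. \<bar>x $ i\<bar> \<le> r"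
  shows "norm x \<le> CARD('k) * r"
proof -
  have "norm x \<le> (\<Sum>i\<in>UNIV. \<bar>x $ i\<bar>)" by (rule norm_le_l1_cart)
  also have "\<dots> \<le> (\<Sum>i\<in>(UNIV :: 'k set). r)" using assms by (intro sum_mono) auto
  finally show ?thesis by simp
qed

lemma grid_round_norm: "norm (grid_round n y - y) \<le> CARD('k) * step n" for y :: "real ^ 'k::finite"
  using grid_round_component[of n y] by (intro norm_le_sum_components) simp

text \<open>Each difference uses a point and its neighbour one step ahead, so some point reached in
  at most \<open>length is\<close> steps carries a nonzero value. Steps do not change membership in
  the lattice.\<close>

lemma std_diffs_support:
  assumes "diffs n is f x \<noteq> 0"
  shows "\<exists>z. f z \<noteq> 0 \<and> norm (z - x) \<le> length is * step n \<and> (x \<in> step_lattice n \<longleftrightarrow> z \<in> step_lattice n)"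
  using assms
proof (induction "is" arbitrary: x)
  case Nil
  then show ?case by auto
next
  case (Cons i "is")
  let ?g = "diffs n is f" and ?y = "x + step n *\<^sub>R axis i 1"
  have "?g x \<noteq> 0 \<or> ?g ?y \<noteq> 0"
    using Cons.prems by (auto simp: std_diff_def[of n i])
  then show ?case
  proof
    assume "?g x \<noteq> 0"
    from Cons.IH[OF this] show ?thesis
      by (force simp: algebra_simps intro: order_trans)
  next
    assume "?g ?y \<noteq> 0"
    from Cons.IH[OF this] obtain z where
      z: "f z \<noteq> 0" "norm (z - ?y) \<le> length is * step n" "x \<in> step_lattice n \<longleftrightarrow> z \<in> step_lattice n"
      unfolding lattice_shift by blast
    have "norm (z - x) \<le> norm (z - ?y) + norm (?y - x)"
      by (metis norm_triangle_sub diff_add_cancel norm_triangle_ineq diff_add_eq add_diff_eq)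
    also have "norm (?y - x) = step n"
      using step_pos[of n] by (simp add: norm_axis_1)
    finally show ?thesis using z by (intro exI[of _ z]) (simp add: algebra_simps)
  qed
qed

lemma std_diff_sum:
  "std_diff n i (\<lambda>x. \<Sum>s\<in>S. c s * F s x) = (\<lambda>x. \<Sum>s\<in>S. c s * std_diff n i (F s) x)"
  by (auto simp: std_diff_def sum_divide_distrib right_diff_distrib diff_divide_distrib sum_subtractf)

lemma std_diffs_sum:
  "diffs n is (\<lambda>x. \<Sum>s\<in>S. c s * F s x) = (\<lambda>x. \<Sum>s\<in>S. c s * diffs n is (F s) x)"
  by (induction "is") (auto simp: std_diff_sum)

lemma std_diffs_scale:
  "diffs n is (\<lambda>x. c * f x) = (\<lambda>x. c * diffs n is f x)"
  using std_diffs_sum[of n "is" "\<lambda>_. c" "\<lambda>_. f" "{()}"] by simp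

lemma std_diffs_diff:
  "diffs n is (\<lambda>x. f x - g x) = (\<lambda>x. diffs n is f x - diffs n is g x)"
  by (induction "is") (auto simp: std_diff_def diff_divide_distrib)

lemma std_diff_commute: "std_diff n i (std_diff n j f) = std_diff n j (std_diff n i f)"
  by (auto simp: std_diff_def algebra_simps diff_divide_distrib)

lemma std_diffs_snoc: "diffs n is (std_diff n i f) = std_diff n i (diffs n is f)"
proof (induction "is")
  case (Cons j "is")
  then show ?case using std_diff_commute by simp
qed simp

text \<open>Differences commute; this undoes the \<open>rev\<close> that comes from
  \<open>std_diffs_MVT\<close>.\<close>

lemma std_diffs_rev: "diffs n (rev is) f = diffs n is f"
  by (induction "is") (auto simp: std_diffs_snoc)

text \<open>The increments over m steps are added up. With c = 0 this is a Lipschitz estimate; with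
  c the difference quotient at the starting point it is a first-order expansion.\<close>

lemma std_diff_telescope:
  assumes "\<And>l. l < m \<Longrightarrow> \<bar>std_diff n i f (x + (real l * step n) *\<^sub>R axis i 1) - c\<bar> \<le> r"
  shows "\<bar>f (x + (real m * step n) *\<^sub>R axis i 1) - f x - real m * step n * c\<bar> \<le> real m * step n * r"
  using assms
proof (induction m)
  case (Suc m)
  let ?y = "x + (real m * step n) *\<^sub>R axis i 1"
  have y: "x + (real (Suc m) * step n) *\<^sub>R axis i 1 = ?y + step n *\<^sub>R axis i 1"
    by (simp add: algebra_simps)
  have "\<bar>std_diff n i f ?y - c\<bar> \<le> r" using Suc.prems by simp
  then have "\<bar>step n * (std_diff n i f ?y - c)\<bar> \<le> step n * r"
    using mult_left_mono[OF _ step_nonneg] by (simp add: abs_mult)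
  moreover have "step n * (std_diff n i f ?y - c) = f (?y + step n *\<^sub>R axis i 1) - f ?y - step n * c"
    by (subst right_diff_distrib) (simp add: std_diff_def)
  moreover have "\<bar>f ?y - f x - real m * step n * c\<bar> \<le> real m * step n * r"
    by (rule Suc.IH) (use Suc.prems in auto)
  ultimately show ?case unfolding y by (simp add: algebra_simps abs_le_iff)
qed simp

text \<open>Lattice points that differ in one coordinate are joined by a whole number of steps, so
  \<open>std_diff_telescope\<close> applies with c = 0.\<close>

lemma lattice_Lipschitz:
  fixes f :: "real ^ 'k::finite \<Rightarrow> real"
  assumes "\<And>x i. \<bar>std_diff n i f x\<bar> \<le> C" "x \<in> step_lattice n" "y \<in> step_lattice n"
  shows "\<bar>f x - f y\<bar> \<le> C * CARD('k) * norm (x - y)"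
proof -
  have C: "C \<ge> 0" using assms(1)[of undefined undefined] by linarith
  have "\<bar>f x - f y\<bar> \<le> C * (\<Sum>i\<in>UNIV. \<bar>x $ i - y $ i\<bar>)"
  proof (rule coordinate_chain[of "step_lattice n"])
    show "(\<chi> k. if k = i then x $ k else y $ k) \<in> step_lattice n"
      if "x \<in> step_lattice n" "y \<in> step_lattice n" for x y :: "real ^ 'k" and i
      using that by (auto simp: step_lattice_def)
    have le: "\<bar>f x - f y\<bar> \<le> C * \<bar>x $ i - y $ i\<bar>"
      if xy: "x \<in> step_lattice n" "y \<in> step_lattice n" and eq: "\<And>k. k \<noteq> i \<Longrightarrow> x $ k = y $ k" and "y $ i \<le> x $ i"
      for x y and i
    proof -
      obtain a b :: int where ab: "x $ i = of_int a * step n" "y $ i = of_int b * step n"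
        using xy unfolding step_lattice_def by blast
      then have "b \<le> a" using \<open>y $ i \<le> x $ i\<close> by simp
      define m where "m = nat (a - b)"
      have m: "x $ i - y $ i = real m * step n"
        using ab \<open>b \<le> a\<close> by (simp add: m_def left_diff_distrib)
      have x: "x = y + (real m * step n) *\<^sub>R axis i 1"
        using eq by (auto simp: vec_eq_iff m[symmetric] axis_def)
      have "\<bar>f (y + (real m * step n) *\<^sub>R axis i 1) - f y - real m * step n * 0\<bar> \<le> real m * step n * C"
        by (rule std_diff_telescope) (use assms(1) in simp)
      then show ?thesis
        unfolding m x[symmetric] using step_pos[of n] by (simp add: mult.commute)
    qed
    show "\<bar>f x - f y\<bar> \<le> C * \<bar>x $ i - y $ i\<bar>"
      if "x \<in> step_lattice n" "y \<in> step_lattice n" "\<And>k. k \<noteq> i \<Longrightarrow> x $ k = y $ k" for x y i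
      using le[of x y i] le[of y x i] that by (cases "y $ i \<le> x $ i") (auto simp: abs_minus_commute)
  qed (use assms in auto)
  also have "\<dots> \<le> C * (\<Sum>i\<in>(UNIV :: 'k set). norm (x - y))"
    using C component_le_norm_cart[of "x - y"] by (intro mult_left_mono sum_mono) auto
  finally show ?thesis by (simp add: mult.assoc)
qed

section \<open>A smooth step function\<close>

definition flat :: "real poly \<Rightarrow> real \<Rightarrow> real" where
  "flat p t = (if t \<le> 0 then 0 else poly p (1 / t) * exp (- (1 / t)))"

text \<open>With s = 1/t one has d/dt = - s^2 d/ds, which turns p(s) exp(-s) into s^2 (p - p')(s)
  exp(-s); \<open>[:0, 0, 1:]\<close> is the polynomial s^2.\<close>

definition flat_deriv :: "real poly \<Rightarrow> real poly" where
  "flat_deriv p = [:0, 0, 1:] * (p - pderiv p)"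

lemma poly_exp_tendsto_0: "((\<lambda>s. poly p s * exp (- s)) \<longlongrightarrow> (0::real)) at_top"
proof -
  have "((\<lambda>s. \<Sum>i\<le>degree p. coeff p i * (s ^ i / exp s)) \<longlongrightarrow> (\<Sum>i\<le>degree p. coeff p i * 0)) at_top"
    by (intro tendsto_intros tendsto_power_div_exp_0)
  then show ?thesis
    by (simp add: poly_altdef exp_minus divide_inverse sum_distrib_right mult.assoc)
qed

lemma flat_has_derivative: "(flat p has_real_derivative flat (flat_deriv p) t) (at t)"
proof (cases t "0::real" rule: linorder_cases)
  case less
  have "((\<lambda>t. 0) has_real_derivative flat (flat_deriv p) t) (at t)"
    using less by (simp add: flat_def)
  moreover have "\<forall>\<^sub>F s in nhds t. flat p s = 0"
    using eventually_nhds_in_open[of "{..<0}" t] less by (auto elim!: eventually_mono simp: flat_def)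
  ultimately show ?thesis
    by (subst DERIV_cong_ev[OF refl _ refl, of _ "\<lambda>t. 0"]) auto
next
  case greater
  have "((\<lambda>t. poly p (1 / t) * exp (- (1 / t))) has_real_derivative flat (flat_deriv p) t) (at t)"
    using greater
    by (auto intro!: derivative_eq_intros poly_DERIV[THEN DERIV_chain2]
        simp: flat_def flat_deriv_def field_simps power2_eq_square)
  moreover have "\<forall>\<^sub>F s in nhds t. flat p s = poly p (1 / s) * exp (- (1 / s))"
    using eventually_nhds_in_open[of "{0<..}" t] greater by (auto elim!: eventually_mono simp: flat_def)
  ultimately show ?thesis
    by (subst DERIV_cong_ev[OF refl _ refl, of _ "\<lambda>t. poly p (1 / t) * exp (- (1 / t))"]) auto
next
  case equal
  have "((\<lambda>h. flat p h / h) \<longlongrightarrow> 0) (at_left 0)"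
    by (rule tendsto_eventually) (auto simp: flat_def eventually_at_filter)
  moreover have "((\<lambda>h. flat p h / h) \<longlongrightarrow> 0) (at_right 0)"
  proof -
    \<comment> \<open>The difference quotient at 0 is s p(s) exp(-s) with s = 1/h, and
      \<open>pCons 0 p\<close> is the polynomial s p(s).\<close>
    have "((\<lambda>h. poly (pCons 0 p) (inverse h) * exp (- inverse h)) \<longlongrightarrow> 0) (at_right (0::real))"
      by (rule filterlim_compose[OF poly_exp_tendsto_0 filterlim_inverse_at_top_right])
    then show ?thesis
      by (rule Lim_transform_eventually)
        (auto simp: flat_def eventually_at_filter field_simps)
  qed
  ultimately have "((\<lambda>h. flat p h / h) \<longlongrightarrow> 0) (at 0)"
    by (simp add: filterlim_split_at)
  then show ?thesis
    using equal by (simp add: DERIV_def flat_def)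
qed

lemma flat_uminus: "flat (- p) t = - flat p t"
  by (simp add: flat_def)

text \<open>Products of a function flat at 0 with one flat at 1 vanish outside (0, 1), and their
  finite sums form a class closed under differentiation.\<close>

definition bump_sum :: "(real poly \<times> real poly) list \<Rightarrow> real \<Rightarrow> real" where
  "bump_sum ps t = (\<Sum>(p, q)\<leftarrow>ps. flat p t * flat q (1 - t))"

definition bump_deriv :: "(real poly \<times> real poly) list \<Rightarrow> (real poly \<times> real poly) list" where
  "bump_deriv ps = concat (map (\<lambda>(p, q). [(flat_deriv p, q), (p, - flat_deriv q)]) ps)"

lemma bump_sum_has_derivative: "(bump_sum ps has_real_derivative bump_sum (bump_deriv ps) t) (at t)"
proof (induction ps)
  case Nil
  show ?case by (simp add: bump_sum_def[abs_def] bump_deriv_def)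
next
  case (Cons a ps)
  obtain p q where a: "a = (p, q)" by (cases a)
  have q: "((\<lambda>t. flat q (1 - t)) has_real_derivative - flat (flat_deriv q) (1 - t)) (at t)"
  proof -
    have "((\<lambda>t. flat q (1 - t)) has_real_derivative flat (flat_deriv q) (1 - t) * (- 1)) (at t)"
      by (rule DERIV_chain2[OF flat_has_derivative]) (auto intro!: derivative_eq_intros)
    then show ?thesis by simp
  qed
  show ?case
    using DERIV_add[OF DERIV_mult[OF flat_has_derivative q] Cons.IH, of p]
    by (simp add: a bump_sum_def[abs_def] bump_deriv_def flat_uminus algebra_simps)
qed

lemma bump_sum_support: "t \<le> 0 \<or> t \<ge> 1 \<Longrightarrow> bump_sum ps t = 0"
proof (induction ps)
  case (Cons a ps)
  then show ?case by (cases a) (auto simp: bump_sum_def flat_def)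
qed (simp add: bump_sum_def)

text \<open>\<open>H 0\<close> is the normalized antiderivative of a bump on (0, 1), and
  \<open>H (Suc m)\<close> is the m-th derivative of the bump divided by the same constant. These
  derivatives vanish outside (0, 1) and are continuous, hence bounded.\<close>

lemma smooth_step_exists:
  "\<exists>(H :: nat \<Rightarrow> real \<Rightarrow> real) A.
     (\<forall>m t. (H m has_real_derivative H (Suc m) t) (at t)) \<and> (\<forall>m t. \<bar>H m t\<bar> \<le> A m) \<and>
     mono (H 0) \<and> (\<forall>t\<le>0. H 0 t = 0) \<and> (\<forall>t\<ge>1. H 0 t = 1)"
proof -
  define h where "h m = bump_sum ((bump_deriv ^^ m) [(1, 1)])" for m
  have h: "(h m has_real_derivative h (Suc m) t) (at t)" for m t
    unfolding h_def by (simp add: bump_sum_has_derivative)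
  have h0: "h 0 t = flat 1 t * flat 1 (1 - t)" for t
    by (simp add: h_def bump_sum_def)
  have nonneg: "h 0 t \<ge> 0" for t
    by (simp add: h0 flat_def)
  have supp: "h m t = 0" if "t \<le> 0 \<or> t \<ge> 1" for m t
    using that by (simp add: h_def bump_sum_support)
  have cont: "isCont (h m) t" for m t
    using h DERIV_isCont by blast
  obtain F where F: "\<And>t. (F has_real_derivative h 0 t) (at t)"
    using einterval_antiderivative[of "- \<infinity>" "\<infinity>" "h 0"] cont
    by (auto simp: has_real_derivative_iff_has_vector_derivative)
  have mono: "F s \<le> F t" if "s \<le> t" for s t
    using DERIV_nonneg_imp_nondecreasing[OF that] F nonneg by blast
  have F01: "F 0 < F 1"
  proof (rule DERIV_pos_imp_increasing_open[of 0 1 F])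
    show "\<exists>y. (F has_real_derivative y) (at x) \<and> 0 < y" if "0 < x" "x < 1" for x
      using that by (intro exI[of _ "h 0 x"] conjI F) (simp add: h0 flat_def)
    show "continuous_on {0..1} F"
      using F by (intro continuous_at_imp_continuous_on ballI DERIV_isCont)
  qed simp
  have F0: "F t = F 0" if t: "t \<le> 0" for t
  proof (cases "t = 0")
    case False
    then obtain z where "t < z" "z < 0" "F 0 - F t = (0 - t) * h 0 z"
      using t MVT2[of t 0 F "h 0"] F by auto
    then show ?thesis by (simp add: supp)
  qed simp
  have F1: "F t = F 1" if t: "t \<ge> 1" for t
  proof (cases "t = 1")
    case False
    then obtain z where "1 < z" "z < t" "F t - F 1 = (t - 1) * h 0 z"
      using t MVT2[of 1 t F "h 0"] F by auto
    then show ?thesis by (simp add: supp)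
  qed simp
  define d where "d = F 1 - F 0"
  have d: "d > 0" using F01 by (simp add: d_def)
  define H where "H m t = (case m of 0 \<Rightarrow> (F t - F 0) / d | Suc m \<Rightarrow> h m t / d)" for m t
  have "(H m has_real_derivative H (Suc m) t) (at t)" for m t
    using d F h by (cases m) (auto simp: H_def[abs_def] intro!: derivative_eq_intros)
  moreover have "\<exists>A. \<forall>t. \<bar>H m t\<bar> \<le> A" for m
  proof (cases m)
    case 0
    have "F 0 \<le> F t" for t using mono[of 0 t] F0[of t] by linarith
    moreover have "F t \<le> F 1" for t using mono[of t 1] F1[of t] by linarith
    ultimately have "0 \<le> H m t \<and> H m t \<le> 1" for t
      using d 0 by (simp add: H_def d_def)
    then show ?thesis by (intro exI[of _ 1] allI) (simp add: abs_le_iff order_trans[of _ 0])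
  next
    case (Suc l)
    have "compact (h l ` {0..1})"
      using cont by (intro compact_continuous_image continuous_at_imp_continuous_on) auto
    then obtain B where "\<And>y. y \<in> h l ` {0..1} \<Longrightarrow> \<bar>y\<bar> \<le> B"
      using compact_imp_bounded bounded_iff by (metis real_norm_def)
    then have B: "\<bar>h l t\<bar> \<le> B" if "0 \<le> t" "t \<le> 1" for t
      using that by auto
    have "\<bar>H m t\<bar> \<le> max B 0 / d" for t
      using B[of t] supp[of t l] d Suc
      by (cases "0 \<le> t \<and> t \<le> 1") (auto simp: H_def abs_div intro!: divide_right_mono)
    then show ?thesis by blast
  qed
  then obtain A where "\<And>m t. \<bar>H m t\<bar> \<le> A m" by metis
  moreover have "mono (H 0)"
    using mono d by (auto simp: H_def mono_def intro!: divide_right_mono)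
  moreover have "H 0 t = 0" if "t \<le> 0" for t using F0[OF that] by (simp add: H_def)
  moreover have "H 0 t = 1" if "t \<ge> 1" for t using F1[OF that] d by (simp add: H_def d_def)
  ultimately show ?thesis by blast
qed

section \<open>Smearing out grid functions\<close>

definition in_box :: "nat \<Rightarrow> real \<Rightarrow> (real ^ 'k::finite \<Rightarrow> real) \<Rightarrow> bool" where
  "in_box n R g \<longleftrightarrow> (\<forall>x. g x \<noteq> 0 \<longrightarrow> x \<in> step_lattice n \<and> (\<forall>i. \<bar>x $ i\<bar> \<le> R))"

lemma in_box_grid: "in_box n R g \<Longrightarrow> R \<le> fact n \<Longrightarrow> g x \<noteq> 0 \<Longrightarrow> x \<in> std_grid n"
  unfolding in_box_def std_grid_iff using order_trans by blast

text \<open>A difference enlarges the support by one step, and steps have length at most 1.\<close>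

lemma in_box_std_diff:
  assumes "in_box n R g"
  shows "in_box n (R + 1) (std_diff n i g)"
  unfolding in_box_def
proof (intro allI impI)
  fix x assume "std_diff n i g x \<noteq> 0"
  then have "g x \<noteq> 0 \<or> g (x + step n *\<^sub>R axis i 1) \<noteq> 0"
    by (auto simp: std_diff_def)
  then show "x \<in> step_lattice n \<and> (\<forall>i. \<bar>x $ i\<bar> \<le> R + 1)"
  proof
    assume "g x \<noteq> 0"
    then have "x \<in> step_lattice n" "\<And>k. \<bar>x $ k\<bar> \<le> R" using assms by (auto simp: in_box_def)
    moreover have "\<bar>x $ k\<bar> \<le> R + 1" for k using \<open>\<bar>x $ k\<bar> \<le> R\<close> by linarith
    ultimately show ?thesis by blast
  next
    assume "g (x + step n *\<^sub>R axis i 1) \<noteq> 0"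
    then have x: "x \<in> step_lattice n" "\<And>k. \<bar>x $ k + step n * axis i 1 $ k\<bar> \<le> R"
      using assms unfolding in_box_def by (auto simp: lattice_shift)
    have "\<bar>x $ k\<bar> \<le> R + 1" for k
    proof -
      have "\<bar>step n * axis i 1 $ k\<bar> \<le> 1" using step_le[of n] by (simp add: axis_def)
      then show ?thesis using x(2)[of k] by linarith
    qed
    then show ?thesis using x by blast
  qed
qed

lemma card_grid_points_le:
  fixes R :: real
  assumes "R \<ge> 0"
  shows "card {t \<in> grid_points n. \<bar>t\<bar> \<le> R} \<le> (2 * R + 1) * fact n"
proof -
  let ?J = "{- \<lfloor>R * fact n\<rfloor>..\<lfloor>R * fact n\<rfloor>}"
  have "{t \<in> grid_points n. \<bar>t\<bar> \<le> R} \<subseteq> (\<lambda>j. of_int j * step n) ` ?J"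
  proof
    fix t assume "t \<in> {t \<in> grid_points n. \<bar>t\<bar> \<le> R}"
    then obtain l :: nat where l: "t = (of_nat l - (fact n)\<^sup>2) * step n" "\<bar>t\<bar> \<le> R"
      by (auto simp: grid_points_def)
    define j where "j = int l - (fact n)\<^sup>2"
    have t: "t = of_int j * step n" using l(1) by (simp add: j_def)
    then have "\<bar>real_of_int j\<bar> \<le> R * fact n"
      using l(2) by (simp add: step_def abs_mult divide_le_eq)
    then have "j \<in> ?J" by (simp add: abs_le_iff) linarith
    then show "t \<in> (\<lambda>j. of_int j * step n) ` ?J" using t by blast
  qed
  then have "card {t \<in> grid_points n. \<bar>t\<bar> \<le> R} \<le> card ((\<lambda>j. of_int j * step n) ` ?J)"
    by (intro card_mono) auto
  also have "\<dots> \<le> card ?J" by (rule card_image_le) simp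
  finally have "real (card {t \<in> grid_points n. \<bar>t\<bar> \<le> R}) \<le> real (card ?J)" by simp
  also have "\<dots> = 2 * of_int \<lfloor>R * fact n\<rfloor> + 1"
    using assms by (simp add: of_nat_nat)
  also have "\<dots> \<le> 2 * (R * fact n) + 1" by linarith
  also have "\<dots> \<le> (2 * R + 1) * fact n"
    by (simp add: algebra_simps)
  finally show ?thesis .
qed

text \<open>The count is a product over the coordinates, with at most (2R + 1) n! for each.
  Multiplied by the volume of a cell it stays bounded as n grows; this cancels the power of
  \<open>step n\<close> in the kernel bounds.\<close>

lemma card_std_grid_box:
  fixes R :: real
  assumes "R \<ge> 0"
  shows "real (card {x \<in> (std_grid n :: (real ^ 'k::finite) set). \<forall>i. \<bar>x $ i\<bar> \<le> R}) * step n ^ CARD('k) \<le> (2 * R + 1) ^ CARD('k)"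
proof -
  let ?h = "\<lambda>t. if \<bar>t\<bar> \<le> R then 1 else 0 :: real"
  let ?c = "real (card {t \<in> grid_points n. \<bar>t\<bar> \<le> R})"
  have "real (card {x \<in> (std_grid n :: (real ^ 'k) set). \<forall>i. \<bar>x $ i\<bar> \<le> R}) =
      (\<Sum>x\<in>(std_grid n :: (real ^ 'k) set). if \<forall>i. \<bar>x $ i\<bar> \<le> R then 1 else 0)"
    by (simp add: finite_std_grid sum.If_cases Int_def)
  also have "\<dots> = (\<Sum>x\<in>(std_grid n :: (real ^ 'k) set). \<Prod>i\<in>UNIV. ?h (x $ i))"
  proof (rule sum.cong[OF refl])
    show "(if \<forall>i. \<bar>x $ i\<bar> \<le> R then 1 else 0) = (\<Prod>i\<in>UNIV. ?h (x $ i))" for x :: "real ^ 'k"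
      by (cases "\<forall>i. \<bar>x $ i\<bar> \<le> R") (auto simp: prod_zero_iff)
  qed
  also have "\<dots> = (\<Prod>i\<in>(UNIV :: 'k set). \<Sum>t\<in>grid_points n. ?h t)"
    by (rule sum_std_grid_prod)
  also have "\<dots> = ?c ^ CARD('k)"
    by (simp add: finite_grid_points sum.If_cases Int_def)
  finally have "real (card {x \<in> (std_grid n :: (real ^ 'k) set). \<forall>i. \<bar>x $ i\<bar> \<le> R}) * step n ^ CARD('k) =
      (?c * step n) ^ CARD('k)"
    by (simp add: power_mult_distrib)
  also have "\<dots> \<le> (2 * R + 1) ^ CARD('k)"
    using card_grid_points_le[OF assms, of n] by (intro power_mono) (auto simp: step_def divide_le_eq)
  finally show ?thesis .
qed

locale smooth_step =
  fixes H :: "nat \<Rightarrow> real \<Rightarrow> real" and A :: "nat \<Rightarrow> real"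
  assumes H_deriv: "\<And>m t. (H m has_real_derivative H (Suc m) t) (at t)"
    and H_bound: "\<And>m t. \<bar>H m t\<bar> \<le> A m"
    and H_mono: "mono (H 0)"
    and H_0: "\<And>t. t \<le> 0 \<Longrightarrow> H 0 t = 0"
    and H_1: "\<And>t. t \<ge> 1 \<Longrightarrow> H 0 t = 1"
begin

text \<open>For \<open>m = 0\<close> the translates of \<open>hat\<close> by the points of the one-dimensional grid
  telescope to \<open>1\<close>; \<open>m\<close> counts derivatives.\<close>

definition hat :: "nat \<Rightarrow> nat \<Rightarrow> real \<Rightarrow> real" where
  "hat n m s = real n ^ m * (H m (real n * (s + step n)) - H m (real n * s))"

lemma hat_deriv: "(hat n m has_real_derivative hat n (Suc m) s) (at s)"
proof -
  have 1: "((\<lambda>s. H m (real n * (s + c))) has_real_derivative H (Suc m) (real n * (s + c)) * real n) (at s)" for c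
    by (rule DERIV_chain2[OF H_deriv]) (auto intro!: derivative_eq_intros)
  show ?thesis
    using DERIV_cmult[OF DERIV_diff[OF 1[of "step n"] 1[of 0]], of "real n ^ m"]
    by (simp add: hat_def[abs_def] algebra_simps)
qed

lemma hat_nonneg: "0 \<le> hat n 0 s"
  using monoD[OF H_mono, of "real n * s" "real n * (s + step n)"] by (simp add: hat_def mult_left_mono)

text \<open>The two values of \<open>H 0\<close> are both 0 or both 1 unless s lies between -1/n!
  and 1/n, and 1/n! is at most 1/n.\<close>

lemma hat_support:
  assumes "n \<ge> 1" "hat n 0 s \<noteq> 0"
  shows "\<bar>s\<bar> \<le> 1 / n"
proof (rule ccontr)
  assume "\<not> ?thesis"
  then consider "s > 1 / n" | "s < - (1 / n)" by linarith
  then have "hat n 0 s = 0"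
  proof cases
    case 1
    then have "real n * s \<ge> 1" using assms(1) by (simp add: field_simps)
    moreover have "real n * (s + step n) \<ge> real n * s" by (intro mult_left_mono) auto
    ultimately show ?thesis by (simp add: hat_def H_1)
  next
    case 2
    have "real n \<le> fact n" by (metis fact_ge_self of_nat_fact of_nat_le_iff)
    then have "step n \<le> 1 / n" using assms(1) by (simp add: step_def frac_le)
    then have "s + step n \<le> 0" "s \<le> 0" using 2 step_pos[of n] by linarith+
    then have "real n * (s + step n) \<le> 0" "real n * s \<le> 0" by (auto simp: mult_nonneg_nonpos)
    then show ?thesis by (simp add: hat_def H_0)
  qed
  then show False using assms(2) by simp
qed

text \<open>The two arguments of \<open>H m\<close> differ by n times the step, and the mean value
  theorem brings in one more derivative. For n = 0 the increment vanishes, and \<open>hat\<close>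
  with it.\<close>

lemma hat_bound: "\<bar>hat n m s\<bar> \<le> real n ^ (m + 1) * step n * A (m + 1)"
proof (cases "real n * step n = 0")
  case True
  then show ?thesis by (simp add: hat_def)
next
  case False
  then have "real n * s < real n * (s + step n)" using step_pos[of n] by (simp add: algebra_simps)
  from MVT2[OF this, of "H m" "H (Suc m)"] H_deriv obtain z where
    "H m (real n * (s + step n)) - H m (real n * s) = (real n * step n) * H (Suc m) z"
    by (auto simp: algebra_simps)
  then have "hat n m s = real n ^ (m + 1) * step n * H (m + 1) z"
    by (simp add: hat_def)
  then show ?thesis
    using H_bound[of "m + 1" z] by (simp add: abs_mult mult_left_mono)
qed

lemma hat_sum:
  assumes "n \<ge> 1" "\<bar>y\<bar> \<le> fact n - 1"
  shows "(\<Sum>t\<in>grid_points n. hat n 0 (y - t)) = 1"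
proof -
  let ?M = "(fact n)\<^sup>2 :: nat"
  \<comment> \<open>Moving on by one grid point turns the second term of \<open>hat\<close> into the
    first, so the sum telescopes. The bound on y makes the argument of \<open>H 0\<close> at least 1
    at the lower end and at most 0 at the upper end.\<close>
  define a where "a l = H 0 (real n * (y - (real l - real ?M) * step n + step n))" for l
  have "inj_on (\<lambda>l::nat. (real l - (fact n)\<^sup>2) * step n) {..2 * ?M}"
    by (auto simp: inj_on_def)
  then have "(\<Sum>t\<in>grid_points n. hat n 0 (y - t)) = (\<Sum>l\<le>2 * ?M. hat n 0 (y - (real l - (fact n)\<^sup>2) * step n))"
    unfolding grid_points_def by (simp add: sum.reindex)
  also have "\<dots> = (\<Sum>l\<le>2 * ?M. a l - a (Suc l))"
    by (intro sum.cong) (auto simp: hat_def a_def algebra_simps)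
  also have "\<dots> = a 0 - a (Suc (2 * ?M))"
    by (rule sum_telescope)
  also have "\<dots> = 1"
  proof -
    have M: "real ?M * step n = fact n" by (simp add: step_def power2_eq_square)
    have y: "- y \<le> fact n - 1" "y \<le> fact n - 1" using assms(2) by linarith+
    have "y - (real 0 - real ?M) * step n + step n = y + fact n + step n"
      using M by (simp add: algebra_simps)
    then have "y - (real 0 - real ?M) * step n + step n \<ge> 1"
      using y step_nonneg[of n] by linarith
    then have "real n * (y - (real 0 - real ?M) * step n + step n) \<ge> 1 * 1"
      using assms(1) by (intro mult_mono) auto
    moreover have "y - (real (Suc (2 * ?M)) - real ?M) * step n + step n = y - fact n"
      using M by (simp add: algebra_simps)
    then have "y - (real (Suc (2 * ?M)) - real ?M) * step n + step n \<le> 0"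
      using y by linarith
    then have "real n * (y - (real (Suc (2 * ?M)) - real ?M) * step n + step n) \<le> 0"
      by (auto simp: mult_nonneg_nonpos)
    ultimately show ?thesis
      unfolding a_def by (simp only: H_0 H_1)
  qed
  finally show ?thesis .
qed

definition kernel :: "nat \<Rightarrow> real ^ 'k::finite \<Rightarrow> real" where
  "kernel n z = (\<Prod>i\<in>UNIV. hat n 0 (z $ i))"

lemma kernel_nonneg: "0 \<le> kernel n z"
  unfolding kernel_def by (intro prod_nonneg ballI hat_nonneg)

lemma kernel_support:
  fixes z :: "real ^ 'k::finite"
  assumes "n \<ge> 1" "kernel n z \<noteq> 0"
  shows "norm z \<le> CARD('k) / n"
proof -
  have "\<bar>z $ i\<bar> \<le> 1 / n" for i
    using assms by (intro hat_support) (auto simp: kernel_def)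
  then show ?thesis using norm_le_sum_components[of z "1 / n"] by simp
qed

text \<open>A derivative in direction i acts on the i-th factor only, so the list enters through its
  multiplicities alone.\<close>

lemma kernel_smooth: "smooth (kernel n :: real ^ 'k::finite \<Rightarrow> real)"
  and kernel_partials: "partials is (kernel n) = (\<lambda>z :: real ^ 'k::finite. \<Prod>i\<in>UNIV. hat n (count_list is i) (z $ i))"
proof -
  let ?\<Phi> = "\<lambda>is (z :: real ^ 'k). \<Prod>i\<in>UNIV. hat n (count_list is i) (z $ i)"
  have "((\<lambda>t. ?\<Phi> is (z + t *\<^sub>R axis j 1)) has_real_derivative ?\<Phi> (j # is) z) (at 0)" for "is" j z
  proof -
    let ?P = "\<Prod>i\<in>UNIV - {j}. hat n (count_list is i) (z $ i)"
    have "?\<Phi> is (z + t *\<^sub>R axis j 1) = hat n (count_list is j) (z $ j + t) * ?P" for t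
      by (subst prod.remove[of _ j]) (auto simp: axis_def intro!: prod.cong)
    moreover have "?\<Phi> (j # is) z = hat n (Suc (count_list is j)) (z $ j) * ?P"
      by (subst prod.remove[of _ j]) (auto intro!: prod.cong)
    moreover have "((\<lambda>t. hat n (count_list is j) (z $ j + t)) has_real_derivative hat n (Suc (count_list is j)) (z $ j)) (at 0)"
      using DERIV_shift[of "hat n (count_list is j)" "hat n (Suc (count_list is j)) (z $ j)" 0 "z $ j"] hat_deriv
      by (simp add: add.commute)
    ultimately show ?thesis by (auto intro!: derivative_eq_intros)
  qed
  moreover have "continuous_on UNIV (?\<Phi> is)" for "is"
  proof -
    have "continuous_on UNIV (hat n m)" for m
      using hat_deriv by (intro continuous_at_imp_continuous_on ballI DERIV_isCont)
    then have "continuous_on UNIV (\<lambda>z :: real ^ 'k. hat n m (z $ i))" for m i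
      by (rule continuous_on_compose2[of UNIV "hat n m" UNIV "\<lambda>z. z $ i"]) (auto intro!: continuous_intros)
    then show ?thesis
      by (rule continuous_on_prod)
  qed
  moreover have "kernel n = ?\<Phi> []" by (auto simp: kernel_def)
  ultimately show "smooth (kernel n :: real ^ 'k \<Rightarrow> real)" "partials is (kernel n) = ?\<Phi> is"
    using smooth_tower[of ?\<Phi>] by auto
qed

text \<open>A common bound of \<open>A 1\<close>, ..., \<open>A (m + 1)\<close>; a sum will do since
  the terms are nonnegative.\<close>

definition A_max :: "nat \<Rightarrow> real" where
  "A_max m = (\<Sum>l\<le>m + 1. A l)"

lemma A_nonneg: "0 \<le> A m"
  using H_bound[of m 0] by linarith

lemma A_le_A_max: "l \<le> m \<Longrightarrow> A (l + 1) \<le> A_max m"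
  unfolding A_max_def by (intro member_le_sum) (auto simp: A_nonneg)

text \<open>Besides the powers of n from differentiation every coordinate contributes one factor n
  and one factor \<open>step n\<close>; the multiplicities add up to the length of the list.\<close>

lemma kernel_partials_bound:
  fixes z :: "real ^ 'k::finite"
  shows "\<bar>partials is (kernel n) z\<bar> \<le>
    real n ^ (length is + CARD('k)) * A_max (length is) ^ CARD('k) * step n ^ CARD('k)"
proof -
  have "\<bar>partials is (kernel n) z\<bar> = (\<Prod>i\<in>UNIV. \<bar>hat n (count_list is i) (z $ i)\<bar>)"
    by (simp add: kernel_partials abs_prod)
  also have "\<dots> \<le> (\<Prod>i\<in>(UNIV :: 'k set). real n ^ count_list is i * (real n * A_max (length is) * step n))"
  proof (rule prod_mono)
    fix i
    have "\<bar>hat n (count_list is i) (z $ i)\<bar> \<le> real n ^ (count_list is i + 1) * step n * A (count_list is i + 1)"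
      by (rule hat_bound)
    also have "\<dots> \<le> real n ^ (count_list is i + 1) * step n * A_max (length is)"
      by (intro mult_left_mono A_le_A_max count_le_length) auto
    finally show "0 \<le> \<bar>hat n (count_list is i) (z $ i)\<bar> \<and> \<bar>hat n (count_list is i) (z $ i)\<bar> \<le>
        real n ^ count_list is i * (real n * A_max (length is) * step n)"
      by (simp add: mult_ac)
  qed
  also have "\<dots> = real n ^ (\<Sum>i\<in>UNIV. count_list is i) * (real n * A_max (length is) * step n) ^ CARD('k)"
    by (simp add: prod.distrib power_sum)
  also have "(\<Sum>i\<in>UNIV. count_list is i) = length is"
    by (rule sum_count_set) auto
  finally show ?thesis by (simp add: power_mult_distrib power_add mult_ac)
qed

text \<open>There is no volume factor, because well inside the grid the translates of
  \<open>kernel n\<close> already add up to 1.\<close>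

definition smear :: "nat \<Rightarrow> (real ^ 'k::finite \<Rightarrow> real) \<Rightarrow> real ^ 'k \<Rightarrow> real" where
  "smear n g y = (\<Sum>x\<in>std_grid n. g x * kernel n (y - x))"

lemma kernel_shift_smooth: "smooth (\<lambda>y. kernel n (y - x))"
  and kernel_shift_partials: "partials is (\<lambda>y. kernel n (y - x)) = (\<lambda>y. partials is (kernel n) (y - x))"
  using smooth_shift(1)[OF kernel_smooth[of n], of "- x"]
    smooth_shift(2)[OF kernel_smooth[of n], of "is" "- x"] by simp_all

lemma smear_smooth: "smooth (smear n g)"
  and smear_partials: "partials is (smear n g) = (\<lambda>y. \<Sum>x\<in>std_grid n. g x * partials is (kernel n) (y - x))"
  using smooth_sum[of "std_grid n" "\<lambda>x y. kernel n (y - x)" g "is"] finite_std_grid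
  by (auto simp: smear_def[abs_def] kernel_shift_smooth kernel_shift_partials)

lemma smear_support:
  fixes g :: "real ^ 'k::finite \<Rightarrow> real"
  assumes "n \<ge> 1" "smear n g y \<noteq> 0"
  shows "\<exists>x. g x \<noteq> 0 \<and> norm (y - x) \<le> CARD('k) / n"
proof -
  obtain x where "g x * kernel n (y - x) \<noteq> 0"
    using assms(2) unfolding smear_def by (meson sum.neutral)
  then show ?thesis using kernel_support[OF assms(1)] by (intro exI[of _ x]) auto
qed

lemma kernel_sum:
  fixes y :: "real ^ 'k::finite"
  assumes "n \<ge> 1" "\<And>i. \<bar>y $ i\<bar> \<le> fact n - 1"
  shows "(\<Sum>x\<in>std_grid n. kernel n (y - x)) = 1"
proof -
  have "(\<Sum>x\<in>std_grid n. kernel n (y - x)) = (\<Sum>x\<in>std_grid n. \<Prod>i\<in>UNIV. hat n 0 (y $ i - x $ i))"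
    by (simp add: kernel_def)
  also have "\<dots> = (\<Prod>i\<in>UNIV. \<Sum>t\<in>grid_points n. hat n 0 (y $ i - t))"
    by (rule sum_std_grid_prod)
  also have "\<dots> = 1"
    using hat_sum[OF assms(1)] assms(2) by simp
  finally show ?thesis .
qed

text \<open>\<open>smear n g y\<close> is an average of values of g, with nonnegative weights
  \<open>kernel n (y - x)\<close> of total 1 that vanish unless x is within CARD('k)/n of y.\<close>

lemma smear_close:
  fixes y :: "real ^ 'k::finite"
  assumes "n \<ge> 1" "\<And>i. \<bar>y $ i\<bar> \<le> fact n - 1"
    and "\<And>x. x \<in> std_grid n \<Longrightarrow> norm (y - x) \<le> CARD('k) / n \<Longrightarrow> \<bar>g x - c\<bar> \<le> r"
  shows "\<bar>smear n g y - c\<bar> \<le> r"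
proof -
  have "smear n g y - c = (\<Sum>x\<in>std_grid n. (g x - c) * kernel n (y - x))"
    using kernel_sum[OF assms(1,2)] by (simp add: smear_def left_diff_distrib sum_subtractf flip: sum_distrib_left)
  also have "\<bar>\<dots>\<bar> \<le> (\<Sum>x\<in>std_grid n. \<bar>(g x - c) * kernel n (y - x)\<bar>)"
    by (rule sum_abs)
  also have "\<dots> \<le> (\<Sum>x\<in>std_grid n. r * kernel n (y - x))"
  proof (rule sum_mono)
    fix x :: "real ^ 'k" assume "x \<in> std_grid n"
    then show "\<bar>(g x - c) * kernel n (y - x)\<bar> \<le> r * kernel n (y - x)"
      using assms(3)[of x] kernel_support[OF assms(1), of "y - x"] kernel_nonneg[of n "y - x"]
      by (cases "kernel n (y - x) = 0") (auto simp: abs_mult intro: mult_right_mono)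
  qed
  also have "\<dots> = r"
    using kernel_sum[OF assms(1,2)] by (simp flip: sum_distrib_left)
  finally show ?thesis .
qed

text \<open>Translation invariance of the convolution. The margin \<open>R + 1 \<le> fact n\<close>
  keeps the support of g on the grid when it is moved by one step, so that reindexing the finite sum
  loses no term.\<close>

lemma std_diff_smear:
  fixes g :: "real ^ 'k::finite \<Rightarrow> real"
  assumes "in_box n R g" "R + 1 \<le> fact n"
  shows "std_diff n i (smear n g) = smear n (std_diff n i g)"
proof
  fix y
  let ?e = "step n *\<^sub>R axis i 1 :: real ^ 'k"
  have grid: "x \<in> std_grid n" if "g x \<noteq> 0" for x
    using in_box_grid[OF assms(1) _ that] assms(2) by simp
  have grid': "x - ?e \<in> std_grid n" if "g x \<noteq> 0" for x
  proof -
    have x: "x \<in> step_lattice n" "\<And>k. \<bar>x $ k\<bar> \<le> R"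
      using assms(1) that by (auto simp: in_box_def)
    have "x - ?e \<in> step_lattice n"
      using lattice_shift[of "x - ?e" n i] x(1) by simp
    moreover have "\<bar>(x - ?e) $ k\<bar> \<le> fact n" for k
    proof -
      have "\<bar>(x - ?e) $ k\<bar> \<le> \<bar>x $ k\<bar> + \<bar>step n\<bar>"
        using abs_triangle_ineq4[of "x $ k" "step n"] by (auto simp: axis_def)
      then show ?thesis using x(2)[of k] assms(2) step_le[of n] by simp
    qed
    ultimately show ?thesis by (simp add: std_grid_iff)
  qed
  have "smear n g (y + ?e) = (\<Sum>x\<in>std_grid n. g (x + ?e) * kernel n (y - x))"
    unfolding smear_def
    by (rule sum.reindex_bij_witness_not_neutral[where i = "\<lambda>x. x + ?e" and j = "\<lambda>x. x - ?e"
          and S' = "{x \<in> std_grid n. g x = 0}" and T' = "{x \<in> std_grid n. g (x + ?e) = 0}"])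
      (use grid grid' in \<open>auto simp: algebra_simps intro: finite_subset[OF _ finite_std_grid[of n]]\<close>)
  moreover have "smear n (std_diff n i g) y = ((\<Sum>x\<in>std_grid n. g (x + ?e) * kernel n (y - x)) - smear n g y) / step n"
    by (simp add: std_diff_def smear_def sum_subtractf sum_divide_distrib diff_divide_distrib left_diff_distrib)
  ultimately show "std_diff n i (smear n g) y = smear n (std_diff n i g) y"
    by (simp add: std_diff_def[of n i "smear n g"])
qed

lemma std_diffs_smear:
  assumes "in_box n R g" "R + length is \<le> fact n"
  shows "diffs n is (smear n g) = smear n (diffs n is g)
    \<and> in_box n (R + length is) (diffs n is g)"
  using assms
proof (induction "is")
  case (Cons i "is")
  then have IH: "diffs n is (smear n g) = smear n (diffs n is g)"
    "in_box n (R + length is) (diffs n is g)" by auto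
  show ?case
    using std_diff_smear[OF IH(2), of i] in_box_std_diff[OF IH(2), of i] Cons.prems IH(1)
    by (simp add: algebra_simps)
qed simp

text \<open>The number of grid points in the box is multiplied by the bound for the kernel; the
  powers of \<open>step n\<close> cancel and a power of n remains.\<close>

lemma smear_partials_bound:
  fixes g :: "real ^ 'k::finite \<Rightarrow> real"
  assumes "in_box n R g" "R \<ge> 0" "\<And>x. \<bar>g x\<bar> \<le> G"
  shows "\<bar>partials is (smear n g) y\<bar> \<le>
    G * ((2 * R + 1) * A_max (length is)) ^ CARD('k) * real n ^ (length is + CARD('k))"
proof -
  let ?S = "{x \<in> (std_grid n :: (real ^ 'k) set). \<forall>i. \<bar>x $ i\<bar> \<le> R}"
  let ?B = "real n ^ (length is + CARD('k)) * A_max (length is) ^ CARD('k) * step n ^ CARD('k)"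
  have G: "G \<ge> 0" using assms(3)[of 0] by linarith
  have A: "A_max (length is) \<ge> 0" unfolding A_max_def by (intro sum_nonneg A_nonneg)
  have "partials is (smear n g) y = (\<Sum>x\<in>std_grid n. g x * partials is (kernel n) (y - x))"
    by (simp add: smear_partials)
  also have "\<dots> = (\<Sum>x\<in>?S. g x * partials is (kernel n) (y - x))"
    using assms(1) by (intro sum.mono_neutral_right) (auto simp: in_box_def finite_std_grid)
  also have "\<bar>\<dots>\<bar> \<le> (\<Sum>x\<in>?S. \<bar>g x * partials is (kernel n) (y - x)\<bar>)"
    by (rule sum_abs)
  also have "\<dots> \<le> (\<Sum>x\<in>?S. G * ?B)"
    unfolding abs_mult using G by (intro sum_mono mult_mono assms kernel_partials_bound) auto
  also have "\<dots> = G * A_max (length is) ^ CARD('k) * real n ^ (length is + CARD('k)) * (real (card ?S) * step n ^ CARD('k))"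
    by (simp add: mult_ac)
  also have "\<dots> \<le> G * A_max (length is) ^ CARD('k) * real n ^ (length is + CARD('k)) * (2 * R + 1) ^ CARD('k)"
    using G A by (intro mult_left_mono card_std_grid_box assms) auto
  finally show ?thesis by (simp add: power_mult_distrib mult_ac)
qed

text \<open>The error is measured against the supremum of \<open>g\<close> alone, not of its differences: the powers
  of \<open>n\<close> lost by differentiating the kernel are dominated by \<open>1/n!\<close>.\<close>

lemma smear_partials_approx:
  assumes "R \<ge> 0"
  shows "\<exists>e. e \<longlonglongrightarrow> 0 \<and> (\<forall>n (g :: real ^ 'k::finite \<Rightarrow> real) G y.
    in_box n R g \<longrightarrow> R + length is \<le> fact n \<longrightarrow> (\<forall>x. \<bar>g x\<bar> \<le> G) \<longrightarrow>
    \<bar>partials (rev is) (smear n g) y - smear n (diffs n is g) y\<bar> \<le> G * e n)"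
proof -
  let ?m = "length is" and ?k = "CARD('k)"
  \<comment> \<open>The constant of \<open>smear_partials_bound\<close> at order
    \<open>Suc ?m\<close>, times \<open>?k\<close> from the Lipschitz estimate and \<open>?m\<close>
    from the distance in \<open>std_diffs_MVT\<close>.\<close>
  define D where "D = ((2 * R + 1) * A_max (Suc ?m)) ^ ?k * ?k * ?m"
  show ?thesis
  proof (intro exI[of _ "\<lambda>n. D * (real n ^ (Suc ?m + ?k) * step n)"] conjI allI impI)
    show "(\<lambda>n. D * (real n ^ (Suc ?m + ?k) * step n)) \<longlonglongrightarrow> 0"
      using tendsto_mult_right_zero[OF power_step_LIMSEQ] .
  next
    fix n :: nat and g :: "real ^ 'k \<Rightarrow> real" and G :: real and y :: "real ^ 'k"
    assume g: "in_box n R g" "R + ?m \<le> fact n" "\<forall>x. \<bar>g x\<bar> \<le> G"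
    let ?\<psi> = "smear n g"
    let ?f = "partials (rev is) ?\<psi>"
    \<comment> \<open>The differences of the smeared function are derivatives at a point within
      \<open>?m\<close> steps of y; one further derivative bounds the change between that point and
      y.\<close>
    obtain \<xi> where \<xi>: "diffs n is ?\<psi> y = ?f \<xi>" "norm (\<xi> - y) \<le> ?m * step n"
      using std_diffs_MVT[OF smear_smooth] by blast
    let ?C = "G * ((2 * R + 1) * A_max (Suc ?m)) ^ ?k * real n ^ (Suc ?m + ?k)"
    have f: "smooth ?f"
      by (intro smooth_partials smear_smooth)
    have "\<bar>partial i ?f x\<bar> \<le> ?C" for i x
      using smear_partials_bound[OF g(1) assms, of G "i # rev is" x] g(3) by simp
    then have "\<bar>?f y - ?f \<xi>\<bar> \<le> ?C * ?k * norm (y - \<xi>)"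
      by (rule smooth_Lipschitz[OF f])
    also have "\<dots> \<le> ?C * ?k * (?m * step n)"
    proof (rule mult_left_mono)
      show "norm (y - \<xi>) \<le> ?m * step n" using \<xi>(2) by (simp add: norm_minus_commute)
      have "0 \<le> \<bar>partial undefined ?f 0\<bar>" by simp
      also have "\<dots> \<le> ?C" by fact
      finally show "0 \<le> ?C * ?k" by simp
    qed
    finally have "\<bar>?f y - ?f \<xi>\<bar> \<le> G * (D * (real n ^ (Suc ?m + ?k) * step n))"
      by (simp add: D_def mult_ac)
    moreover have "?f \<xi> = smear n (diffs n is g) y"
      using \<xi>(1) std_diffs_smear[OF g(1,2)] by simp
    ultimately show "\<bar>?f y - smear n (diffs n is g) y\<bar> \<le> G * (D * (real n ^ (Suc ?m + ?k) * step n))"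
      by simp
  qed
qed

end

section \<open>Distributions\<close>

lemma topspace_D_topology: "topspace (D_topology \<Omega>) = test_functions \<Omega>"
proof
  show "topspace (D_topology \<Omega>) \<subseteq> test_functions \<Omega>"
    unfolding topspace_def openin_D_topology by (auto simp: D_open_def)
  have "zero_nbhd \<Omega> (test_functions \<Omega>)"
    unfolding zero_nbhd_def using test_functions_mono
    by (auto intro!: test_functions_linear exI[of _ 0] exI[of _ 1])
  then have "D_open \<Omega> (test_functions \<Omega>)"
    unfolding D_open_def using test_functions_add by blast
  then show "test_functions \<Omega> \<subseteq> topspace (D_topology \<Omega>)"
    by (simp add: openin_subset openin_D_topology)
qed

lemma distribution_add:
  "T \<in> distributions \<Omega> \<Longrightarrow> \<phi> \<in> test_functions \<Omega> \<Longrightarrow> \<psi> \<in> test_functions \<Omega> \<Longrightarrow>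
    T (\<lambda>x. \<phi> x + \<psi> x) = T \<phi> + T \<psi>"
  by (simp add: distributions_def)

lemma distribution_scale:
  "T \<in> distributions \<Omega> \<Longrightarrow> \<phi> \<in> test_functions \<Omega> \<Longrightarrow> T (\<lambda>x. r * \<phi> x) = r * T \<phi>"
  by (simp add: distributions_def)

lemma distribution_zero: "T \<in> distributions \<Omega> \<Longrightarrow> T (\<lambda>x. 0) = 0"
  using distribution_scale[OF _ test_functions_zero, of T \<Omega> 0] by simp

text \<open>Continuity at 0 puts a neighbourhood of zero into the preimage of (-1, 1). On
  \<open>test_functions K\<close> it is described by finitely many derivatives, and homogeneity of T
  turns the inclusion into an estimate of finite order.\<close>

lemma distribution_bound:
  assumes T: "T \<in> distributions \<Omega>" and K: "compact K" "K \<subseteq> \<Omega>"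
  shows "\<exists>m C. C > 0 \<and> (\<forall>\<psi> \<in> test_functions K. \<forall>s>0.
    (\<forall>is x. length is \<le> m \<longrightarrow> \<bar>partials is \<psi> x\<bar> \<le> s) \<longrightarrow> \<bar>T \<psi>\<bar> \<le> C * s)"
proof -
  note T_scale = distribution_scale[OF T] and T0 = distribution_zero[OF T]
  let ?U = "{\<psi> \<in> test_functions \<Omega>. T \<psi> \<in> {-1<..<1}}"
  have "openin (D_topology \<Omega>) ?U"
    using T openin_continuous_map_preimage[of "D_topology \<Omega>" euclideanreal T "{-1<..<1}"]
    by (simp add: distributions_def topspace_D_topology)
  moreover have "(\<lambda>x. 0) \<in> ?U" by (simp add: T0 test_functions_zero)
  ultimately obtain W where W: "zero_nbhd \<Omega> W" "\<forall>\<psi>\<in>W. (\<lambda>x. 0 + \<psi> x) \<in> ?U"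
    unfolding openin_D_topology D_open_def by blast
  obtain m \<delta> where m: "\<delta> > 0" "\<And>\<phi>. \<phi> \<in> test_functions K \<Longrightarrow>
      (\<forall>is. length is \<le> m \<longrightarrow> (\<forall>x. \<bar>partials is \<phi> x\<bar> \<le> \<delta>)) \<Longrightarrow> \<phi> \<in> W"
    using W(1) K unfolding zero_nbhd_def by meson
  show ?thesis
  proof (intro exI[of _ m] exI[of _ "1 / \<delta>"] conjI ballI allI impI)
    fix \<psi> and s :: real
    assume \<psi>: "\<psi> \<in> test_functions K" and s: "s > 0"
      and le: "\<forall>is x. length is \<le> m \<longrightarrow> \<bar>partials is \<psi> x\<bar> \<le> s"
    have \<psi>\<Omega>: "\<psi> \<in> test_functions \<Omega>" using \<psi> test_functions_mono[OF K(2)] by blast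
    have "(\<lambda>x. (\<delta> / s) * \<psi> x) \<in> W"
    proof (rule m(2))
      show "(\<lambda>x. (\<delta> / s) * \<psi> x) \<in> test_functions K" using \<psi> by (rule test_functions_scale)
      have "\<bar>partials is (\<lambda>x. (\<delta> / s) * \<psi> x) x\<bar> \<le> \<delta>" if "length is \<le> m" for "is" x
      proof -
        have "\<bar>partials is (\<lambda>x. (\<delta> / s) * \<psi> x) x\<bar> = (\<delta> / s) * \<bar>partials is \<psi> x\<bar>"
          using m(1) s by (subst partials_scale[OF test_function_smooth[OF \<psi>]]) (simp add: abs_mult)
        also have "\<dots> \<le> (\<delta> / s) * s"
          using le that m(1) s by (intro mult_left_mono) auto
        finally show ?thesis using s by simp
      qed
      then show "\<forall>is. length is \<le> m \<longrightarrow> (\<forall>x. \<bar>partials is (\<lambda>x. (\<delta> / s) * \<psi> x) x\<bar> \<le> \<delta>)" by blast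
    qed
    then have "T (\<lambda>x. (\<delta> / s) * \<psi> x) \<in> {-1<..<1}" using W(2) by auto
    then have "\<bar>(\<delta> / s) * T \<psi>\<bar> < 1"
      by (simp only: T_scale[OF \<psi>\<Omega>] greaterThanLessThan_iff) linarith
    then have "(\<delta> / s) * \<bar>T \<psi>\<bar> < 1"
      using m(1) s by (simp add: abs_mult)
    then show "\<bar>T \<psi>\<bar> \<le> 1 / \<delta> * s"
      using m(1) s by (simp add: field_simps)
  qed (use m in simp)
qed

text \<open>By linearity the sets where |T| < e are absolutely convex, so continuity at 0 on each
  \<open>test_functions K\<close> makes them neighbourhoods of zero, and additivity carries
  continuity from 0 to every point.\<close>

lemma distributionI:
  assumes ext: "T \<in> extensional (test_functions \<Omega>)"
    and add: "\<And>\<phi> \<psi>. \<phi> \<in> test_functions \<Omega> \<Longrightarrow> \<psi> \<in> test_functions \<Omega> \<Longrightarrow> T (\<lambda>x. \<phi> x + \<psi> x) = T \<phi> + T \<psi>"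
    and scale: "\<And>\<phi> r. \<phi> \<in> test_functions \<Omega> \<Longrightarrow> T (\<lambda>x. r * \<phi> x) = r * T \<phi>"
    and cont: "\<And>K e. compact K \<Longrightarrow> K \<subseteq> \<Omega> \<Longrightarrow> e > 0 \<Longrightarrow> \<exists>m::nat. \<exists>\<delta>>0. \<forall>\<psi> \<in> test_functions K.
      (\<forall>is x. length is \<le> m \<longrightarrow> \<bar>partials is \<psi> x\<bar> \<le> \<delta>) \<longrightarrow> \<bar>T \<psi>\<bar> < e"
  shows "T \<in> distributions \<Omega>"
proof -
  have "D_open \<Omega> {\<phi> \<in> test_functions \<Omega>. T \<phi> \<in> S}" if S: "open S" for S
    unfolding D_open_def
  proof (intro conjI ballI)
    fix \<phi> assume \<phi>: "\<phi> \<in> {\<phi> \<in> test_functions \<Omega>. T \<phi> \<in> S}"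
    then obtain e where e: "e > 0" "\<And>t. \<bar>t - T \<phi>\<bar> < e \<Longrightarrow> t \<in> S"
      using S unfolding open_dist dist_real_def by blast
    let ?W = "{\<psi> \<in> test_functions \<Omega>. \<bar>T \<psi>\<bar> < e}"
    have "zero_nbhd \<Omega> ?W"
      unfolding zero_nbhd_def
    proof (intro conjI ballI allI impI)
      fix \<phi> \<psi> and a b :: real
      assume "\<phi> \<in> ?W" "\<psi> \<in> ?W" and ab: "\<bar>a\<bar> + \<bar>b\<bar> \<le> 1"
      then have *: "\<phi> \<in> test_functions \<Omega>" "\<psi> \<in> test_functions \<Omega>" "\<bar>T \<phi>\<bar> < e" "\<bar>T \<psi>\<bar> < e" by auto
      have "T (\<lambda>x. a * \<phi> x + b * \<psi> x) = a * T \<phi> + b * T \<psi>"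
        using * by (simp add: add scale test_functions_scale)
      moreover define M where "M = max \<bar>T \<phi>\<bar> \<bar>T \<psi>\<bar>"
      have "\<bar>a * T \<phi> + b * T \<psi>\<bar> \<le> \<bar>a\<bar> * \<bar>T \<phi>\<bar> + \<bar>b\<bar> * \<bar>T \<psi>\<bar>"
        using abs_triangle_ineq[of "a * T \<phi>" "b * T \<psi>"] by (simp add: abs_mult)
      also have "\<dots> \<le> \<bar>a\<bar> * M + \<bar>b\<bar> * M"
        by (intro add_mono mult_left_mono) (auto simp: M_def)
      also have "\<dots> \<le> M"
        using mult_right_mono[OF ab, of M] by (simp add: distrib_right M_def le_max_iff_disj)
      also have "\<dots> < e" using * by (simp add: M_def)
      ultimately show "(\<lambda>x. a * \<phi> x + b * \<psi> x) \<in> ?W"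
        using * by (simp add: test_functions_linear)
    next
      fix K :: "(real ^ 'a) set" assume K: "compact K" "K \<subseteq> \<Omega>"
      obtain m \<delta> where "\<delta> > 0" "\<And>\<psi>. \<psi> \<in> test_functions K \<Longrightarrow>
          (\<forall>is x. length is \<le> m \<longrightarrow> \<bar>partials is \<psi> x\<bar> \<le> \<delta>) \<Longrightarrow> \<bar>T \<psi>\<bar> < e"
        using cont[OF K e(1)] by blast
      then show "\<exists>m. \<exists>\<delta>>0. \<forall>\<phi>\<in>test_functions K.
          (\<forall>is. length is \<le> m \<longrightarrow> (\<forall>x. \<bar>partials is \<phi> x\<bar> \<le> \<delta>)) \<longrightarrow> \<phi> \<in> ?W"
        using test_functions_mono[OF K(2)] by (intro exI[of _ m] exI[of _ \<delta>]) auto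
    qed auto
    moreover have "\<forall>\<psi>\<in>?W. (\<lambda>x. \<phi> x + \<psi> x) \<in> {\<phi> \<in> test_functions \<Omega>. T \<phi> \<in> S}"
      using \<phi> e(2) by (auto simp: add test_functions_add)
    ultimately show "\<exists>W. zero_nbhd \<Omega> W \<and> (\<forall>\<psi>\<in>W. (\<lambda>x. \<phi> x + \<psi> x) \<in> {\<phi> \<in> test_functions \<Omega>. T \<phi> \<in> S})"
      by blast
  qed auto
  then have "continuous_map (D_topology \<Omega>) euclideanreal T"
    by (simp add: continuous_map_def topspace_D_topology openin_D_topology)
  then show ?thesis
    using ext add scale by (simp add: distributions_def)
qed

lemma distribution_sum:
  assumes T: "T \<in> distributions \<Omega>" and "finite S" "\<And>s. s \<in> S \<Longrightarrow> F s \<in> test_functions \<Omega>"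
  shows "(\<lambda>y. \<Sum>s\<in>S. c s * F s y) \<in> test_functions \<Omega> \<and> T (\<lambda>y. \<Sum>s\<in>S. c s * F s y) = (\<Sum>s\<in>S. c s * T (F s))"
  using assms(2,3)
proof (induction S rule: finite_induct)
  case empty
  show ?case by (simp add: test_functions_zero distribution_zero[OF T])
next
  case (insert s S)
  let ?f = "\<lambda>y. c s * F s y" and ?g = "\<lambda>y. \<Sum>s\<in>S. c s * F s y"
  have 1: "?f \<in> test_functions \<Omega>" "?g \<in> test_functions \<Omega>" "T ?g = (\<Sum>s\<in>S. c s * T (F s))"
    using insert by (auto intro: test_functions_scale)
  have "T (\<lambda>y. ?f y + ?g y) = T ?f + T ?g"
    using 1 by (intro distribution_add[OF T])
  moreover have "T ?f = c s * T (F s)"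
    using insert.prems by (intro distribution_scale[OF T]) auto
  ultimately show ?case
    using insert.hyps 1 test_functions_add[OF 1(1,2)] by simp
qed

definition supported_on :: "(real ^ 'k::finite) set \<Rightarrow> nat \<Rightarrow> (real ^ 'k \<Rightarrow> real) \<Rightarrow> bool" where
  "supported_on K n g \<longleftrightarrow> (\<forall>x. g x \<noteq> 0 \<longrightarrow> x \<in> K \<inter> std_grid n)"

lemma compact_box:
  fixes K :: "(real ^ 'k::finite) set"
  assumes "compact K"
  shows "\<exists>R\<ge>0. \<forall>x\<in>K. \<forall>i. \<bar>x $ i\<bar> \<le> R"
proof -
  obtain R where R: "R > 0" "\<And>x. x \<in> K \<Longrightarrow> norm x \<le> R"
    using compact_imp_bounded[OF assms] by (auto simp: bounded_pos)
  have "\<bar>x $ i\<bar> \<le> R" if "x \<in> K" for x i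
    using R(2)[OF that] component_le_norm_cart[of x i] by linarith
  then show ?thesis using R(1) by (intro exI[of _ R]) auto
qed

lemma supported_on_in_box:
  assumes "supported_on K n g" "\<forall>x\<in>K. \<forall>i. \<bar>x $ i\<bar> \<le> R"
  shows "in_box n R g"
  using assms by (auto simp: supported_on_def in_box_def std_grid_iff)

text \<open>Leaves room in \<Omega> for enlarging supports: by CARD('k)/n when smearing, and by an
  infinitesimal when a support is recovered from its standard part.\<close>

lemma compact_nbhd:
  fixes K :: "'a::euclidean_space set"
  assumes "compact K" "open \<Omega>" "K \<subseteq> \<Omega>"
  shows "\<exists>d>0. \<exists>L. compact L \<and> L \<subseteq> \<Omega> \<and> (\<forall>x\<in>K. \<forall>y. norm (y - x) \<le> d \<longrightarrow> y \<in> L)"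
proof -
  obtain d where d: "d > 0" "(\<Union>x\<in>K. cball x d) \<subseteq> \<Omega>"
    using compact_subset_open_imp_cball_epsilon_subset[OF assms] by blast
  have "compact {x + y | x y. x \<in> K \<and> y \<in> cball 0 d}"
    using assms(1) by (intro compact_sums) auto
  moreover have "{x + y | x y. x \<in> K \<and> y \<in> cball 0 d} = (\<Union>x\<in>K. cball x d)"
  proof (intro equalityI subsetI)
    fix z assume "z \<in> (\<Union>x\<in>K. cball x d)"
    then obtain x where "x \<in> K" "dist x z \<le> d" by auto
    then show "z \<in> {x + y | x y. x \<in> K \<and> y \<in> cball 0 d}"
      by (intro CollectI exI[of _ x] exI[of _ "z - x"]) (auto simp: dist_norm norm_minus_commute)
  next
    fix z assume "z \<in> {x + y | x y. x \<in> K \<and> y \<in> cball 0 d}"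
    then obtain x y where "z = x + y" "x \<in> K" "norm y \<le> d" by auto
    then show "z \<in> (\<Union>x\<in>K. cball x d)" by (auto simp: dist_norm intro!: bexI[of _ x])
  qed
  moreover have "y \<in> (\<Union>x\<in>K. cball x d)" if "x \<in> K" "norm (y - x) \<le> d" for x y
  proof -
    have "y \<in> cball x d" using that(2) by (simp add: dist_norm norm_minus_commute)
    then show ?thesis using that(1) by blast
  qed
  ultimately show ?thesis
    using d by (intro exI[of _ d] conjI exI[of _ "\<Union>x\<in>K. cball x d"]) simp_all
qed

lemma eventually_fact_ge: "\<forall>\<^sub>F n in sequentially. R \<le> (fact n :: real)"
proof -
  have "\<forall>\<^sub>F n in sequentially. R \<le> real n"
    using filterlim_real_sequentially unfolding filterlim_at_top by blast
  moreover have "real n \<le> fact n" for n by (metis fact_ge_self of_nat_fact of_nat_le_iff)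
  ultimately show ?thesis by (elim eventually_mono) (use order_trans in blast)
qed

lemma eventually_inverse_le: "d > 0 \<Longrightarrow> \<forall>\<^sub>F n in sequentially. c / real n \<le> d"
  using order_tendstoD(2)[OF lim_const_over_n[of c], of d] by (auto elim: eventually_mono)

lemma smooth_Lipschitz_bound:
  fixes \<phi> :: "real ^ 'k::finite \<Rightarrow> real"
  assumes "\<phi> \<in> test_functions A"
  shows "\<exists>C\<ge>0. \<forall>x y. \<bar>partials is \<phi> x - partials is \<phi> y\<bar> \<le> C * norm (x - y)"
proof -
  have "\<forall>i. \<exists>B. \<forall>x. \<bar>partials (i # is) \<phi> x\<bar> \<le> B"
    using test_function_partial_bounded[OF assms] by blast
  from choice[OF this] obtain B where B: "\<And>i x. \<bar>partials (i # is) \<phi> x\<bar> \<le> B i" by blast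
  have "\<bar>partial i (partials is \<phi>) x\<bar> \<le> (\<Sum>i\<in>UNIV. \<bar>B i\<bar>)" for i x
  proof -
    have "\<bar>partial i (partials is \<phi>) x\<bar> \<le> \<bar>B i\<bar>" using B[of i x] by simp
    also have "\<dots> \<le> (\<Sum>i\<in>UNIV. \<bar>B i\<bar>)" by (rule member_le_sum) auto
    finally show ?thesis .
  qed
  from smooth_Lipschitz[OF smooth_partials[OF test_function_smooth[OF assms]] this]
  show ?thesis
    by (intro exI[of _ "(\<Sum>i\<in>UNIV. \<bar>B i\<bar>) * CARD('k)"]) (auto intro!: mult_nonneg_nonneg sum_nonneg)
qed

text \<open>The representative of \<phi> as a grid function; grid functions being extended by zero,
  the values of \<phi> off the grid have to be removed.\<close>

definition restrict_grid :: "(real ^ 'k::finite) set \<Rightarrow> nat \<Rightarrow> (real ^ 'k \<Rightarrow> real) \<Rightarrow> real ^ 'k \<Rightarrow> real" where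
  "restrict_grid \<Omega> n \<phi> x = (if x \<in> \<Omega> \<inter> std_grid n then \<phi> x else 0)"

text \<open>The support of \<phi> lies in a box inside the grid, so on the lattice the cut-off
  removes nothing; off the lattice all values used by the differences are 0.\<close>

lemma restrict_grid_diffs:
  assumes "\<phi> \<in> test_functions K" "K \<subseteq> \<Omega>" "\<forall>x\<in>K. \<forall>i. \<bar>x $ i\<bar> \<le> R" "R \<le> fact n"
  shows "diffs n is (restrict_grid \<Omega> n \<phi>) x = (if x \<in> step_lattice n then diffs n is \<phi> x else 0)"
proof -
  have supp: "y \<in> K" if "\<phi> y \<noteq> 0" for y
    using assms(1) that closure_subset[of "{x. \<phi> x \<noteq> 0}"] by (auto simp: test_functions_def)
  have grid: "y \<in> std_grid n" if "\<phi> y \<noteq> 0" "y \<in> step_lattice n" for y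
    using that supp[OF that(1)] assms(3,4) unfolding std_grid_iff using order_trans by blast
  show ?thesis
  proof (induction "is" arbitrary: x)
    case Nil
    show ?case
      using supp[of x] grid[of x] assms(2) by (auto simp: restrict_grid_def std_grid_iff)
  next
    case (Cons i "is")
    then show ?case by (simp add: std_diff_def[of n i] lattice_shift)
  qed
qed

lemma restrict_grid_supported: "\<phi> \<in> test_functions K \<Longrightarrow> supported_on K n (restrict_grid \<Omega> n \<phi>)"
  using closure_subset[of "{x. \<phi> x \<noteq> 0}"] by (auto simp: supported_on_def restrict_grid_def test_functions_def)

lemma restrict_grid_diffs_bound:
  assumes "\<phi> \<in> test_functions K" "K \<subseteq> \<Omega>" "\<forall>x\<in>K. \<forall>i. \<bar>x $ i\<bar> \<le> R" "R \<le> fact n"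
    and "\<And>x. \<bar>partials (rev is) \<phi> x\<bar> \<le> B"
  shows "\<bar>diffs n is (restrict_grid \<Omega> n \<phi>) x\<bar> \<le> B"
proof -
  obtain \<xi> where "diffs n is \<phi> x = partials (rev is) \<phi> \<xi>"
    using std_diffs_MVT[OF test_function_smooth[OF assms(1)]] by blast
  then show ?thesis
    unfolding restrict_grid_diffs[OF assms(1-4)] using assms(5)[of \<xi>] by auto
qed

lemma test_function_diffs_approx:
  fixes \<phi> :: "real ^ 'k::finite \<Rightarrow> real"
  assumes "\<phi> \<in> test_functions A"
  shows "\<exists>C\<ge>0. \<forall>n x. \<bar>diffs n is \<phi> x - partials (rev is) \<phi> x\<bar> \<le> C * step n"
proof -
  obtain C where C: "C \<ge> 0" "\<And>x y. \<bar>partials (rev is) \<phi> x - partials (rev is) \<phi> y\<bar> \<le> C * norm (x - y)"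
    using smooth_Lipschitz_bound[OF assms] by blast
  have "\<bar>diffs n is \<phi> x - partials (rev is) \<phi> x\<bar> \<le> C * length is * step n" for n x
  proof -
    obtain \<xi> where \<xi>: "diffs n is \<phi> x = partials (rev is) \<phi> \<xi>" "norm (\<xi> - x) \<le> length is * step n"
      using std_diffs_MVT[OF test_function_smooth[OF assms]] by blast
    have "\<bar>partials (rev is) \<phi> \<xi> - partials (rev is) \<phi> x\<bar> \<le> C * (length is * step n)"
      using C(2)[of \<xi> x] mult_left_mono[OF \<xi>(2) C(1)] by linarith
    then show ?thesis by (simp add: \<xi>(1) mult.assoc)
  qed
  then show ?thesis using C(1) by (intro exI[of _ "C * length is"]) auto
qed

section \<open>The grid function that represents a distribution\<close>

context smooth_step
begin

text \<open>Near the boundary of \<Omega> a bump need not be supported in \<Omega>, and T has no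
  meaningful value on it; the value 0 is put there. The division by the volume of a cell compensates
  the factor in \<open>std_inner\<close>.\<close>

definition represent :: "(real ^ 'k::finite) set \<Rightarrow> ((real ^ 'k \<Rightarrow> real) \<Rightarrow> real) \<Rightarrow> nat \<Rightarrow> real ^ 'k \<Rightarrow> real" where
  "represent \<Omega> T n x =
    (if x \<in> \<Omega> \<inter> std_grid n \<and> (\<lambda>y. kernel n (y - x)) \<in> test_functions \<Omega>
     then T (\<lambda>y. kernel n (y - x)) / step n ^ CARD('k) else 0)"

text \<open>Around points of K all bumps are test functions, so T can be moved through the finite
  sum that defines \<open>smear\<close>. Only the points where g is nonzero enter, which keeps away
  from those where \<open>represent\<close> was set to 0.\<close>

lemma represent_inner:
  fixes \<Omega> :: "(real ^ 'k::finite) set"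
  assumes T: "T \<in> distributions \<Omega>" and n: "n \<ge> 1" and g: "supported_on K n g" and "K \<subseteq> \<Omega>"
    and L: "compact L" "L \<subseteq> \<Omega>" "\<forall>x\<in>K. \<forall>y. norm (y - x) \<le> CARD('k) / n \<longrightarrow> y \<in> L"
  shows "smear n g \<in> test_functions L" "std_inner n (represent \<Omega> T n) g = T (smear n g)"
proof -
  show "smear n g \<in> test_functions L"
  proof (rule test_functionI[OF smear_smooth L(1) order_refl])
    fix y assume "smear n g y \<noteq> 0"
    then obtain x where "g x \<noteq> 0" "norm (y - x) \<le> CARD('k) / n"
      using smear_support[OF n] by blast
    then show "y \<in> L" using g L(3) by (auto simp: supported_on_def)
  qed
  define S where "S = {x \<in> std_grid n. g x \<noteq> 0}"
  have fin: "finite S" by (simp add: S_def finite_std_grid)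
  have ker: "(\<lambda>y. kernel n (y - x)) \<in> test_functions \<Omega>" if "x \<in> S" for x
  proof (rule test_functionI[OF kernel_shift_smooth L(1,2)])
    fix y assume "kernel n (y - x) \<noteq> 0"
    then have "norm (y - x) \<le> CARD('k) / n" by (rule kernel_support[OF n])
    then show "y \<in> L" using g L(3) that by (auto simp: supported_on_def S_def)
  qed
  have "std_inner n (represent \<Omega> T n) g = (\<Sum>x\<in>std_grid n. step n ^ CARD('k) * (represent \<Omega> T n x * g x))"
    by (simp add: std_inner_def sum_distrib_left)
  also have "\<dots> = (\<Sum>x\<in>S. step n ^ CARD('k) * (represent \<Omega> T n x * g x))"
    by (rule sum.mono_neutral_right) (auto simp: S_def finite_std_grid)
  also have "\<dots> = (\<Sum>x\<in>S. g x * T (\<lambda>y. kernel n (y - x)))"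
  proof (rule sum.cong[OF refl])
    fix x assume "x \<in> S"
    then have "x \<in> \<Omega> \<inter> std_grid n" using g \<open>K \<subseteq> \<Omega>\<close> by (auto simp: S_def supported_on_def)
    then show "step n ^ CARD('k) * (represent \<Omega> T n x * g x) = g x * T (\<lambda>y. kernel n (y - x))"
      using ker[OF \<open>x \<in> S\<close>] by (simp add: represent_def)
  qed
  also have "\<dots> = T (\<lambda>y. \<Sum>x\<in>S. g x * kernel n (y - x))"
    using distribution_sum[OF T fin ker, of "\<lambda>x. x" g] by simp
  also have "(\<lambda>y. \<Sum>x\<in>S. g x * kernel n (y - x)) = smear n g"
    unfolding smear_def S_def by (intro ext sum.mono_neutral_left) (auto simp: finite_std_grid)
  finally show "std_inner n (represent \<Omega> T n) g = T (smear n g)" .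
qed

text \<open>T is estimated by the derivatives of order at most m of the smeared function. These are
  averages of differences of g, at most G, up to an error \<open>G * e n\<close>, at most G for
  large n; hence the factor 2. The threshold for n is uniform in g because g will vary with
  n.\<close>

lemma represent_bounded:
  fixes \<Omega> :: "(real ^ 'k::finite) set"
  assumes T: "T \<in> distributions \<Omega>" and "open \<Omega>" and K: "compact K" "K \<subseteq> \<Omega>"
  shows "\<exists>m C. \<forall>\<^sub>F n in sequentially. \<forall>g. \<forall>G>0. supported_on K n g \<longrightarrow>
    (\<forall>is x. length is \<le> m \<longrightarrow> \<bar>diffs n is g x\<bar> \<le> G) \<longrightarrow>
    \<bar>std_inner n (represent \<Omega> T n) g\<bar> \<le> C * G"
proof -
  obtain d L where d: "d > 0" and L: "compact L" "L \<subseteq> \<Omega>"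
    and KL: "\<And>x y. x \<in> K \<Longrightarrow> norm (y - x) \<le> d \<Longrightarrow> y \<in> L"
    using compact_nbhd[OF K(1) \<open>open \<Omega>\<close> K(2)] by blast
  obtain R where R: "R \<ge> 0" "\<forall>x\<in>K. \<forall>i. \<bar>x $ i\<bar> \<le> R"
    using compact_box[OF K(1)] by blast
  obtain R' where R': "R' \<ge> 0" "\<forall>x\<in>L. \<forall>i. \<bar>x $ i\<bar> \<le> R'"
    using compact_box[OF L(1)] by blast
  obtain m C where C: "C > 0" "\<And>\<psi> s. \<psi> \<in> test_functions L \<Longrightarrow> s > 0 \<Longrightarrow>
      (\<forall>is x. length is \<le> m \<longrightarrow> \<bar>partials is \<psi> x\<bar> \<le> s) \<Longrightarrow> \<bar>T \<psi>\<bar> \<le> C * s"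
    using distribution_bound[OF T L] by blast
  \<comment> \<open>Orders up to m involve finitely many lists, so one threshold for n serves them
    all.\<close>
  define J where "J = {is :: 'k list. length is \<le> m}"
  have J: "finite J" using finite_lists_length_le[of "UNIV :: 'k set" m] by (simp add: J_def)
  have "\<forall>is. \<exists>e. e \<longlonglongrightarrow> 0 \<and> (\<forall>n (g :: real ^ 'k \<Rightarrow> real) G y.
    in_box n R g \<longrightarrow> R + length is \<le> fact n \<longrightarrow> (\<forall>x. \<bar>g x\<bar> \<le> G) \<longrightarrow>
    \<bar>partials (rev is) (smear n g) y - smear n (diffs n is g) y\<bar> \<le> G * e n)"
    for "is" :: "'k list"
    using smear_partials_approx[OF R(1)] by blast
  then have "\<forall>is. \<exists>e. e \<longlonglongrightarrow> 0 \<and> (\<forall>n (g :: real ^ 'k \<Rightarrow> real) G y.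
    in_box n R g \<longrightarrow> R + length is \<le> fact n \<longrightarrow> (\<forall>x. \<bar>g x\<bar> \<le> G) \<longrightarrow>
    \<bar>partials (rev is) (smear n g) y - smear n (diffs n is g) y\<bar> \<le> G * e n)" by blast
  from choice[OF this] obtain e where e: "\<And>is. e is \<longlonglongrightarrow> 0"
    "\<And>is n (g :: real ^ 'k \<Rightarrow> real) G y. in_box n R g \<Longrightarrow> R + length is \<le> fact n \<Longrightarrow> (\<forall>x. \<bar>g x\<bar> \<le> G) \<Longrightarrow>
    \<bar>partials (rev is) (smear n g) y - smear n (diffs n is g) y\<bar> \<le> G * e is n" by blast
  have "\<forall>\<^sub>F n in sequentially. \<forall>is\<in>J. e is n < 1"
    using J e(1) by (intro eventually_ball_finite ballI order_tendstoD(2)) auto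
  moreover have "\<forall>\<^sub>F n in sequentially. CARD('k) / real n \<le> d"
    using eventually_inverse_le[OF d] .
  ultimately have "\<forall>\<^sub>F n in sequentially. \<forall>g. \<forall>G>0. supported_on K n g \<longrightarrow>
    (\<forall>is x. length is \<le> m \<longrightarrow> \<bar>diffs n is g x\<bar> \<le> G) \<longrightarrow>
    \<bar>std_inner n (represent \<Omega> T n) g\<bar> \<le> (2 * C) * G"
    using eventually_ge_at_top[of "1::nat"] eventually_fact_ge[of "R + m"] eventually_fact_ge[of "R' + 1"]
  proof eventually_elim
    case (elim n)
    show ?case
    proof (intro allI impI)
      fix g :: "real ^ 'k \<Rightarrow> real" and G :: real
      assume G: "G > 0" and g: "supported_on K n g"
        and le: "\<forall>is x. length is \<le> m \<longrightarrow> \<bar>diffs n is g x\<bar> \<le> G"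
      have KL': "\<forall>x\<in>K. \<forall>y. norm (y - x) \<le> CARD('k) / n \<longrightarrow> y \<in> L"
        using KL elim by (meson order_trans)
      have box: "in_box n R g" using supported_on_in_box[OF g R(2)] .
      have g_le: "\<forall>x. \<bar>g x\<bar> \<le> G" using le[rule_format, of "[]"] by simp
      note inner = represent_inner[OF T _ g K(2) L KL']
      have "\<bar>partials is (smear n g) y\<bar> \<le> 2 * G" if "is": "length is \<le> m" for "is" y
      proof (cases "y \<in> L")
        case True
        have y: "\<bar>y $ i\<bar> \<le> fact n - 1" for i
        proof -
          have "\<bar>y $ i\<bar> \<le> R'" using R'(2) True by blast
          then show ?thesis using elim by linarith
        qed
        have "\<bar>smear n (diffs n (rev is) g) y - 0\<bar> \<le> G"
          using elim le "is" by (intro smear_close y) auto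
        moreover have "\<bar>partials (rev (rev is)) (smear n g) y - smear n (diffs n (rev is) g) y\<bar> \<le> G * e (rev is) n"
          using elim "is" by (intro e(2) box g_le) auto
        moreover have "G * e (rev is) n \<le> G * 1"
          using G elim "is" by (intro mult_left_mono) (auto simp: J_def intro: less_imp_le)
        ultimately show ?thesis by simp
      next
        case False
        have "y \<notin> closure {x. smear n g x \<noteq> 0}"
          using inner(1) elim False by (auto simp: test_functions_def)
        from partials_support[OF this] show ?thesis using G by simp
      qed
      then have "\<bar>T (smear n g)\<bar> \<le> C * (2 * G)"
        using G elim inner(1) by (intro C(2)) auto
      then show "\<bar>std_inner n (represent \<Omega> T n) g\<bar> \<le> 2 * C * G"
        using inner(2) elim by simp
    qed
  qed
  then show ?thesis by blast
qed

text \<open>The smeared restriction of \<phi> converges to \<phi> uniformly with each derivative and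
  stays supported in L, where T satisfies an estimate of finite order.\<close>

lemma represent_tendsto:
  fixes \<Omega> :: "(real ^ 'k::finite) set"
  assumes T: "T \<in> distributions \<Omega>" and "open \<Omega>" and \<phi>\<Omega>: "\<phi> \<in> test_functions \<Omega>"
  shows "(\<lambda>n. std_inner n (represent \<Omega> T n) (restrict_grid \<Omega> n \<phi>)) \<longlonglongrightarrow> T \<phi>"
proof -
  obtain K where K: "compact K" "K \<subseteq> \<Omega>" "\<phi> \<in> test_functions K"
    using test_function_support[OF \<phi>\<Omega>] by blast
  obtain d L where d: "d > 0" and L: "compact L" "L \<subseteq> \<Omega>"
    and KL: "\<And>x y. x \<in> K \<Longrightarrow> norm (y - x) \<le> d \<Longrightarrow> y \<in> L"
    using compact_nbhd[OF K(1) \<open>open \<Omega>\<close> K(2)] by blast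
  have "K \<subseteq> L" using KL d by auto
  obtain R where R: "R \<ge> 0" "\<forall>x\<in>K. \<forall>i. \<bar>x $ i\<bar> \<le> R"
    using compact_box[OF K(1)] by blast
  obtain R' where R': "R' \<ge> 0" "\<forall>x\<in>L. \<forall>i. \<bar>x $ i\<bar> \<le> R'"
    using compact_box[OF L(1)] by blast
  obtain m C where C: "C > 0" "\<And>\<psi> s. \<psi> \<in> test_functions L \<Longrightarrow> s > 0 \<Longrightarrow>
      (\<forall>is x. length is \<le> m \<longrightarrow> \<bar>partials is \<psi> x\<bar> \<le> s) \<Longrightarrow> \<bar>T \<psi>\<bar> \<le> C * s"
    using distribution_bound[OF T L] by blast
  define J where "J = {is :: 'k list. length is \<le> m}"
  have J: "finite J" using finite_lists_length_le[of "UNIV :: 'k set" m] by (simp add: J_def)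
  let ?g = "\<lambda>n. restrict_grid \<Omega> n \<phi>"
  have g: "supported_on K n (?g n)" for n using restrict_grid_supported[OF K(3)] .
  have box: "in_box n R (?g n)" for n using supported_on_in_box[OF g R(2)] .
  have \<phi>L: "\<phi> \<in> test_functions L" using K(3) test_functions_mono[OF \<open>K \<subseteq> L\<close>] by blast
  obtain B where "\<And>x. \<bar>partials [] \<phi> x\<bar> \<le> B"
    using test_function_partial_bounded[OF K(3)] by blast
  then have g_le: "\<bar>?g n x\<bar> \<le> \<bar>B\<bar>" for n x
    using order_trans[OF _ abs_ge_self] by (auto simp: restrict_grid_def)
  have close: "\<forall>\<^sub>F n in sequentially. \<forall>y. \<bar>partials (rev is) (smear n (?g n)) y - partials (rev is) \<phi> y\<bar> \<le> s"
    if s: "s > 0" for "is" s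
  proof -
    obtain e where e: "e \<longlonglongrightarrow> 0" "\<And>n (g :: real ^ 'k \<Rightarrow> real) G y.
      in_box n R g \<Longrightarrow> R + length is \<le> fact n \<Longrightarrow> (\<forall>x. \<bar>g x\<bar> \<le> G) \<Longrightarrow>
      \<bar>partials (rev is) (smear n g) y - smear n (diffs n is g) y\<bar> \<le> G * e n"
      using smear_partials_approx[OF R(1), of "is"] by blast
    obtain C1 where C1: "C1 \<ge> 0" "\<And>n x. \<bar>diffs n is \<phi> x - partials (rev is) \<phi> x\<bar> \<le> C1 * step n"
      using test_function_diffs_approx[OF K(3)] by blast
    obtain C2 where C2: "C2 \<ge> 0"
      "\<And>x y. \<bar>partials (rev is) \<phi> x - partials (rev is) \<phi> y\<bar> \<le> C2 * norm (x - y)"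
      using smooth_Lipschitz_bound[OF K(3)] by blast
    \<comment> \<open>The three errors: from derivatives of the smeared function to averages of
      differences, from differences to derivatives of \<phi>, and from those at y to those at points
      within CARD('k)/n of y.\<close>
    have "(\<lambda>n. \<bar>B\<bar> * e n + (C1 * step n + C2 * (CARD('k) / real n))) \<longlonglongrightarrow> \<bar>B\<bar> * 0 + (C1 * 0 + C2 * 0)"
      by (intro tendsto_intros e step_LIMSEQ lim_const_over_n)
    then have "\<forall>\<^sub>F n in sequentially. \<bar>B\<bar> * e n + (C1 * step n + C2 * (CARD('k) / real n)) < s"
      using s by (intro order_tendstoD(2)) auto
    then show ?thesis
      using eventually_inverse_le[OF d, of "CARD('k)"] eventually_ge_at_top[of "1::nat"]
        eventually_fact_ge[of "R + length is"] eventually_fact_ge[of "R' + 1"]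
    proof eventually_elim
      case (elim n)
      have KL': "\<forall>x\<in>K. \<forall>y. norm (y - x) \<le> CARD('k) / n \<longrightarrow> y \<in> L"
        using KL elim by (meson order_trans)
      note inner = represent_inner[OF T _ g K(2) L KL']
      show ?case
      proof
        fix y
        show "\<bar>partials (rev is) (smear n (?g n)) y - partials (rev is) \<phi> y\<bar> \<le> s"
        proof (cases "y \<in> L")
          case True
          have y: "\<bar>y $ i\<bar> \<le> fact n - 1" for i
          proof -
          have "\<bar>y $ i\<bar> \<le> R'" using R'(2) True by blast
          then show ?thesis using elim by linarith
        qed
          have "\<bar>smear n (diffs n is (?g n)) y - partials (rev is) \<phi> y\<bar> \<le>
              C1 * step n + C2 * (CARD('k) / real n)"
          proof (rule smear_close)
            fix x :: "real ^ 'k" assume x: "x \<in> std_grid n" "norm (y - x) \<le> CARD('k) / real n"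
            have "diffs n is (?g n) x = diffs n is \<phi> x"
              using x(1) elim by (subst restrict_grid_diffs[OF K(3,2) R(2)]) (auto simp: std_grid_iff)
            moreover have "\<bar>partials (rev is) \<phi> x - partials (rev is) \<phi> y\<bar> \<le> C2 * (CARD('k) / real n)"
              using C2(2)[of x y] mult_left_mono[OF x(2) C2(1)] by (simp add: norm_minus_commute)
            ultimately show "\<bar>diffs n is (?g n) x - partials (rev is) \<phi> y\<bar> \<le>
                C1 * step n + C2 * (CARD('k) / real n)"
              using C1(2)[of n x] by linarith
          qed (use elim y in auto)
          moreover have "\<bar>partials (rev is) (smear n (?g n)) y - smear n (diffs n is (?g n)) y\<bar> \<le> \<bar>B\<bar> * e n"
            using elim g_le by (intro e(2) box) auto
          ultimately show ?thesis using elim by linarith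
        next
          case False
          have 1: "y \<notin> closure {x. smear n (?g n) x \<noteq> 0}"
            using inner(1) elim False by (auto simp: test_functions_def)
          have 2: "y \<notin> closure {x. \<phi> x \<noteq> 0}"
            using \<phi>L False by (auto simp: test_functions_def)
          show ?thesis using partials_support[OF 1] partials_support[OF 2] s by simp
        qed
      qed
    qed
  qed
  have "\<forall>\<^sub>F n in sequentially. \<bar>std_inner n (represent \<Omega> T n) (?g n) - T \<phi>\<bar> < r" if r: "r > 0" for r
  proof -
    define s where "s = r / (2 * C)"
    have s: "s > 0" "C * s < r" using r C(1) by (auto simp: s_def)
    have "\<forall>\<^sub>F n in sequentially. \<forall>is\<in>J. \<forall>y. \<bar>partials (rev is) (smear n (?g n)) y - partials (rev is) \<phi> y\<bar> \<le> s"
      using J close[OF s(1)] by (intro eventually_ball_finite) auto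
    then show ?thesis
      using eventually_inverse_le[OF d, of "CARD('k)"] eventually_ge_at_top[of "1::nat"]
    proof eventually_elim
      case (elim n)
      have KL': "\<forall>x\<in>K. \<forall>y. norm (y - x) \<le> CARD('k) / n \<longrightarrow> y \<in> L"
        using KL elim by (meson order_trans)
      note inner = represent_inner[OF T _ g K(2) L KL']
      let ?\<psi> = "smear n (?g n)"
      have \<psi>: "?\<psi> \<in> test_functions L" using inner(1) elim by simp
      have \<psi>\<Omega>: "?\<psi> \<in> test_functions \<Omega>" using \<psi> test_functions_mono[OF L(2)] by blast
      have "\<bar>T (\<lambda>x. 1 * ?\<psi> x + (- 1) * \<phi> x)\<bar> \<le> C * s"
      proof (rule C(2)[OF test_functions_linear[OF \<psi> \<phi>L] s(1)], intro allI impI)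
        fix "is" :: "'k list" and x assume "length is \<le> m"
        then have "rev is \<in> J" by (simp add: J_def)
        then show "\<bar>partials is (\<lambda>x. 1 * ?\<psi> x + (- 1) * \<phi> x) x\<bar> \<le> s"
          using elim(1) by (subst smooth_linear(2)) (force intro: test_function_smooth[OF \<psi>] test_function_smooth[OF \<phi>L])+
      qed
      moreover have "T (\<lambda>x. 1 * ?\<psi> x + (- 1) * \<phi> x) = T ?\<psi> - T \<phi>"
        using distribution_add[OF T test_functions_scale[OF \<psi>\<Omega>, of 1] test_functions_scale[OF \<phi>\<Omega>, of "-1"]]
          distribution_scale[OF T \<psi>\<Omega>, of 1] distribution_scale[OF T \<phi>\<Omega>, of "-1"] by simp
      ultimately show ?case
        using inner(2) elim s(2) by simp
    qed
  qed
  then show ?thesis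
    by (simp add: tendsto_iff dist_real_def)
qed

end

section \<open>Grid test functions and grid distributions along an ultrafilter\<close>

lemma eventually_choice:
  assumes "\<forall>\<^sub>F i in U. \<exists>x. P i x"
  shows "\<exists>X. \<forall>\<^sub>F i in U. P i (X i)"
proof -
  have "\<forall>\<^sub>F i in U. P i (SOME x. P i x)"
    using assms by eventually_elim (rule someI_ex)
  then show ?thesis by (rule exI[of _ "\<lambda>i. SOME x. P i x"])
qed

locale grid_filter =
  fixes U :: "'i filter" and n :: "'i \<Rightarrow> nat"
  assumes U: "ultra U" and n: "filterlim n at_top U"
begin

lemma nontrivial: "U \<noteq> bot"
  using U by (simp add: ultra_def)

lemma eventually_n: "eventually P sequentially \<Longrightarrow> \<forall>\<^sub>F i in U. P (n i)"
  by (rule eventually_compose_filterlim[OF _ n])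

lemma step_tendsto: "((\<lambda>i. step (n i)) \<longlongrightarrow> 0) U"
  by (rule filterlim_compose[OF step_LIMSEQ n])

lemma eventually_step_less: "d > 0 \<Longrightarrow> \<forall>\<^sub>F i in U. c * step (n i) < d"
  using order_tendstoD(2)[OF tendsto_mult_right_zero[OF step_tendsto, of c]] by blast

text \<open>Grid test functions seen along the ultrafilter, with S-continuity replaced by bounds for
  the differences of all orders: bounded differences of the next order imply S-continuity, and the
  converse is \<open>grid_test_gtest\<close>.\<close>

definition gtest :: "(real ^ 'k::finite) set \<Rightarrow> ('i \<Rightarrow> real ^ 'k \<Rightarrow> real) \<Rightarrow> bool" where
  "gtest \<Omega> g \<longleftrightarrow> (\<exists>K. compact K \<and> K \<subseteq> \<Omega> \<and> (\<forall>\<^sub>F i in U. supported_on K (n i) (g i))) \<and>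
     (\<forall>is. \<exists>C. \<forall>\<^sub>F i in U. \<forall>x. \<bar>diffs (n i) is (g i) x\<bar> \<le> C)"

definition gdist :: "(real ^ 'k::finite) set \<Rightarrow> ('i \<Rightarrow> real ^ 'k \<Rightarrow> real) \<Rightarrow> bool" where
  "gdist \<Omega> f \<longleftrightarrow> (\<forall>g. gtest \<Omega> g \<longrightarrow> (\<exists>C. \<forall>\<^sub>F i in U. \<bar>std_inner (n i) (f i) (g i)\<bar> \<le> C))"

lemma gtest_Lipschitz:
  fixes g :: "'i \<Rightarrow> real ^ 'k::finite \<Rightarrow> real"
  assumes "\<And>is. \<exists>C. \<forall>\<^sub>F i in U. \<forall>x. \<bar>diffs (n i) is (g i) x\<bar> \<le> C"
  shows "\<exists>C\<ge>0. \<forall>\<^sub>F i in U. \<forall>x\<in>step_lattice (n i). \<forall>y\<in>step_lattice (n i).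
    \<bar>diffs (n i) is (g i) x - diffs (n i) is (g i) y\<bar> \<le> C * norm (x - y)"
proof -
  have "\<forall>k. \<exists>C. \<forall>\<^sub>F i in U. \<forall>x. \<bar>diffs (n i) (k # is) (g i) x\<bar> \<le> C"
    using assms by blast
  from choice[OF this] obtain B where
    B: "\<And>k. \<forall>\<^sub>F i in U. \<forall>x. \<bar>diffs (n i) (k # is) (g i) x\<bar> \<le> B k" by blast
  let ?C = "\<Sum>k\<in>UNIV. \<bar>B k\<bar>"
  have "\<forall>\<^sub>F i in U. \<forall>k. \<forall>x. \<bar>diffs (n i) (k # is) (g i) x\<bar> \<le> B k"
    using B by (rule eventually_all_finite)
  then have "\<forall>\<^sub>F i in U. \<forall>x\<in>step_lattice (n i). \<forall>y\<in>step_lattice (n i).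
    \<bar>diffs (n i) is (g i) x - diffs (n i) is (g i) y\<bar> \<le> ?C * CARD('k) * norm (x - y)"
  proof eventually_elim
    case (elim i)
    have le: "\<bar>std_diff (n i) k (diffs (n i) is (g i)) x\<bar> \<le> ?C" for x k
    proof -
      have "\<bar>std_diff (n i) k (diffs (n i) is (g i)) x\<bar> \<le> \<bar>B k\<bar>"
        using elim[rule_format, of k x] by simp
      also have "\<dots> \<le> ?C" by (rule member_le_sum) auto
      finally show ?thesis .
    qed
    show ?case using lattice_Lipschitz[OF le] by blast
  qed
  then show ?thesis
    by (intro exI[of _ "?C * CARD('k)"] conjI) (auto intro!: mult_nonneg_nonneg sum_nonneg)
qed

lemma grid_round_tendsto: "((\<lambda>i. grid_round (n i) y) \<longlongrightarrow> y) U" for y :: "real ^ 'k::finite"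
proof (rule Lim_null[THEN iffD2], rule tendsto_norm_zero_cancel)
  show "((\<lambda>i. norm (grid_round (n i) y - y)) \<longlongrightarrow> 0) U"
    by (rule tendsto_sandwich[OF _ _ tendsto_const tendsto_mult_right_zero[OF step_tendsto, of "CARD('k)"]])
      (auto simp: grid_round_norm)
qed

lemma tendsto_bounded_diff:
  fixes a b :: "'i \<Rightarrow> real"
  assumes "(a \<longlongrightarrow> l) U" "\<forall>\<^sub>F i in U. \<bar>b i - a i\<bar> \<le> c i" "(c \<longlongrightarrow> 0) U"
  shows "(b \<longlongrightarrow> l) U"
proof -
  have "((\<lambda>i. \<bar>b i - a i\<bar>) \<longlongrightarrow> 0) U"
    by (rule tendsto_sandwich[OF _ assms(2) tendsto_const assms(3)]) auto
  then have "((\<lambda>i. b i - a i) \<longlongrightarrow> 0) U" by (simp add: tendsto_rabs_zero_iff)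
  from tendsto_add[OF this assms(1)] show ?thesis by simp
qed

section \<open>The standard part of a grid test function and its derivatives\<close>

definition shadow :: "('i \<Rightarrow> real ^ 'k::finite \<Rightarrow> real) \<Rightarrow> 'k list \<Rightarrow> real ^ 'k \<Rightarrow> real" where
  "shadow g is y = (SOME l. ((\<lambda>i. diffs (n i) is (g i) (grid_round (n i) y)) \<longlongrightarrow> l) U)"

context
  fixes \<Omega> :: "(real ^ 'k::finite) set" and g :: "'i \<Rightarrow> real ^ 'k \<Rightarrow> real"
  assumes g: "gtest \<Omega> g"
begin

lemma shadow_tendsto:
  "((\<lambda>i. diffs (n i) is (g i) (grid_round (n i) y)) \<longlongrightarrow> shadow g is y) U"
proof -
  obtain C where "\<forall>\<^sub>F i in U. \<forall>x. \<bar>diffs (n i) is (g i) x\<bar> \<le> C"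
    using g unfolding gtest_def by blast
  then have "\<forall>\<^sub>F i in U. \<bar>diffs (n i) is (g i) (grid_round (n i) y)\<bar> \<le> C"
    by eventually_elim blast
  from ultra_bounded_convergent[OF U this] show ?thesis
    unfolding shadow_def by (rule someI_ex)
qed

lemma diffs_Lipschitz:
  "\<exists>C\<ge>0. \<forall>\<^sub>F i in U. \<forall>x\<in>step_lattice (n i). \<forall>y\<in>step_lattice (n i).
    \<bar>diffs (n i) is (g i) x - diffs (n i) is (g i) y\<bar> \<le> C * norm (x - y)"
  using g unfolding gtest_def by (intro gtest_Lipschitz) blast

text \<open>The uniform Lipschitz bound on the lattice makes the choice of the lattice points near y
  immaterial.\<close>

lemma diffs_tendsto_shadow:
  assumes X: "\<forall>\<^sub>F i in U. X i \<in> step_lattice (n i)" "(X \<longlongrightarrow> y) U"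
  shows "((\<lambda>i. diffs (n i) is (g i) (X i)) \<longlongrightarrow> shadow g is y) U"
proof -
  obtain C where C: "\<forall>\<^sub>F i in U. \<forall>x\<in>step_lattice (n i). \<forall>y\<in>step_lattice (n i).
    \<bar>diffs (n i) is (g i) x - diffs (n i) is (g i) y\<bar> \<le> C * norm (x - y)"
    using diffs_Lipschitz by blast
  show ?thesis
  proof (rule tendsto_bounded_diff[OF shadow_tendsto])
    show "\<forall>\<^sub>F i in U. \<bar>diffs (n i) is (g i) (X i) - diffs (n i) is (g i) (grid_round (n i) y)\<bar>
        \<le> C * norm (X i - grid_round (n i) y)"
      using C X(1) by eventually_elim (auto simp: grid_round_lattice)
    have "((\<lambda>i. C * norm (X i - grid_round (n i) y)) \<longlongrightarrow> C * norm (y - y)) U"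
      by (intro tendsto_intros X grid_round_tendsto)
    then show "((\<lambda>i. C * norm (X i - grid_round (n i) y)) \<longlongrightarrow> 0) U" by simp
  qed
qed

lemma shadow_Lipschitz: "\<exists>C\<ge>0. \<forall>x y. \<bar>shadow g is x - shadow g is y\<bar> \<le> C * norm (x - y)"
proof -
  obtain C where C: "C \<ge> 0" "\<forall>\<^sub>F i in U. \<forall>x\<in>step_lattice (n i). \<forall>y\<in>step_lattice (n i).
    \<bar>diffs (n i) is (g i) x - diffs (n i) is (g i) y\<bar> \<le> C * norm (x - y)"
    using diffs_Lipschitz by blast
  have "\<bar>shadow g is x - shadow g is y\<bar> \<le> C * norm (x - y)" for x y
  proof (rule tendsto_le[OF nontrivial])
    show "((\<lambda>i. C * norm (grid_round (n i) x - grid_round (n i) y)) \<longlongrightarrow> C * norm (x - y)) U"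
      by (intro tendsto_intros grid_round_tendsto)
    show "((\<lambda>i. \<bar>diffs (n i) is (g i) (grid_round (n i) x) -
        diffs (n i) is (g i) (grid_round (n i) y)\<bar>) \<longlongrightarrow> \<bar>shadow g is x - shadow g is y\<bar>) U"
      by (intro tendsto_intros shadow_tendsto)
    show "\<forall>\<^sub>F i in U. \<bar>diffs (n i) is (g i) (grid_round (n i) x) -
        diffs (n i) is (g i) (grid_round (n i) y)\<bar> \<le> C * norm (grid_round (n i) x - grid_round (n i) y)"
      using C(2) by eventually_elim (auto simp: grid_round_lattice)
  qed
  then show ?thesis using C(1) by blast
qed

text \<open>From the lattice point next to x one walks about t n! steps in direction k. On the way
  the difference quotient changes by at most C t, so telescoping gives a first-order expansion on
  the grid, and the limit along \<open>U\<close> gives it for the shadows. As the differences are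
  forward, t is taken nonnegative.\<close>

lemma shadow_expansion:
  "\<exists>C\<ge>0. \<forall>x. \<forall>t\<ge>0. \<bar>shadow g is (x + t *\<^sub>R axis k 1) - shadow g is x - t * shadow g (k # is) x\<bar> \<le> C * t * t"
proof -
  let ?D = "\<lambda>i. diffs (n i) is (g i)" and ?D' = "\<lambda>i. diffs (n i) (k # is) (g i)"
  obtain C where C: "C \<ge> 0" "\<forall>\<^sub>F i in U. \<forall>x\<in>step_lattice (n i). \<forall>y\<in>step_lattice (n i).
    \<bar>?D' i x - ?D' i y\<bar> \<le> C * norm (x - y)"
    using diffs_Lipschitz[of "k # is"] by blast
  have "\<bar>shadow g is (x + t *\<^sub>R axis k 1) - shadow g is x - t * shadow g (k # is) x\<bar> \<le> C * t * t"
    if t: "t \<ge> 0" for x t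
  proof -
    define m where "m i = nat \<lfloor>t * fact (n i)\<rfloor>" for i
    define s where "s i = real (m i) * step (n i)" for i
    have m: "real (m i) \<le> t * fact (n i)" "t * fact (n i) \<le> real (m i) + 1" for i
      using t by (auto simp: m_def of_nat_nat)
    have s: "s i \<le> t" "t - s i \<le> step (n i)" "s i \<ge> 0" for i
    proof -
      have t_eq: "t * fact (n i) * step (n i) = t" by (simp add: step_def)
      show "s i \<le> t"
        using mult_right_mono[OF m(1)[of i] step_nonneg[of "n i"]] by (simp add: s_def t_eq)
      show "t - s i \<le> step (n i)"
        using mult_right_mono[OF m(2)[of i] step_nonneg[of "n i"]] unfolding t_eq by (simp add: s_def distrib_right)
      show "s i \<ge> 0" by (simp add: s_def)
    qed
    have "((\<lambda>i. t - s i) \<longlongrightarrow> 0) U"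
      by (rule tendsto_sandwich[OF _ _ tendsto_const step_tendsto]) (auto simp: s)
    from tendsto_diff[OF tendsto_const this, of t] have s_lim: "(s \<longlongrightarrow> t) U" by simp
    let ?X = "\<lambda>i. grid_round (n i) x"
    have lat: "?X i + (real l * step (n i)) *\<^sub>R axis k 1 \<in> step_lattice (n i)" for i l
    proof (induction l)
      case (Suc l)
      then have "?X i + (real l * step (n i)) *\<^sub>R axis k 1 + step (n i) *\<^sub>R axis k 1 \<in> step_lattice (n i)"
        by (simp add: lattice_shift)
      then show ?case by (simp add: algebra_simps)
    qed (simp add: grid_round_lattice)
    have lim: "((\<lambda>i. ?D i (?X i + s i *\<^sub>R axis k 1)) \<longlongrightarrow> shadow g is (x + t *\<^sub>R axis k 1)) U"
      by (rule diffs_tendsto_shadow)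
        (auto simp: s_def lat intro!: tendsto_intros grid_round_tendsto s_lim[unfolded s_def])
    show ?thesis
    proof (rule tendsto_le[OF nontrivial])
      show "((\<lambda>i. s i * (C * t)) \<longlongrightarrow> C * t * t) U"
        using tendsto_mult_right[OF s_lim, of "C * t"] by (simp add: mult_ac)
      show "((\<lambda>i. \<bar>?D i (?X i + s i *\<^sub>R axis k 1) - ?D i (?X i) - s i * ?D' i (?X i)\<bar>) \<longlongrightarrow>
          \<bar>shadow g is (x + t *\<^sub>R axis k 1) - shadow g is x - t * shadow g (k # is) x\<bar>) U"
        by (intro tendsto_intros lim s_lim shadow_tendsto)
      show "\<forall>\<^sub>F i in U. \<bar>?D i (?X i + s i *\<^sub>R axis k 1) - ?D i (?X i) - s i * ?D' i (?X i)\<bar> \<le> s i * (C * t)"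
        using C(2)
      proof eventually_elim
        case (elim i)
        have "\<bar>std_diff (n i) k (?D i) (?X i + (real l * step (n i)) *\<^sub>R axis k 1) - ?D' i (?X i)\<bar> \<le> C * t"
          if l: "l < m i" for l
        proof -
          have "\<bar>?D' i (?X i + (real l * step (n i)) *\<^sub>R axis k 1) - ?D' i (?X i)\<bar> \<le> C * (real l * step (n i))"
            using elim[rule_format, OF lat[of i l] grid_round_lattice[of "n i" x]]
            by (simp add: norm_axis_1 abs_mult)
          also have "\<dots> \<le> C * s i"
            using l C(1) by (intro mult_left_mono) (auto simp: s_def intro!: mult_right_mono)
          also have "\<dots> \<le> C * t" using s C(1) by (intro mult_left_mono) auto
          finally show ?thesis by simp
        qed
        from std_diff_telescope[OF this] show ?case
          unfolding s_def by simp
      qed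
    qed
  qed
  then show ?thesis using C(1) by blast
qed

text \<open>For negative t the expansion is taken at the other end of the segment, and the Lipschitz
  bound B moves the derivative from there back to x.\<close>

lemma shadow_deriv: "((\<lambda>t. shadow g is (x + t *\<^sub>R axis k 1)) has_real_derivative shadow g (k # is) x) (at 0)"
proof -
  obtain C where C: "C \<ge> 0" "\<And>x t. t \<ge> 0 \<Longrightarrow>
    \<bar>shadow g is (x + t *\<^sub>R axis k 1) - shadow g is x - t * shadow g (k # is) x\<bar> \<le> C * t * t"
    using shadow_expansion by blast
  obtain B where B: "B \<ge> 0" "\<And>x y. \<bar>shadow g (k # is) x - shadow g (k # is) y\<bar> \<le> B * norm (x - y)"
    using shadow_Lipschitz by blast
  have le: "\<bar>shadow g is (x + t *\<^sub>R axis k 1) - shadow g is x - t * shadow g (k # is) x\<bar> \<le> (C + B) * t\<^sup>2" for t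
  proof (cases "t \<ge> 0")
    case True
    have "0 \<le> B * t\<^sup>2" using B(1) by simp
    then show ?thesis
      using C(2)[OF True, of x] by (simp add: power2_eq_square algebra_simps)
  next
    case False
    let ?y = "x + t *\<^sub>R axis k 1"
    have "\<bar>shadow g is x - shadow g is ?y - (- t) * shadow g (k # is) ?y\<bar> \<le> C * t\<^sup>2"
      using C(2)[of "- t" ?y] False by (simp add: power2_eq_square)
    moreover have "\<bar>t * (shadow g (k # is) ?y - shadow g (k # is) x)\<bar> \<le> B * t\<^sup>2"
    proof -
      have "\<bar>t * (shadow g (k # is) ?y - shadow g (k # is) x)\<bar> \<le> \<bar>t\<bar> * (B * \<bar>t\<bar>)"
        unfolding abs_mult using B(2)[of ?y x] by (intro mult_left_mono) (auto simp: norm_axis_1)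
      also have "\<dots> = B * t\<^sup>2" by (simp add: power2_eq_square mult_ac)
      finally show ?thesis .
    qed
    ultimately show ?thesis by (simp add: algebra_simps abs_le_iff)
  qed
  have "((\<lambda>h. (shadow g is (x + h *\<^sub>R axis k 1) - shadow g is x) / h - shadow g (k # is) x) \<longlongrightarrow> 0) (at 0)"
  proof (rule Lim_null_comparison)
    show "\<forall>\<^sub>F h in at 0. norm ((shadow g is (x + h *\<^sub>R axis k 1) - shadow g is x) / h - shadow g (k # is) x) \<le> (C + B) * \<bar>h\<bar>"
      unfolding eventually_at_filter
    proof (intro always_eventually allI impI)
      fix h :: real assume h: "h \<noteq> 0"
      have "\<bar>h\<bar> * \<bar>(shadow g is (x + h *\<^sub>R axis k 1) - shadow g is x) / h - shadow g (k # is) x\<bar> \<le> \<bar>h\<bar> * ((C + B) * \<bar>h\<bar>)"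
      proof -
        have "h * (X / h - c) = X - h * c" for X c :: real using h by (simp add: right_diff_distrib)
        moreover have "\<bar>h\<bar> * ((C + B) * \<bar>h\<bar>) = (C + B) * h\<^sup>2" by (simp add: power2_eq_square mult_ac)
        ultimately show ?thesis using le[of h] by (simp only: abs_mult[symmetric])
      qed
      then show "norm ((shadow g is (x + h *\<^sub>R axis k 1) - shadow g is x) / h - shadow g (k # is) x) \<le> (C + B) * \<bar>h\<bar>"
        using h by simp
    qed
    have "((\<lambda>h. (C + B) * \<bar>h\<bar>) \<longlongrightarrow> (C + B) * \<bar>0\<bar>) (at (0::real))"
      by (intro tendsto_intros)
    then show "((\<lambda>h. (C + B) * \<bar>h\<bar>) \<longlongrightarrow> 0) (at (0::real))" by simp
  qed
  then show ?thesis
    by (simp add: DERIV_def Lim_null[of _ "shadow g (k # is) x"])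
qed

lemma shadow_smooth: "smooth (shadow g [])"
  and shadow_partials: "partials is (shadow g []) = shadow g is"
proof -
  have "continuous_on UNIV (shadow g is)" for "is"
  proof -
    obtain C where C: "C \<ge> 0" "\<And>x y. \<bar>shadow g is x - shadow g is y\<bar> \<le> C * norm (x - y)"
      using shadow_Lipschitz by blast
    then have "C-lipschitz_on UNIV (shadow g is)"
      by (intro lipschitz_onI) (auto simp: dist_norm)
    then show ?thesis by (rule lipschitz_on_continuous_on)
  qed
  from smooth_tower[of "shadow g", OF shadow_deriv this]
  show "smooth (shadow g [])" "partials is (shadow g []) = shadow g is" by auto
qed

lemma shadow_support:
  assumes K: "compact K" "\<forall>\<^sub>F i in U. supported_on K (n i) (g i)" and "y \<notin> K"
  shows "shadow g [] y = 0"
proof -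
  have "open (- K)" using K(1) by (simp add: compact_imp_closed open_Compl)
  then have "\<forall>\<^sub>F i in U. grid_round (n i) y \<in> - K"
    using topological_tendstoD[OF grid_round_tendsto] \<open>y \<notin> K\<close> by blast
  then have "\<forall>\<^sub>F i in U. diffs (n i) [] (g i) (grid_round (n i) y) = 0"
    using K(2) by eventually_elim (auto simp: supported_on_def)
  then have "((\<lambda>i. diffs (n i) [] (g i) (grid_round (n i) y)) \<longlongrightarrow> 0) U"
    by (rule tendsto_eventually)
  then show ?thesis using tendsto_unique[OF nontrivial shadow_tendsto] by blast
qed

text \<open>Uniformity by contradiction: offending lattice points \<open>X i\<close> stay within
  distance 1 of K, hence have a limit y, and along them both quantities tend to
  \<open>shadow g is y\<close>.\<close>

lemma diffs_near_shadow:
  assumes K: "compact K" "\<forall>\<^sub>F i in U. supported_on K (n i) (g i)" and r: "r > 0"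
  shows "\<forall>\<^sub>F i in U. \<forall>x\<in>step_lattice (n i). \<bar>diffs (n i) is (g i) x - shadow g is x\<bar> < r"
proof (rule ccontr)
  let ?D = "\<lambda>i. diffs (n i) is (g i)"
  assume "\<not> ?thesis"
  then have "\<forall>\<^sub>F i in U. \<exists>x. x \<in> step_lattice (n i) \<and> \<not> \<bar>?D i x - shadow g is x\<bar> < r"
    unfolding ultra_not[OF U] by (rule eventually_mono) blast
  from eventually_choice[OF this] obtain X where
    X: "\<forall>\<^sub>F i in U. X i \<in> step_lattice (n i) \<and> \<not> \<bar>?D i (X i) - shadow g is (X i)\<bar> < r" by blast
  obtain R where R: "\<And>z. z \<in> K \<Longrightarrow> norm z \<le> R"
    using compact_imp_bounded[OF K(1)] by (auto simp: bounded_iff)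
  have "\<forall>\<^sub>F i in U. X i \<in> cball 0 (R + 1)"
    using X K(2) eventually_step_less[OF zero_less_one, of "length is"]
  proof eventually_elim
    case (elim i)
    have "?D i (X i) \<noteq> 0 \<or> shadow g is (X i) \<noteq> 0" using elim r by auto
    then have "\<exists>z\<in>K. norm (z - X i) \<le> 1"
    proof
      assume "?D i (X i) \<noteq> 0"
      then obtain z where "g i z \<noteq> 0" "norm (z - X i) \<le> length is * step (n i)"
        using std_diffs_support by blast
      then show ?thesis using elim by (intro bexI[of _ z]) (auto simp: supported_on_def)
    next
      assume 1: "shadow g is (X i) \<noteq> 0"
      have "{x. shadow g [] x \<noteq> 0} \<subseteq> K" using shadow_support[OF K] by blast
      then have "closure {x. shadow g [] x \<noteq> 0} \<subseteq> K"
        using K(1) by (intro closure_minimal compact_imp_closed)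
      then have "X i \<in> K"
        using 1 partials_support[of "X i" "shadow g []" "is"] by (auto simp: shadow_partials)
      then show ?thesis by (intro bexI[of _ "X i"]) auto
    qed
    then obtain z where z: "z \<in> K" "norm (z - X i) \<le> 1" by blast
    have "norm (X i) \<le> norm z + norm (z - X i)"
      by (metis norm_minus_commute norm_triangle_sub)
    then show ?case using R[OF z(1)] z(2) by simp
  qed
  from ultra_compact[OF U compact_cball this] obtain y where y: "(X \<longlongrightarrow> y) U" by blast
  have "((\<lambda>i. ?D i (X i)) \<longlongrightarrow> shadow g is y) U"
    using X y by (intro diffs_tendsto_shadow) (auto elim: eventually_mono)
  moreover have "((\<lambda>i. shadow g is (X i)) \<longlongrightarrow> shadow g is y) U"
  proof -
    have "continuous_on UNIV (shadow g is)"
      using smooth_continuous[OF shadow_smooth, of "is"] by (simp add: shadow_partials)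
    then show ?thesis by (rule continuous_on_tendsto_compose[OF _ y]) auto
  qed
  ultimately have "((\<lambda>i. \<bar>?D i (X i) - shadow g is (X i)\<bar>) \<longlongrightarrow> \<bar>shadow g is y - shadow g is y\<bar>) U"
    by (intro tendsto_intros)
  then have "\<forall>\<^sub>F i in U. \<bar>?D i (X i) - shadow g is (X i)\<bar> < r"
    using r by (intro order_tendstoD(2)) auto
  with X have "\<forall>\<^sub>F i in U. False" by eventually_elim auto
  then show False using nontrivial by (simp add: trivial_limit_def)
qed

end

lemma gtest_restrict_grid:
  fixes \<Omega> :: "(real ^ 'k::finite) set"
  assumes "\<phi> \<in> test_functions \<Omega>"
  shows "gtest \<Omega> (\<lambda>i. restrict_grid \<Omega> (n i) \<phi>)"
proof -
  obtain K where K: "compact K" "K \<subseteq> \<Omega>" "\<phi> \<in> test_functions K"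
    using test_function_support[OF assms] by blast
  obtain R where R: "\<forall>x\<in>K. \<forall>i. \<bar>x $ i\<bar> \<le> R"
    using compact_box[OF K(1)] by blast
  have "\<exists>C. \<forall>\<^sub>F i in U. \<forall>x. \<bar>diffs (n i) is (restrict_grid \<Omega> (n i) \<phi>) x\<bar> \<le> C" for "is"
  proof -
    obtain B where B: "\<And>x. \<bar>partials (rev is) \<phi> x\<bar> \<le> B"
      using test_function_partial_bounded[OF assms] by blast
    have "\<forall>\<^sub>F i in U. \<forall>x. \<bar>diffs (n i) is (restrict_grid \<Omega> (n i) \<phi>) x\<bar> \<le> B"
      using eventually_n[OF eventually_fact_ge[of R]]
      by eventually_elim (intro allI restrict_grid_diffs_bound[OF K(3,2) R _ B])
    then show ?thesis by blast
  qed
  then show ?thesis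
    unfolding gtest_def
    by (intro conjI allI exI[of _ K] K always_eventually restrict_grid_supported[OF K(3)])
qed

lemma gdist_small:
  fixes \<Omega> :: "(real ^ 'k::finite) set"
  assumes f: "gdist \<Omega> f" and K: "compact K" "K \<subseteq> \<Omega>" "\<forall>\<^sub>F i in U. supported_on K (n i) (h i)"
    and small: "\<And>is r. r > 0 \<Longrightarrow> \<forall>\<^sub>F i in U. \<forall>x. \<bar>diffs (n i) is (h i) x\<bar> \<le> r"
  shows "((\<lambda>i. std_inner (n i) (f i) (h i)) \<longlongrightarrow> 0) U"
proof -
  \<comment> \<open>The order and the smallness are tied to the same m, so that after the diagonal
    argument the multiple by \<open>Suc (M i)\<close> has differences bounded by 1 at every fixed
    order.\<close>
  define P where "P m i \<longleftrightarrow> (\<forall>is\<in>{is. length is \<le> m}. \<forall>x. \<bar>diffs (n i) is (h i) x\<bar> \<le> 1 / real (Suc m))" for m i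
  have "\<forall>\<^sub>F i in U. P m i" for m
    unfolding P_def using finite_lists_length_le[of "UNIV :: 'k set" m]
    by (intro eventually_ball_finite ballI small) auto
  from diagonal[of n U P, OF n this] obtain M where M: "\<forall>\<^sub>F i in U. P (M i) i" "filterlim M at_top U" by blast
  have "gtest \<Omega> (\<lambda>i x. real (Suc (M i)) * h i x)"
    unfolding gtest_def
  proof (intro conjI allI exI[of _ K] K)
    show "\<forall>\<^sub>F i in U. supported_on K (n i) (\<lambda>x. real (Suc (M i)) * h i x)"
      using K(3) by eventually_elim (auto simp: supported_on_def)
    show "\<exists>C. \<forall>\<^sub>F i in U. \<forall>x. \<bar>diffs (n i) is (\<lambda>x. real (Suc (M i)) * h i x) x\<bar> \<le> C" for "is"
    proof (rule exI[of _ 1])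
      show "\<forall>\<^sub>F i in U. \<forall>x. \<bar>diffs (n i) is (\<lambda>x. real (Suc (M i)) * h i x) x\<bar> \<le> 1"
        using M(1) filterlim_at_top[THEN iffD1, OF M(2), rule_format, of "length is"]
      proof eventually_elim
        case (elim i)
        show ?case
        proof
          fix x
          have "\<bar>diffs (n i) is (h i) x\<bar> \<le> 1 / real (Suc (M i))"
            using elim unfolding P_def by blast
          then have "real (Suc (M i)) * \<bar>diffs (n i) is (h i) x\<bar> \<le> real (Suc (M i)) * (1 / real (Suc (M i)))"
            by (intro mult_left_mono) auto
          then show "\<bar>diffs (n i) is (\<lambda>x. real (Suc (M i)) * h i x) x\<bar> \<le> 1"
            by (simp only: std_diffs_scale abs_mult abs_of_nat) simp
        qed
      qed
    qed
  qed
  then obtain C where C: "\<forall>\<^sub>F i in U. \<bar>std_inner (n i) (f i) (\<lambda>x. real (Suc (M i)) * h i x)\<bar> \<le> C"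
    using f unfolding gdist_def by blast
  have eq: "std_inner m f (\<lambda>x. c * h x) = c * std_inner m f h" for m c and f h :: "real ^ 'k \<Rightarrow> real"
    by (simp add: std_inner_def sum_distrib_left mult_ac)
  have "\<forall>\<^sub>F i in U. norm (std_inner (n i) (f i) (h i)) \<le> C / real (Suc (M i))"
    using C
  proof eventually_elim
    case (elim i)
    then have "real (Suc (M i)) * \<bar>std_inner (n i) (f i) (h i)\<bar> \<le> C"
      by (simp only: eq abs_mult abs_of_nat)
    then show ?case by (simp add: pos_le_divide_eq mult.commute del: of_nat_Suc)
  qed
  moreover have "((\<lambda>i. C / real (Suc (M i))) \<longlongrightarrow> 0) U"
    by (rule filterlim_compose[OF _ M(2)]) (use LIMSEQ_Suc[OF lim_const_over_n] in simp)
  ultimately show ?thesis by (rule Lim_null_comparison)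
qed

text \<open>Finite differences of \<open>g\<close> and of the restriction of its shadow are infinitely close, so
  that an infinite multiple of the difference of the two is still a test function.\<close>

lemma gtest_shadow:
  fixes \<Omega> :: "(real ^ 'k::finite) set"
  assumes g: "gtest \<Omega> g"
  shows "\<exists>\<phi>\<in>test_functions \<Omega>. \<forall>f. gdist \<Omega> f \<longrightarrow>
    ((\<lambda>i. std_inner (n i) (f i) (g i) - std_inner (n i) (f i) (restrict_grid \<Omega> (n i) \<phi>)) \<longlongrightarrow> 0) U"
proof -
  obtain K where K: "compact K" "K \<subseteq> \<Omega>" "\<forall>\<^sub>F i in U. supported_on K (n i) (g i)"
    using g unfolding gtest_def by blast
  define \<phi> where "\<phi> = shadow g []"
  have \<phi>K: "\<phi> \<in> test_functions K"
    unfolding \<phi>_def using shadow_support[OF g K(1,3)]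
    by (intro test_functionI[OF shadow_smooth[OF g] K(1)]) auto
  obtain R where R: "\<forall>x\<in>K. \<forall>i. \<bar>x $ i\<bar> \<le> R"
    using compact_box[OF K(1)] by blast
  let ?h = "\<lambda>i x. g i x - restrict_grid \<Omega> (n i) \<phi> x"
  have supp: "\<forall>\<^sub>F i in U. supported_on K (n i) (?h i)"
    using K(3)
  proof eventually_elim
    case (elim i)
    then show ?case
      using restrict_grid_supported[OF \<phi>K, of "n i" \<Omega>] unfolding supported_on_def by (metis diff_zero)
  qed
  have small: "\<forall>\<^sub>F i in U. \<forall>x. \<bar>diffs (n i) is (?h i) x\<bar> \<le> r" if r: "r > 0" for "is" r
  proof -
    \<comment> \<open>Both functions are compared with \<open>partials (rev is) \<phi>\<close>. For
      g this is the shadow belonging to the reversed list, and \<open>std_diffs_rev\<close> restores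
      the order of the differences.\<close>
    obtain C where C: "\<And>n x. \<bar>diffs n is \<phi> x - partials (rev is) \<phi> x\<bar> \<le> C * step n"
      using test_function_diffs_approx[OF \<phi>K] by blast
    have "\<forall>\<^sub>F i in U. \<forall>x\<in>step_lattice (n i). \<bar>diffs (n i) (rev is) (g i) x - shadow g (rev is) x\<bar> < r / 2"
      using r by (intro diffs_near_shadow[OF g K(1,3)]) simp
    then show ?thesis
      using eventually_step_less[OF half_gt_zero[OF r], of C] K(3) eventually_n[OF eventually_fact_ge[of R]]
    proof eventually_elim
      case (elim i)
      show ?case
      proof
        fix x
        show "\<bar>diffs (n i) is (?h i) x\<bar> \<le> r"
        proof (cases "x \<in> step_lattice (n i)")
          case True
          have "\<bar>diffs (n i) is (g i) x - partials (rev is) \<phi> x\<bar> < r / 2"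
            using elim(1) True by (simp add: \<phi>_def shadow_partials[OF g] std_diffs_rev)
          moreover have "\<bar>diffs (n i) is \<phi> x - partials (rev is) \<phi> x\<bar> < r / 2"
            using C[of "n i" x] elim(2) by (rule le_less_trans)
          ultimately have "\<bar>diffs (n i) is (g i) x - diffs (n i) is \<phi> x\<bar> \<le> r"
            by linarith
          then show ?thesis
            using True unfolding std_diffs_diff restrict_grid_diffs[OF \<phi>K K(2) R elim(4)] by simp
        next
          case False
          have "diffs (n i) is (g i) x = 0"
          proof (rule ccontr)
            assume "\<not> ?thesis"
            from std_diffs_support[OF this] obtain z where "g i z \<noteq> 0" "z \<notin> step_lattice (n i)"
              using False by blast
            then show False using elim(3) by (auto simp: supported_on_def std_grid_iff)
          qed
          then show ?thesis
            using False r unfolding std_diffs_diff restrict_grid_diffs[OF \<phi>K K(2) R elim(4)] by simp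
        qed
      qed
    qed
  qed
  have "((\<lambda>i. std_inner (n i) (f i) (g i) - std_inner (n i) (f i) (restrict_grid \<Omega> (n i) \<phi>)) \<longlongrightarrow> 0) U"
    if "gdist \<Omega> f" for f
  proof -
    have "std_inner m f (\<lambda>x. a x - b x) = std_inner m f a - std_inner m f b" for m and f a b :: "real ^ 'k \<Rightarrow> real"
      by (simp add: std_inner_def right_diff_distrib sum_subtractf)
    then show ?thesis
      using gdist_small[OF that K(1,2) supp small] by simp
  qed
  moreover have "\<phi> \<in> test_functions \<Omega>" using \<phi>K test_functions_mono[OF K(2)] by blast
  ultimately show ?thesis by blast
qed

section \<open>The distribution belonging to a grid distribution\<close>

definition pairing :: "(real ^ 'k::finite) set \<Rightarrow> ('i \<Rightarrow> real ^ 'k \<Rightarrow> real) \<Rightarrow> (real ^ 'k \<Rightarrow> real) \<Rightarrow> real" where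
  "pairing \<Omega> f = (\<lambda>\<phi>\<in>test_functions \<Omega>. Lim U (\<lambda>i. std_inner (n i) (f i) (restrict_grid \<Omega> (n i) \<phi>)))"

lemma pairing_tendsto:
  assumes "gdist \<Omega> f" "\<phi> \<in> test_functions \<Omega>"
  shows "((\<lambda>i. std_inner (n i) (f i) (restrict_grid \<Omega> (n i) \<phi>)) \<longlongrightarrow> pairing \<Omega> f \<phi>) U"
proof -
  obtain C where "\<forall>\<^sub>F i in U. \<bar>std_inner (n i) (f i) (restrict_grid \<Omega> (n i) \<phi>)\<bar> \<le> C"
    using assms(1) gtest_restrict_grid[OF assms(2)] unfolding gdist_def by blast
  from ultra_bounded_convergent[OF U this] obtain l where
    l: "((\<lambda>i. std_inner (n i) (f i) (restrict_grid \<Omega> (n i) \<phi>)) \<longlongrightarrow> l) U" by blast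
  then show ?thesis
    using tendsto_Lim[OF nontrivial l] assms(2) by (simp add: pairing_def)
qed

text \<open>Without continuity on \<open>test_functions K\<close> there are \<psi> m with
  derivatives up to order m at most 1/(m + 1)^2 and pairings of absolute value at least e. At an
  infinite m the multiple by m + 1 is still a grid test function, but its inner product with f is
  infinite.\<close>

lemma pairing_distribution:
  fixes \<Omega> :: "(real ^ 'k::finite) set"
  assumes f: "gdist \<Omega> f"
  shows "pairing \<Omega> f \<in> distributions \<Omega>"
proof (rule distributionI)
  show "pairing \<Omega> f \<in> extensional (test_functions \<Omega>)" by (simp add: pairing_def)
next
  fix \<phi> \<psi> assume \<phi>: "\<phi> \<in> test_functions \<Omega>" and \<psi>: "\<psi> \<in> test_functions \<Omega>"
  have eq: "std_inner m f (restrict_grid \<Omega> m (\<lambda>x. \<phi> x + \<psi> x)) =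
      std_inner m f (restrict_grid \<Omega> m \<phi>) + std_inner m f (restrict_grid \<Omega> m \<psi>)" for m f
    unfolding std_inner_def distrib_left[symmetric] sum.distrib[symmetric]
    by (intro arg_cong2[where f = "(*)"] sum.cong) (auto simp: restrict_grid_def distrib_left)
  show "pairing \<Omega> f (\<lambda>x. \<phi> x + \<psi> x) = pairing \<Omega> f \<phi> + pairing \<Omega> f \<psi>"
    using tendsto_unique[OF nontrivial pairing_tendsto[OF f test_functions_add[OF \<phi> \<psi>], unfolded eq]
        tendsto_add[OF pairing_tendsto[OF f \<phi>] pairing_tendsto[OF f \<psi>]]] .
next
  fix \<phi> r assume \<phi>: "\<phi> \<in> test_functions \<Omega>"
  have eq: "std_inner m f (restrict_grid \<Omega> m (\<lambda>x. r * \<phi> x)) = r * std_inner m f (restrict_grid \<Omega> m \<phi>)" for m f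
    unfolding std_inner_def mult.left_commute[of r] sum_distrib_left
    by (intro arg_cong2[where f = "(*)"] sum.cong) (auto simp: restrict_grid_def mult_ac)
  show "pairing \<Omega> f (\<lambda>x. r * \<phi> x) = r * pairing \<Omega> f \<phi>"
    using tendsto_unique[OF nontrivial pairing_tendsto[OF f test_functions_scale[OF \<phi>, of r], unfolded eq]
        tendsto_mult_left[OF pairing_tendsto[OF f \<phi>], of r]] .
next
  fix K and e :: real assume K: "compact K" "K \<subseteq> \<Omega>" and e: "e > 0"
  obtain R where R: "\<forall>x\<in>K. \<forall>i. \<bar>x $ i\<bar> \<le> R"
    using compact_box[OF K(1)] by blast
  \<comment> \<open>One factor is consumed by the multiplication with \<open>Suc (M i)\<close>; the
    other remains as a bound for the differences.\<close>
  let ?d = "\<lambda>m. 1 / (real (Suc m) * real (Suc m))"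
  show "\<exists>m::nat. \<exists>\<delta>>0. \<forall>\<psi> \<in> test_functions K.
      (\<forall>is x. length is \<le> m \<longrightarrow> \<bar>partials is \<psi> x\<bar> \<le> \<delta>) \<longrightarrow> \<bar>pairing \<Omega> f \<psi>\<bar> < e"
  proof (rule ccontr)
    assume "\<not> ?thesis"
    then have *: "\<not> (\<exists>\<delta>>0. \<forall>\<psi> \<in> test_functions K.
      (\<forall>is x. length is \<le> m \<longrightarrow> \<bar>partials is \<psi> x\<bar> \<le> \<delta>) \<longrightarrow> \<bar>pairing \<Omega> f \<psi>\<bar> < e)" for m by blast
    have "\<forall>m. \<exists>\<psi>. \<psi> \<in> test_functions K \<and> (\<forall>is x. length is \<le> m \<longrightarrow> \<bar>partials is \<psi> x\<bar> \<le> ?d m) \<and>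
        \<not> \<bar>pairing \<Omega> f \<psi>\<bar> < e"
    proof
      fix m :: nat
      have "?d m > 0" by simp
      with *[of m] show "\<exists>\<psi>. \<psi> \<in> test_functions K \<and> (\<forall>is x. length is \<le> m \<longrightarrow> \<bar>partials is \<psi> x\<bar> \<le> ?d m) \<and>
        \<not> \<bar>pairing \<Omega> f \<psi>\<bar> < e" by blast
    qed
    from choice[OF this] obtain \<psi> where \<psi>: "\<And>m. \<psi> m \<in> test_functions K"
      "\<And>m is x. length is \<le> m \<Longrightarrow> \<bar>partials is (\<psi> m) x\<bar> \<le> ?d m" "\<And>m. \<not> \<bar>pairing \<Omega> f (\<psi> m)\<bar> < e" by blast
    have \<psi>\<Omega>: "\<psi> m \<in> test_functions \<Omega>" for m using \<psi>(1) test_functions_mono[OF K(2)] by blast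
    have "\<forall>\<^sub>F i in U. \<bar>std_inner (n i) (f i) (restrict_grid \<Omega> (n i) (\<psi> m))\<bar> > e / 2" for m
      using \<psi>(3)[of m] e by (intro order_tendstoD(1)[OF tendsto_rabs[OF pairing_tendsto[OF f \<psi>\<Omega>]]]) auto
    from diagonal[of n U "\<lambda>m i. \<bar>std_inner (n i) (f i) (restrict_grid \<Omega> (n i) (\<psi> m))\<bar> > e / 2", OF n this]
    obtain M where
      M: "\<forall>\<^sub>F i in U. \<bar>std_inner (n i) (f i) (restrict_grid \<Omega> (n i) (\<psi> (M i)))\<bar> > e / 2" "filterlim M at_top U" by blast
    let ?g = "\<lambda>i x. real (Suc (M i)) * restrict_grid \<Omega> (n i) (\<psi> (M i)) x"
    have "gtest \<Omega> ?g"
      unfolding gtest_def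
    proof (intro conjI allI exI[of _ K] K)
      show "\<forall>\<^sub>F i in U. supported_on K (n i) (?g i)"
      proof (intro always_eventually allI)
        show "supported_on K (n i) (?g i)" for i
          using restrict_grid_supported[OF \<psi>(1), of "n i" \<Omega> "M i"] by (simp add: supported_on_def)
      qed
      show "\<exists>C. \<forall>\<^sub>F i in U. \<forall>x. \<bar>diffs (n i) is (?g i) x\<bar> \<le> C" for "is"
      proof (rule exI[of _ 1])
        show "\<forall>\<^sub>F i in U. \<forall>x. \<bar>diffs (n i) is (?g i) x\<bar> \<le> 1"
          using filterlim_at_top[THEN iffD1, OF M(2), rule_format, of "length is"] eventually_n[OF eventually_fact_ge[of R]]
        proof eventually_elim
          case (elim i)
          show ?case
          proof
            fix x
            have "\<bar>diffs (n i) is (restrict_grid \<Omega> (n i) (\<psi> (M i))) x\<bar> \<le> ?d (M i)"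
              by (rule restrict_grid_diffs_bound[OF \<psi>(1) K(2) R elim(2)]) (use \<psi>(2) elim(1) in simp)
            then have "\<bar>diffs (n i) is (?g i) x\<bar> \<le> real (Suc (M i)) * ?d (M i)"
              unfolding std_diffs_scale abs_mult by (simp only: abs_of_nat) (intro mult_left_mono, auto)
            also have "\<dots> = 1 / real (Suc (M i))" by simp
            also have "\<dots> \<le> 1" by simp
            finally show "\<bar>diffs (n i) is (?g i) x\<bar> \<le> 1" .
          qed
        qed
      qed
    qed
    then obtain C where C: "\<forall>\<^sub>F i in U. \<bar>std_inner (n i) (f i) (?g i)\<bar> \<le> C"
      using f unfolding gdist_def by blast
    obtain m :: nat where m: "real m * (e / 2) > C"
      using reals_Archimedean3[of "e / 2"] e by auto
    have "\<forall>\<^sub>F i in U. False"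
      using C M(1) filterlim_at_top[THEN iffD1, OF M(2), rule_format, of m]
    proof eventually_elim
      case (elim i)
      have "std_inner (n i) (f i) (?g i) = real (Suc (M i)) * std_inner (n i) (f i) (restrict_grid \<Omega> (n i) (\<psi> (M i)))"
        by (simp add: std_inner_def sum_distrib_left mult_ac)
      then have "real (Suc (M i)) * \<bar>std_inner (n i) (f i) (restrict_grid \<Omega> (n i) (\<psi> (M i)))\<bar> \<le> C"
        using elim(1) by (simp add: abs_mult)
      moreover have "real m * (e / 2) \<le> real (Suc (M i)) * \<bar>std_inner (n i) (f i) (restrict_grid \<Omega> (n i) (\<psi> (M i)))\<bar>"
        using elim e by (intro mult_mono) auto
      ultimately show False using m by linarith
    qed
    then show False using nontrivial by (simp add: trivial_limit_def)
  qed
qed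

end

section \<open>Internal grid functions in a model\<close>

context grid_model
begin

sublocale grid_filter U n
  by unfold_locales (rule U_ultra n_inf)+

lemma infinite: "infinite_hypernat E n0"
  unfolding infinite_hypernat_def n0_def los1
proof
  fix m
  show "\<forall>\<^sub>F i in U. [real_in E (of_nat (n i))] \<in> {[real_in E (of_nat n)] |n. m < n}"
    using filterlim_at_top[THEN iffD1, OF n_inf, rule_format, of "Suc m"] by eventually_elim auto
qed

text \<open>A choice of bad points defines an internal hyperpoint, to which the pointwise condition
  in \<open>grid_functions\<close> applies. So a condition on hyperpoints becomes one on all points
  at almost all indices.\<close>

lemma grid_functionsD:
  assumes "jf f \<in> grid_functions E n0 \<Omega>"
  shows "\<forall>\<^sub>F i in U. \<forall>x. f i x \<noteq> 0 \<longrightarrow> x \<in> \<Omega> \<inter> std_grid (n i)"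
proof (rule ccontr)
  assume "\<not> ?thesis"
  then have "\<forall>\<^sub>F i in U. \<exists>x. f i x \<noteq> 0 \<and> x \<notin> \<Omega> \<inter> std_grid (n i)"
    unfolding not_eventually_U by (rule eventually_mono) blast
  from eventually_choice[OF this] obtain X where
    X: "\<forall>\<^sub>F i in U. f i (X i) \<noteq> 0 \<and> X i \<notin> \<Omega> \<inter> std_grid (n i)" by blast
  then have "jp X \<notin> Omega_grid E n0 \<Omega>"
    unfolding Omega_grid_jp not_eventually_U by (rule eventually_mono) blast
  then have "happ E (jf f) (jp X) = hzero E"
    using assms hyperpoints_jp[of X] by (simp add: grid_functions_def)
  then have "\<forall>\<^sub>F i in U. f i (X i) = 0"
    by (simp add: happ_jf hzero_j j_eq)
  with X have "\<forall>\<^sub>F i in U. False" by eventually_elim auto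
  then show False using U_nontrivial by (simp add: trivial_limit_def)
qed

text \<open>A hyperpoint x need not be represented in the given model. The hypothesis is a property
  of F at N_0 in the sense of \<open>holds_at\<close>, so it is available in a model that represents
  x as well.\<close>

lemma grid_functionsI:
  assumes "\<forall>\<^sub>F i in U. \<forall>x. f i x \<noteq> 0 \<longrightarrow> x \<in> \<Omega> \<inter> std_grid (n i)"
  shows "jf f \<in> grid_functions E n0 \<Omega>"
proof -
  define F where "F = jf f"
  have F: "F \<in> internal_funs E" "holds_at E n0 F (\<lambda>n f. \<forall>x. f x \<noteq> 0 \<longrightarrow> x \<in> \<Omega> \<inter> std_grid n)"
    unfolding F_def using assms by (auto simp: internal_funs_jf holds_at_jf)
  have "happ E F x = hzero E" if x: "x \<in> hyperpoints E - Omega_grid E n0 \<Omega>" for x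
  proof -
    obtain U' :: "'u list filter" and j' n' where m: "grid_model E n0 U' j' n'" "set [F, x] \<subseteq> range j'"
      using ex_model[OF ne infinite] by blast
    interpret m: grid_model E n0 U' j' n' by fact
    obtain f' X where f': "F = m.jf f'" and X: "x = m.jp X"
      using m.internal_funs_range[OF F(1)] m.hyperpoints_range[of x] x m(2) by auto
    have "\<forall>\<^sub>F i in U'. X i \<notin> \<Omega> \<inter> std_grid (n' i)"
      using x unfolding X by (simp add: m.Omega_grid_jp m.not_eventually_U)
    moreover have "\<forall>\<^sub>F i in U'. \<forall>x. f' i x \<noteq> 0 \<longrightarrow> x \<in> \<Omega> \<inter> std_grid (n' i)"
      using F(2) unfolding f' m.holds_at_jf .
    ultimately have "\<forall>\<^sub>F i in U'. f' i (X i) = 0"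
      by eventually_elim blast
    then show ?thesis
      unfolding f' X m.happ_jf by (simp add: m.hzero_j m.j_eq)
  qed
  then show ?thesis
    using F(1) unfolding grid_functions_def F_def by blast
qed

lemma round_nearstandard:
  assumes "open \<Omega>" "y \<in> \<Omega>"
  shows "jp (\<lambda>i. grid_round (n i) y) \<in> nearstandard E n0 \<Omega>"
proof -
  have "\<forall>\<^sub>F i in U. grid_round (n i) y \<in> \<Omega>"
    by (rule topological_tendstoD[OF grid_round_tendsto assms])
  then have "\<forall>\<^sub>F i in U. grid_round (n i) y \<in> \<Omega> \<inter> std_grid (n i)"
    using eventually_n[OF eventually_fact_ge[of "norm y + 1"]]
  proof eventually_elim
    case (elim i)
    have "\<bar>grid_round (n i) y $ k\<bar> \<le> fact (n i)" for k
      using grid_round_component[of "n i" y k] component_le_norm_cart[of y k] step_le[of "n i"] elim(2) by linarith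
    then show ?case using elim(1) by (simp add: std_grid_iff grid_round_lattice)
  qed
  then show ?thesis
    unfolding nearstandard_def using assms(2) grid_round_tendsto[of y]
    by (auto simp: Omega_grid_jp near_pt_std)
qed

text \<open>Class S^0 asks for a nearstandard point with a finite value, hence the nonempty
  \<Omega>. The support and the Lipschitz constants are put into the form \<open>holds_at\<close>,
  so that they can be used in models representing arbitrary nearstandard points.\<close>

lemma gtest_grid_test:
  assumes \<Omega>: "open \<Omega>" "\<Omega> \<noteq> {}" and g: "gtest \<Omega> g"
  shows "jf g \<in> grid_test_functions E n0 \<Omega>"
proof -
  define G where "G = jf g"
  obtain K where K: "compact K" "K \<subseteq> \<Omega>" "\<forall>\<^sub>F i in U. supported_on K (n i) (g i)"
    using g unfolding gtest_def by blast
  have G: "G \<in> internal_funs E" by (simp add: G_def internal_funs_jf)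
  have GK: "holds_at E n0 G (\<lambda>n g. supported_on K n g)"
    unfolding G_def holds_at_jf by (rule K)
  obtain C where C: "\<And>is. C is \<ge> 0" "\<And>is. holds_at E n0 G (\<lambda>n g. \<forall>x\<in>step_lattice n. \<forall>y\<in>step_lattice n.
      \<bar>diffs n is g x - diffs n is g y\<bar> \<le> C is * norm (x - y))"
  proof -
    have "\<forall>is. \<exists>C\<ge>0. holds_at E n0 G (\<lambda>n g. \<forall>x\<in>step_lattice n. \<forall>y\<in>step_lattice n.
      \<bar>diffs n is g x - diffs n is g y\<bar> \<le> C * norm (x - y))"
      unfolding G_def holds_at_jf using diffs_Lipschitz[OF g] by blast
    from choice[OF this] show ?thesis using that by blast
  qed
  have S0: "class_S0 E n0 \<Omega> (grid_diff E n0 is G)" for "is"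
    unfolding class_S0_def
  proof (intro conjI ballI impI)
    obtain y where y: "y \<in> \<Omega>" using \<Omega>(2) by blast
    let ?x = "jp (\<lambda>i. grid_round (n i) y)"
    obtain B where "\<forall>\<^sub>F i in U. \<forall>x. \<bar>diffs (n i) is (g i) x\<bar> \<le> B"
      using g unfolding gtest_def by blast
    then have "\<forall>\<^sub>F i in U. \<bar>diffs (n i) is (g i) (grid_round (n i) y)\<bar> \<le> B"
      by eventually_elim blast
    then have "hfinite E (happ E (grid_diff E n0 is G) ?x)"
      unfolding G_def grid_diff_jf happ_jf hfinite_jr by blast
    then show "\<exists>x\<in>nearstandard E n0 \<Omega>. hfinite E (happ E (grid_diff E n0 is G) x)"
      using round_nearstandard[OF \<Omega>(1) y] by blast
  next
    fix x y assume x: "x \<in> nearstandard E n0 \<Omega>" and y: "y \<in> nearstandard E n0 \<Omega>" and near: "near_pt E x y"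
    obtain U' :: "'u list filter" and j' n' where m: "grid_model E n0 U' j' n'" "set [G, x, y] \<subseteq> range j'"
      using ex_model[OF ne infinite] by blast
    interpret m: grid_model E n0 U' j' n' by fact
    obtain g' where g': "G = m.jf g'"
      using m.internal_funs_range[OF G] m(2) by auto
    obtain X Y where X: "x = m.jp X" and Y: "y = m.jp Y"
      using m.hyperpoints_range[of x] m.hyperpoints_range[of y] x y m(2) m.Omega_grid_hyperpoints[of \<Omega>]
      by (auto simp: nearstandard_def)
    have lat: "\<forall>\<^sub>F i in U'. X i \<in> step_lattice (n' i) \<and> Y i \<in> step_lattice (n' i)"
      using x y unfolding X Y nearstandard_def
      by (auto simp: m.Omega_grid_jp std_grid_iff eventually_conj_iff)
    show "near E (happ E (grid_diff E n0 is G) x) (happ E (grid_diff E n0 is G) y)"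
      unfolding g' X Y m.grid_diff_jf m.happ_jf m.near_jr
    proof (intro allI impI)
      fix r :: real assume r: "r > 0"
      \<comment> \<open>Adding 1 allows for a Lipschitz constant 0.\<close>
      have "r / (C is + 1) > 0" using r C(1)[of "is"] by simp
      then have "\<forall>\<^sub>F i in U'. dist (X i) (Y i) < r / (C is + 1)"
        using near unfolding X Y m.near_pt_jp by blast
      then show "\<forall>\<^sub>F i in U'. \<bar>diffs (n' i) is (g' i) (X i) - diffs (n' i) is (g' i) (Y i)\<bar> < r"
        using lat C(2)[of "is", unfolded g' m.holds_at_jf]
      proof eventually_elim
        case (elim i)
        have "\<bar>diffs (n' i) is (g' i) (X i) - diffs (n' i) is (g' i) (Y i)\<bar> \<le> C is * norm (X i - Y i)"
          using elim by blast
        also have "\<dots> \<le> (C is + 1) * norm (X i - Y i)" by (intro mult_right_mono) auto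
        also have "\<dots> < r" using elim(1) C(1)[of "is"] by (simp add: dist_norm pos_less_divide_eq mult.commute)
        finally show ?case .
      qed
    qed
  qed
  have supp: "hfinite_pt E x \<and> (\<forall>y. near_pt E x (std E (pt_in E y)) \<longrightarrow> y \<in> K)" if x: "x \<in> grid_supp E n0 \<Omega> G" for x
  proof -
    obtain U' :: "'u list filter" and j' n' where m: "grid_model E n0 U' j' n'" "set [G, x] \<subseteq> range j'"
      using ex_model[OF ne infinite] by blast
    interpret m: grid_model E n0 U' j' n' by fact
    obtain g' where g': "G = m.jf g'"
      using m.internal_funs_range[OF G] m(2) by auto
    obtain X where X: "x = m.jp X"
      using m.hyperpoints_range[of x] x m(2) m.Omega_grid_hyperpoints[of \<Omega>] by (auto simp: grid_supp_def)
    have "\<forall>\<^sub>F i in U'. g' i (X i) \<noteq> 0"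
      using x unfolding g' X grid_supp_def by (simp add: m.happ_jf m.hzero_j m.j_eq m.not_eventually_U)
    then have XK: "\<forall>\<^sub>F i in U'. X i \<in> K"
      using GK[unfolded g' m.holds_at_jf] by eventually_elim (auto simp: supported_on_def)
    obtain R where R: "\<And>z. z \<in> K \<Longrightarrow> norm z \<le> R"
      using compact_imp_bounded[OF K(1)] by (auto simp: bounded_iff)
    have "\<forall>\<^sub>F i in U'. norm (X i) \<le> R"
      using XK by eventually_elim (rule R)
    then have "hfinite_pt E x" unfolding X m.hfinite_pt_jp by blast
    moreover have "y \<in> K" if "near_pt E x (std E (pt_in E y))" for y
      using Lim_in_closed_set[OF compact_imp_closed[OF K(1)] XK m.U_nontrivial] that
      unfolding X m.near_pt_std by blast
    ultimately show ?thesis by blast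
  qed
  then have "st_set E (grid_supp E n0 \<Omega> G) \<subseteq> K" by (auto simp: st_set_def)
  then have "closure (st_set E (grid_supp E n0 \<Omega> G)) \<subseteq> K"
    using K(1) by (intro closure_minimal compact_imp_closed)
  moreover from this have "compact (closure (st_set E (grid_supp E n0 \<Omega> G)))"
    using K(1) bounded_subset[OF compact_imp_bounded[OF K(1)]] by (simp add: compact_eq_bounded_closed)
  moreover have "G \<in> grid_functions E n0 \<Omega>"
    unfolding G_def
  proof (rule grid_functionsI)
    show "\<forall>\<^sub>F i in U. \<forall>x. g i x \<noteq> 0 \<longrightarrow> x \<in> \<Omega> \<inter> std_grid (n i)"
      using K(3) by eventually_elim (use K(2) in \<open>auto simp: supported_on_def\<close>)
  qed
  ultimately show ?thesis
    using S0 supp K(2) unfolding grid_test_functions_def class_Sinf_def G_def by blast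
qed

text \<open>K is a compact neighbourhood of the closure of the standard part of the support. A
  support point outside K would be finite, so infinitely close to its standard part, which lies in
  that closure; but then it is within d of the closure and belongs to K.\<close>

lemma grid_test_supported:
  assumes \<Omega>: "open \<Omega>" and g: "jf g \<in> grid_test_functions E n0 \<Omega>"
  shows "\<exists>K. compact K \<and> K \<subseteq> \<Omega> \<and> (\<forall>\<^sub>F i in U. supported_on K (n i) (g i))"
proof -
  let ?S = "closure (st_set E (grid_supp E n0 \<Omega> (jf g)))"
  have S: "compact ?S" "?S \<subseteq> \<Omega>" and fin: "\<forall>x \<in> grid_supp E n0 \<Omega> (jf g). hfinite_pt E x"
    and gf: "jf g \<in> grid_functions E n0 \<Omega>"
    using g by (auto simp: grid_test_functions_def)
  obtain d K where d: "d > 0" and K: "compact K" "K \<subseteq> \<Omega>"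
    and SK: "\<And>x y. x \<in> ?S \<Longrightarrow> norm (y - x) \<le> d \<Longrightarrow> y \<in> K"
    using compact_nbhd[OF S(1) \<Omega> S(2)] by blast
  have "\<forall>\<^sub>F i in U. \<forall>x. g i x \<noteq> 0 \<longrightarrow> x \<in> K"
  proof (rule ccontr)
    assume "\<not> ?thesis"
    then have "\<forall>\<^sub>F i in U. \<exists>x. g i x \<noteq> 0 \<and> x \<notin> K"
      unfolding not_eventually_U by (rule eventually_mono) blast
    from eventually_choice[OF this] obtain X where X: "\<forall>\<^sub>F i in U. g i (X i) \<noteq> 0 \<and> X i \<notin> K" by blast
    have "\<forall>\<^sub>F i in U. X i \<in> \<Omega> \<inter> std_grid (n i)"
      using X grid_functionsD[OF gf] by eventually_elim blast
    moreover have "\<forall>\<^sub>F i in U. g i (X i) \<noteq> 0" using X by eventually_elim blast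
    ultimately have supp: "jp X \<in> grid_supp E n0 \<Omega> (jf g)"
      by (simp add: grid_supp_def Omega_grid_jp happ_jf hzero_j j_eq not_eventually_U)
    then obtain r where "\<forall>\<^sub>F i in U. norm (X i) \<le> r"
      using fin hfinite_pt_jp by blast
    then have "\<forall>\<^sub>F i in U. X i \<in> cball 0 r" by eventually_elim simp
    from ultra_compact[OF U compact_cball this] obtain y where y: "(X \<longlongrightarrow> y) U" by blast
    then have "y \<in> st_set E (grid_supp E n0 \<Omega> (jf g))"
      using supp unfolding st_set_def mem_Collect_eq near_pt_std[symmetric] by blast
    then have "y \<in> ?S" using closure_subset by blast
    have "\<forall>\<^sub>F i in U. dist (X i) y < d" using y d by (simp add: tendsto_iff)
    with X have "\<forall>\<^sub>F i in U. False"
      by eventually_elim (use SK[OF \<open>y \<in> ?S\<close>] in \<open>auto simp: dist_norm\<close>)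
    then show False using U_nontrivial by (simp add: trivial_limit_def)
  qed
  then have "\<forall>\<^sub>F i in U. supported_on K (n i) (g i)"
    using grid_functionsD[OF gf] by eventually_elim (auto simp: supported_on_def)
  then show ?thesis using K by blast
qed

text \<open>If no standard \<delta> worked, a diagonal argument would yield infinitely close lattice
  points whose values differ by at least r. One of the values is nonzero, so both points are
  infinitely close to K and nearstandard in \<Omega>, where S-continuity forbids this.\<close>

lemma grid_test_S_continuous:
  assumes \<Omega>: "open \<Omega>" and g: "jf g \<in> grid_test_functions E n0 \<Omega>" and r: "r > 0"
  shows "\<exists>\<delta>>0. \<forall>\<^sub>F i in U. \<forall>x\<in>step_lattice (n i). \<forall>y\<in>step_lattice (n i). dist x y < \<delta> \<longrightarrow>
    \<bar>diffs (n i) is (g i) x - diffs (n i) is (g i) y\<bar> < r"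
proof (rule ccontr)
  let ?D = "\<lambda>i. diffs (n i) is (g i)"
  assume no: "\<not> ?thesis"
  \<comment> \<open>The two points are chosen as a pair because \<open>eventually_choice\<close>
    selects one object per index.\<close>
  define P where "P m i \<longleftrightarrow> (\<exists>p. fst p \<in> step_lattice (n i) \<and> snd p \<in> step_lattice (n i) \<and>
    dist (fst p) (snd p) < 1 / real (Suc m) \<and> \<not> \<bar>?D i (fst p) - ?D i (snd p)\<bar> < r)" for m i
  have "\<forall>\<^sub>F i in U. P m i" for m
  proof -
    have "\<not> (\<forall>\<^sub>F i in U. \<forall>x\<in>step_lattice (n i). \<forall>y\<in>step_lattice (n i). dist x y < 1 / real (Suc m) \<longrightarrow>
      \<bar>?D i x - ?D i y\<bar> < r)"
      (is "\<not> ?ev")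
    proof
      assume ev: ?ev
      show False
        by (rule no[THEN notE], rule exI[of _ "1 / real (Suc m)"], rule conjI[OF _ ev]) simp
    qed
    then show ?thesis
      unfolding not_eventually_U
    proof eventually_elim
      case (elim i)
      then obtain x y where "x \<in> step_lattice (n i)" "y \<in> step_lattice (n i)" "dist x y < 1 / real (Suc m)"
        "\<not> \<bar>?D i x - ?D i y\<bar> < r" by blast
      then show ?case unfolding P_def by (intro exI[of _ "(x, y)"]) simp
    qed
  qed
  from diagonal[of n U P, OF n_inf this] obtain M where M: "\<forall>\<^sub>F i in U. P (M i) i" "filterlim M at_top U" by blast
  obtain Z where Z: "\<forall>\<^sub>F i in U. fst (Z i) \<in> step_lattice (n i) \<and> snd (Z i) \<in> step_lattice (n i) \<and>
    dist (fst (Z i)) (snd (Z i)) < 1 / real (Suc (M i)) \<and> \<not> \<bar>?D i (fst (Z i)) - ?D i (snd (Z i))\<bar> < r"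
    using eventually_choice[OF M(1)[unfolded P_def]] by blast
  define X where "X i = fst (Z i)" for i
  define Y where "Y i = snd (Z i)" for i
  have XY: "\<forall>\<^sub>F i in U. X i \<in> step_lattice (n i) \<and> Y i \<in> step_lattice (n i) \<and>
    dist (X i) (Y i) < 1 / real (Suc (M i)) \<and> \<not> \<bar>?D i (X i) - ?D i (Y i)\<bar> < r"
    using Z by (simp add: X_def Y_def)
  obtain K where K: "compact K" "K \<subseteq> \<Omega>" "\<forall>\<^sub>F i in U. supported_on K (n i) (g i)"
    using grid_test_supported[OF \<Omega> g] by blast
  have "((\<lambda>i. 1 / real (Suc (M i))) \<longlongrightarrow> 0) U"
    by (rule filterlim_compose[OF _ M(2)]) (use LIMSEQ_Suc[OF lim_const_over_n] in simp)
  from tendsto_add[OF tendsto_mult_right_zero[OF step_tendsto, of "length is"] this]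
  have err: "((\<lambda>i. length is * step (n i) + 1 / real (Suc (M i))) \<longlongrightarrow> 0) U" by simp
  have "\<forall>\<^sub>F i in U. \<exists>z. z \<in> K \<and> norm (X i - z) \<le> length is * step (n i) + 1 / real (Suc (M i)) \<and>
      norm (Y i - z) \<le> length is * step (n i) + 1 / real (Suc (M i))"
    using XY K(3)
  proof eventually_elim
    case (elim i)
    have xy: "norm (X i - Y i) < 1 / real (Suc (M i))" using elim by (simp add: dist_norm)
    have "?D i (X i) \<noteq> 0 \<or> ?D i (Y i) \<noteq> 0" using elim r by auto
    then obtain z where z: "g i z \<noteq> 0" "norm (z - X i) \<le> length is * step (n i) \<or> norm (z - Y i) \<le> length is * step (n i)"
      using std_diffs_support by metis
    have "norm (X i - z) \<le> norm (X i - Y i) + norm (z - Y i)"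
      using norm_triangle_ineq[of "X i - Y i" "Y i - z"] by (simp add: norm_minus_commute)
    moreover have "norm (Y i - z) \<le> norm (X i - Y i) + norm (z - X i)"
      using norm_triangle_ineq[of "Y i - X i" "X i - z"] by (simp add: norm_minus_commute)
    moreover have "0 < 1 / real (Suc (M i))" by simp
    ultimately have "norm (X i - z) \<le> length is * step (n i) + 1 / real (Suc (M i))"
      "norm (Y i - z) \<le> length is * step (n i) + 1 / real (Suc (M i))"
      using z(2) xy norm_minus_commute[of z "X i"] norm_minus_commute[of z "Y i"] by linarith+
    then show ?case using z(1) elim(2) by (auto simp: supported_on_def)
  qed
  from eventually_choice[OF this] obtain W where
    W: "\<forall>\<^sub>F i in U. W i \<in> K \<and> norm (X i - W i) \<le> length is * step (n i) + 1 / real (Suc (M i)) \<and>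
      norm (Y i - W i) \<le> length is * step (n i) + 1 / real (Suc (M i))" by blast
  have "\<forall>\<^sub>F i in U. W i \<in> K" using W by eventually_elim blast
  from ultra_compact[OF U K(1) this] obtain z where z: "z \<in> K" "(W \<longlongrightarrow> z) U" by blast
  have lim: "(V \<longlongrightarrow> z) U" if "\<forall>\<^sub>F i in U. norm (V i - W i) \<le> length is * step (n i) + 1 / real (Suc (M i))" for V
  proof -
    have "((\<lambda>i. V i - W i) \<longlongrightarrow> 0) U" by (rule Lim_null_comparison[OF that err])
    from tendsto_add[OF this z(2)] show ?thesis by simp
  qed
  have limX: "(X \<longlongrightarrow> z) U" using W by (intro lim) (auto elim: eventually_mono)
  have limY: "(Y \<longlongrightarrow> z) U" using W by (intro lim) (auto elim: eventually_mono)
  have ns: "jp V \<in> nearstandard E n0 \<Omega>" if V: "\<forall>\<^sub>F i in U. V i \<in> step_lattice (n i)" "(V \<longlongrightarrow> z) U" for V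
  proof -
    have "z \<in> \<Omega>" using z(1) K(2) by blast
    have "\<forall>\<^sub>F i in U. V i \<in> \<Omega>" by (rule topological_tendstoD[OF V(2) \<Omega> \<open>z \<in> \<Omega>\<close>])
    moreover have "\<forall>\<^sub>F i in U. norm (V i) < norm z + 1"
      by (rule order_tendstoD(2)[OF tendsto_norm[OF V(2)]]) simp
    ultimately have "\<forall>\<^sub>F i in U. V i \<in> \<Omega> \<inter> std_grid (n i)"
      using V(1) eventually_n[OF eventually_fact_ge[of "norm z + 1"]]
    proof eventually_elim
      case (elim i)
      have "\<bar>V i $ k\<bar> \<le> fact (n i)" for k
        using component_le_norm_cart[of "V i" k] elim by linarith
      then show ?case using elim by (simp add: std_grid_iff)
    qed
    then show ?thesis
      unfolding nearstandard_def using \<open>z \<in> \<Omega>\<close> V(2) by (auto simp: Omega_grid_jp near_pt_std)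
  qed
  have "jp X \<in> nearstandard E n0 \<Omega>" "jp Y \<in> nearstandard E n0 \<Omega>"
    using XY limX limY by (auto intro!: ns elim: eventually_mono)
  moreover have "near_pt E (jp X) (jp Y)"
    using tendsto_dist[OF limX limY] by (auto simp: near_pt_jp intro: order_tendstoD(2))
  moreover have "class_S0 E n0 \<Omega> (grid_diff E n0 is (jf g))"
    using g by (simp add: grid_test_functions_def class_Sinf_def)
  ultimately have "near E (happ E (grid_diff E n0 is (jf g)) (jp X)) (happ E (grid_diff E n0 is (jf g)) (jp Y))"
    unfolding class_S0_def by blast
  then have "\<forall>\<^sub>F i in U. \<bar>?D i (X i) - ?D i (Y i)\<bar> < r"
    using r unfolding grid_diff_jf happ_jf near_jr by blast
  with XY have "\<forall>\<^sub>F i in U. False" by eventually_elim blast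
  then show False using U_nontrivial by (simp add: trivial_limit_def)
qed

text \<open>S-continuity bounds the differences of \<open>g\<close>: a standard number of small steps in a
  coordinate direction leads out of the support.\<close>

lemma grid_test_gtest:
  assumes \<Omega>: "open \<Omega>" and g: "jf g \<in> grid_test_functions E n0 \<Omega>"
  shows "gtest \<Omega> g"
proof -
  obtain K where K: "compact K" "K \<subseteq> \<Omega>" "\<forall>\<^sub>F i in U. supported_on K (n i) (g i)"
    using grid_test_supported[OF \<Omega> g] by blast
  obtain R where R: "R \<ge> 0" "\<forall>x\<in>K. \<forall>i. \<bar>x $ i\<bar> \<le> R"
    using compact_box[OF K(1)] by blast
  have "\<exists>C. \<forall>\<^sub>F i in U. \<forall>x. \<bar>diffs (n i) is (g i) x\<bar> \<le> C" for "is"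
  proof -
    let ?D = "\<lambda>i. diffs (n i) is (g i)"
    obtain \<delta> where \<delta>: "\<delta> > 0" "\<forall>\<^sub>F i in U. \<forall>x\<in>step_lattice (n i). \<forall>y\<in>step_lattice (n i).
      dist x y < \<delta> \<longrightarrow> \<bar>?D i x - ?D i y\<bar> < 1"
      using grid_test_S_continuous[OF \<Omega> g zero_less_one] by blast
    \<comment> \<open>A walk of p pieces of length \<delta>/2 exceeds the width 2 (R + 1) of the box
      containing the support of the differences; the surplus absorbs the rounding to the
      lattice.\<close>
    obtain p :: nat where p: "2 * R + 4 < real p * (\<delta> / 2)"
      using reals_Archimedean3[OF half_gt_zero[OF \<delta>(1)]] by blast
    \<comment> \<open>Any single direction serves for the walk.\<close>
    fix k :: 'k
    have "\<forall>\<^sub>F i in U. \<forall>x. \<bar>?D i x\<bar> \<le> real p"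
      using \<delta>(2) K(3) eventually_step_less[OF zero_less_one, of "length is"]
        eventually_step_less[OF half_gt_zero[OF \<delta>(1)], of 1]
    proof eventually_elim
      case (elim i)
      have box: "x \<in> step_lattice (n i) \<and> \<bar>x $ k\<bar> \<le> R + 1" if x: "?D i x \<noteq> 0" for x
      proof -
        obtain z where z: "g i z \<noteq> 0" "norm (z - x) \<le> length is * step (n i)" "x \<in> step_lattice (n i) \<longleftrightarrow> z \<in> step_lattice (n i)"
          using std_diffs_support[OF x] by blast
        then have zK: "z \<in> K" "z \<in> step_lattice (n i)"
          using elim(2) by (auto simp: supported_on_def std_grid_iff)
        have "\<bar>z $ k\<bar> \<le> R" using R(2) zK(1) by blast
        moreover have "\<bar>z $ k - x $ k\<bar> \<le> length is * step (n i)"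
          using component_le_norm_cart[of "z - x" k] z(2) by simp
        ultimately have "\<bar>x $ k\<bar> \<le> R + 1" using elim(3) by linarith
        then show ?thesis using z(3) zK(2) by blast
      qed
      show ?case
      proof
        fix x
        show "\<bar>?D i x\<bar> \<le> real p"
        proof (cases "?D i x = 0")
          case False
          \<comment> \<open>The distance l \<delta>/2 rounded down to the lattice. Consecutive
            values differ by less than \<delta>, since the step is below \<delta>/2.\<close>
          define c where "c l = of_int \<lfloor>real l * (\<delta> / 2) * fact (n i)\<rfloor> * step (n i)" for l :: nat
          have c: "c l \<le> real l * (\<delta> / 2)" "real l * (\<delta> / 2) - step (n i) \<le> c l" for l
          proof -
            have eq: "real l * (\<delta> / 2) * fact (n i) * step (n i) = real l * (\<delta> / 2)" by (simp add: step_def)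
            have "of_int \<lfloor>real l * (\<delta> / 2) * fact (n i)\<rfloor> * step (n i) \<le> real l * (\<delta> / 2) * fact (n i) * step (n i)"
              by (intro mult_right_mono of_int_floor_le step_nonneg)
            then show "c l \<le> real l * (\<delta> / 2)" unfolding c_def eq .
            have "(real l * (\<delta> / 2) * fact (n i) - 1) * step (n i) \<le> of_int \<lfloor>real l * (\<delta> / 2) * fact (n i)\<rfloor> * step (n i)"
              by (intro mult_right_mono) (linarith, simp)
            then show "real l * (\<delta> / 2) - step (n i) \<le> c l"
              unfolding left_diff_distrib eq by (simp add: c_def)
          qed
          define X where "X l = x + c l *\<^sub>R axis k 1" for l
          have lat: "X l \<in> step_lattice (n i)" for l
          proof -
            have "\<exists>j::int. X l $ k' = of_int j * step (n i)" for k'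
            proof -
              obtain a :: int where a: "x $ k' = of_int a * step (n i)"
                using box[OF False] by (auto simp: step_lattice_def)
              have "X l $ k' = of_int (a + (if k' = k then \<lfloor>real l * (\<delta> / 2) * fact (n i)\<rfloor> else 0)) * step (n i)"
                by (simp add: X_def a c_def axis_def distrib_right)
              then show ?thesis by blast
            qed
            then show ?thesis by (simp add: step_lattice_def)
          qed
          have "\<bar>?D i (X 0) - ?D i (X l)\<bar> \<le> real l" for l
          proof (induction l)
            case (Suc l)
            have "X l - X (Suc l) = (c l - c (Suc l)) *\<^sub>R axis k 1" by (simp add: X_def algebra_simps)
            then have "dist (X l) (X (Suc l)) = \<bar>c l - c (Suc l)\<bar>"
              by (simp add: dist_norm norm_axis_1)
            moreover have "real (Suc l) * (\<delta> / 2) = real l * (\<delta> / 2) + \<delta> / 2" by (simp add: distrib_right)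
            ultimately have "dist (X l) (X (Suc l)) < \<delta>"
              using c[of l] c[of "Suc l"] elim(4) \<delta>(1) step_pos[of "n i"] by linarith
            then have "\<bar>?D i (X l) - ?D i (X (Suc l))\<bar> < 1" using elim(1) lat by blast
            then show ?case using Suc by simp
          qed simp
          from this[of p] have le: "\<bar>?D i (X 0) - ?D i (X p)\<bar> \<le> real p" .
          have "?D i (X p) = 0"
          proof (rule ccontr)
            assume "\<not> ?thesis"
            then have "\<bar>X p $ k\<bar> \<le> R + 1" using box by blast
            moreover have "X p $ k = x $ k + c p" by (simp add: X_def)
            moreover have "\<bar>x $ k\<bar> \<le> R + 1" using box[OF False] by blast
            ultimately show False using c(2)[of p] p step_le[of "n i"] by linarith
          qed
          then show ?thesis using le by (simp add: X_def c_def)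
        qed simp
      qed
    qed
    then show ?thesis by blast
  qed
  then show ?thesis
    unfolding gtest_def using K by blast
qed

end

section \<open>The vector space of distributions\<close>

lemma distributions_linear:
  fixes S T :: "(real ^ 'k::finite \<Rightarrow> real) \<Rightarrow> real"
  assumes S: "S \<in> distributions \<Omega>" and T: "T \<in> distributions \<Omega>"
  shows "(\<lambda>\<phi>\<in>test_functions \<Omega>. a * S \<phi> + b * T \<phi>) \<in> distributions \<Omega>"
proof -
  let ?L = "\<lambda>\<phi>. a * S \<phi> + b * T \<phi>"
  have "continuous_map (D_topology \<Omega>) euclideanreal ?L"
    using S T by (intro continuous_map_add continuous_map_real_mult_left) (auto simp: distributions_def)
  then have "continuous_map (D_topology \<Omega>) euclideanreal (restrict ?L (test_functions \<Omega>))"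
    by (rule continuous_map_eq) (simp add: topspace_D_topology)
  then show ?thesis
    using S T unfolding distributions_def
    by (auto simp: test_functions_add test_functions_scale algebra_simps)
qed

lemma cring_real_field: "cring real_field"
  using field_real_field by (simp add: field_def domain_def)

lemma module_distribution_space: "Module.module real_field (distribution_space \<Omega>)"
proof -
  let ?W = "distribution_space \<Omega>"
  have add: "S \<oplus>\<^bsub>?W\<^esub> T = (\<lambda>\<phi>\<in>test_functions \<Omega>. S \<phi> + T \<phi>)"
    and smult: "r \<odot>\<^bsub>?W\<^esub> T = (\<lambda>\<phi>\<in>test_functions \<Omega>. r * T \<phi>)"
    and zero: "\<zero>\<^bsub>?W\<^esub> = (\<lambda>\<phi>\<in>test_functions \<Omega>. 0)"
    and carrier: "carrier ?W = distributions \<Omega>" for S T r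
    by (simp_all add: distribution_space_def)
  have add_closed: "(\<lambda>\<phi>\<in>test_functions \<Omega>. S \<phi> + T \<phi>) \<in> distributions \<Omega>"
    if "S \<in> distributions \<Omega>" "T \<in> distributions \<Omega>" for S T
    using distributions_linear[OF that, of 1 1] by simp
  have smult_closed: "(\<lambda>\<phi>\<in>test_functions \<Omega>. r * T \<phi>) \<in> distributions \<Omega>" if "T \<in> distributions \<Omega>" for r T
    using distributions_linear[OF that that, of r 0] by simp
  have zero_closed: "(\<lambda>\<phi>\<in>test_functions \<Omega>. 0) \<in> distributions \<Omega>"
  proof -
    have "(\<lambda>\<phi>\<in>test_functions \<Omega>. 0) \<in> extensional (test_functions \<Omega>)" by simp
    moreover have "continuous_map (D_topology \<Omega>) euclideanreal (\<lambda>\<phi>\<in>test_functions \<Omega>. 0)"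
      by (rule continuous_map_eq[of _ _ "\<lambda>_. 0"]) (auto simp: topspace_D_topology)
    ultimately show ?thesis
      unfolding distributions_def by (auto simp: test_functions_add test_functions_scale)
  qed
  have ext: "(\<lambda>\<phi>\<in>test_functions \<Omega>. T \<phi>) = T" if "T \<in> distributions \<Omega>" for T
    using that by (intro extensional_restrict) (simp add: distributions_def)
  have "abelian_group ?W"
  proof (rule abelian_groupI)
    fix T assume T: "T \<in> carrier ?W"
    show "\<exists>S\<in>carrier ?W. S \<oplus>\<^bsub>?W\<^esub> T = \<zero>\<^bsub>?W\<^esub>"
      using T smult_closed[of T "-1"]
      by (intro bexI[of _ "\<lambda>\<phi>\<in>test_functions \<Omega>. (-1) * T \<phi>"]) (auto simp: add zero carrier intro!: restrict_ext)
  qed (auto simp: add zero carrier add_closed zero_closed ext add_ac cong: restrict_cong intro!: restrict_ext)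
  then show ?thesis
    by (intro moduleI cring_real_field)
      (auto simp: add smult carrier smult_closed ext real_field_def algebra_simps cong: restrict_cong intro!: restrict_ext)
qed

text \<open>Injectivity of h pulls every axiom of W back to V. The axioms for equivalence classes
  thus follow once \<open>Phi\<close> is known to be a bijection compatible with the
  operations.\<close>

lemma module_transport:
  assumes W: "Module.module R W" and bij: "bij_betw h (carrier V) (carrier W)"
    and add: "\<And>x y. x \<in> carrier V \<Longrightarrow> y \<in> carrier V \<Longrightarrow> x \<oplus>\<^bsub>V\<^esub> y \<in> carrier V \<and> h (x \<oplus>\<^bsub>V\<^esub> y) = h x \<oplus>\<^bsub>W\<^esub> h y"
    and smult: "\<And>r x. r \<in> carrier R \<Longrightarrow> x \<in> carrier V \<Longrightarrow> r \<odot>\<^bsub>V\<^esub> x \<in> carrier V \<and> h (r \<odot>\<^bsub>V\<^esub> x) = r \<odot>\<^bsub>W\<^esub> h x"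
    and zero: "\<zero>\<^bsub>V\<^esub> \<in> carrier V" "h \<zero>\<^bsub>V\<^esub> = \<zero>\<^bsub>W\<^esub>"
  shows "Module.module R V"
proof -
  interpret W: Module.module R W by (rule W)
  have eqI: "x = y" if "h x = h y" "x \<in> carrier V" "y \<in> carrier V" for x y
    using bij that by (auto simp: bij_betw_def inj_on_def)
  have h: "h x \<in> carrier W" if "x \<in> carrier V" for x
    using bij that by (auto simp: bij_betw_def)
  note simps = add smult zero h W.a_assoc W.smult_l_distr W.smult_r_distr W.smult_assoc1
  have "abelian_group V"
  proof (rule abelian_groupI)
    fix x assume x: "x \<in> carrier V"
    have "\<ominus>\<^bsub>W\<^esub> h x \<in> h ` carrier V"
      using h[OF x] bij_betw_imp_surj_on[OF bij] by simp
    then obtain y where y: "y \<in> carrier V" "h y = \<ominus>\<^bsub>W\<^esub> h x"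
      by (rule imageE) simp
    have "y \<oplus>\<^bsub>V\<^esub> x = \<zero>\<^bsub>V\<^esub>"
      by (rule eqI) (use x y in \<open>auto simp: simps W.l_neg\<close>)
    then show "\<exists>y\<in>carrier V. y \<oplus>\<^bsub>V\<^esub> x = \<zero>\<^bsub>V\<^esub>" using y(1) by blast
  next
    fix x y assume "x \<in> carrier V" "y \<in> carrier V"
    then show "x \<oplus>\<^bsub>V\<^esub> y = y \<oplus>\<^bsub>V\<^esub> x"
      by (intro eqI) (auto simp: simps W.a_comm)
  qed (auto simp: simps intro!: eqI)
  then show ?thesis
    by (intro moduleI W.R.is_cring) (auto simp: simps intro!: eqI)
qed

section \<open>Grid distributions and distributions\<close>

text \<open>\<open>Phi\<close> on representatives. The definition refers to no model, so values
  computed as \<open>pairing\<close> in different models can be compared.\<close>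

definition grid_pairing :: "('u, 'v, 'k::finite) extension \<Rightarrow> 'v \<Rightarrow> (real ^ 'k) set \<Rightarrow> 'v \<Rightarrow> (real ^ 'k \<Rightarrow> real) \<Rightarrow> real" where
  "grid_pairing E n0 \<Omega> F = (\<lambda>\<phi>\<in>test_functions \<Omega>. st E (grid_inner E n0 F (std E (fun_in E \<phi>))))"

context grid_model
begin

text \<open>\<open>gdist\<close> tests f only against functions represented in the model. Membership
  in \<open>grid_distributions\<close> is therefore proved elsewhere by passing to a model that
  represents the given test function.\<close>

lemma grid_distribution_gdist:
  assumes "open \<Omega>" "jf f \<in> grid_distributions E n0 \<Omega>"
  shows "gdist \<Omega> f"
  unfolding gdist_def
proof (intro allI impI)
  fix g assume g: "gtest \<Omega> g"
  show "\<exists>C. \<forall>\<^sub>F i in U. \<bar>std_inner (n i) (f i) (g i)\<bar> \<le> C"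
  proof (cases "\<Omega> = {}")
    \<comment> \<open>The empty set has no grid test functions to test with, but its grid functions
      vanish.\<close>
    case True
    have "\<forall>\<^sub>F i in U. \<forall>x. f i x \<noteq> 0 \<longrightarrow> x \<in> \<Omega> \<inter> std_grid (n i)"
      using assms(2) by (intro grid_functionsD) (simp add: grid_distributions_def)
    then have "\<forall>\<^sub>F i in U. \<bar>std_inner (n i) (f i) (g i)\<bar> \<le> 0"
      by eventually_elim (simp add: std_inner_def True)
    then show ?thesis by blast
  next
    case False
    then have "jf g \<in> grid_test_functions E n0 \<Omega>"
      using assms(1) g by (intro gtest_grid_test)
    then have "hfinite E (grid_inner E n0 (jf f) (jf g))"
      using assms(2) by (simp add: grid_distributions_def)
    then show ?thesis by (simp add: grid_inner_jf hfinite_jr)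
  qed
qed

text \<open>f vanishes off the grid of \<Omega>, so cutting \<phi> off there changes no term of the
  sum.\<close>

lemma inner_std:
  assumes "jf f \<in> grid_functions E n0 \<Omega>"
  shows "grid_inner E n0 (jf f) (std E (fun_in E \<phi>)) = jr (\<lambda>i. std_inner (n i) (f i) (restrict_grid \<Omega> (n i) \<phi>))"
proof -
  have "\<forall>\<^sub>F i in U. std_inner (n i) (f i) \<phi> = std_inner (n i) (f i) (restrict_grid \<Omega> (n i) \<phi>)"
    using grid_functionsD[OF assms]
  proof eventually_elim
    case (elim i)
    show ?case
      unfolding std_inner_def
    proof (rule arg_cong2[where f = "(*)", OF refl], rule sum.cong[OF refl])
      show "f i x * \<phi> x = f i x * restrict_grid \<Omega> (n i) \<phi> x" for x
        using elim by (cases "f i x = 0") (auto simp: restrict_grid_def)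
    qed
  qed
  then show ?thesis
    by (simp add: std_j grid_inner_jf j_eq)
qed

lemma grid_pairing_jf:
  assumes "open \<Omega>" "jf f \<in> grid_distributions E n0 \<Omega>"
  shows "grid_pairing E n0 \<Omega> (jf f) = pairing \<Omega> f"
proof -
  have f: "jf f \<in> grid_functions E n0 \<Omega>" using assms(2) by (simp add: grid_distributions_def)
  have "st E (grid_inner E n0 (jf f) (std E (fun_in E \<phi>))) = pairing \<Omega> f \<phi>" if "\<phi> \<in> test_functions \<Omega>" for \<phi>
    unfolding inner_std[OF f] by (rule st_jr[OF pairing_tendsto[OF grid_distribution_gdist[OF assms] that]])
  then show ?thesis
    by (auto simp: grid_pairing_def pairing_def restrict_def)
qed

end

section \<open>Equivalence classes and the isomorphism\<close>

locale grid_setting =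
  fixes E :: "('u, 'v, 'k::finite) extension" and n0 :: 'v and \<Omega> :: "(real ^ 'k) set"
  assumes \<Omega>: "open \<Omega>" and ne: "nonstandard_extension E" and inf: "infinite_hypernat E n0"
begin

abbreviation "GD \<equiv> grid_distributions E n0 \<Omega>"
abbreviation "P \<equiv> grid_pairing E n0 \<Omega>"

lemma ex_internal_model:
  assumes "set vs \<subseteq> internal_funs E"
  shows "\<exists>(U :: 'u list filter) j n. grid_model E n0 U j n \<and> (\<forall>F\<in>set vs. \<exists>f. F = j (\<lambda>i. fun_in E (f i)))"
proof -
  obtain U :: "'u list filter" and j n where m: "grid_model E n0 U j n" "set vs \<subseteq> range j"
    using ex_model[OF ne inf] by blast
  have "\<forall>F\<in>set vs. \<exists>f. F = j (\<lambda>i. fun_in E (f i))"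
    using grid_model.internal_funs_range[OF m(1)] m(2) assms by blast
  with m(1) show ?thesis by blast
qed

lemma GD_internal: "F \<in> GD \<Longrightarrow> F \<in> internal_funs E"
  by (simp add: grid_distributions_def grid_functions_def)

lemma test_internal: "H \<in> grid_test_functions E n0 \<Omega> \<Longrightarrow> H \<in> internal_funs E"
  by (simp add: grid_test_functions_def grid_functions_def)

lemma GD_hfinite:
  assumes F: "F \<in> GD" and \<phi>: "\<phi> \<in> test_functions \<Omega>"
  shows "hfinite E (grid_inner E n0 F (std E (fun_in E \<phi>)))"
proof -
  have "set [F] \<subseteq> internal_funs E"
    using GD_internal[OF F] by simp
  from ex_internal_model[OF this] obtain U :: "'u list filter" and j n where m: "grid_model E n0 U j n"
    "\<forall>L\<in>set [F]. \<exists>f. L = j (\<lambda>i. fun_in E (f i))" by blast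
  interpret m: grid_model E n0 U j n by fact
  obtain f where f: "F = m.jf f" using m(2) by auto
  have gf: "m.jf f \<in> grid_functions E n0 \<Omega>" using F unfolding f by (simp add: grid_distributions_def)
  show ?thesis
    unfolding f m.inner_std[OF gf] m.hfinite_jr
    using m.grid_distribution_gdist[OF \<Omega> F[unfolded f]] m.gtest_restrict_grid[OF \<phi>]
    unfolding m.gdist_def by blast
qed

lemma P_distribution: "F \<in> GD \<Longrightarrow> P F \<in> distributions \<Omega>"
proof -
  assume F: "F \<in> GD"
  have "set [F] \<subseteq> internal_funs E"
    using GD_internal[OF F] by simp
  from ex_internal_model[OF this] obtain U :: "'u list filter" and j n where m: "grid_model E n0 U j n"
    "\<forall>L\<in>set [F]. \<exists>f. L = j (\<lambda>i. fun_in E (f i))" by blast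
  interpret m: grid_model E n0 U j n by fact
  obtain f where f: "F = m.jf f" using m(2) by auto
  show ?thesis
    unfolding f m.grid_pairing_jf[OF \<Omega> F[unfolded f]]
    by (rule m.pairing_distribution[OF m.grid_distribution_gdist[OF \<Omega> F[unfolded f]]])
qed

text \<open>Testing with the restrictions of standard \<phi> shows that equivalent elements have the
  same image under \<open>P\<close>. Conversely a grid test function H is replaced by its shadow,
  the same \<phi> for F and for G, and the pairings with \<phi> agree.\<close>

lemma grid_equiv_iff: "(F, G) \<in> grid_equiv E n0 \<Omega> \<longleftrightarrow> F \<in> GD \<and> G \<in> GD \<and> P F = P G"
proof (cases "F \<in> GD \<and> G \<in> GD")
  case True
  then have F: "F \<in> GD" and G: "G \<in> GD" by auto
  have "near E (grid_inner E n0 F H) (grid_inner E n0 G H)" if eq: "P F = P G" and H: "H \<in> grid_test_functions E n0 \<Omega>" for H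
  proof -
    have "set [F, G, H] \<subseteq> internal_funs E"
      using GD_internal[OF F] GD_internal[OF G] test_internal[OF H] by simp
    from ex_internal_model[OF this] obtain U :: "'u list filter" and j n where m: "grid_model E n0 U j n"
      "\<forall>L\<in>set [F, G, H]. \<exists>f. L = j (\<lambda>i. fun_in E (f i))" by blast
    interpret m: grid_model E n0 U j n by fact
    obtain f g h where f: "F = m.jf f" and g: "G = m.jf g" and h: "H = m.jf h" using m(2) by (auto; metis)
    have fd: "m.gdist \<Omega> f" and gd: "m.gdist \<Omega> g"
      using m.grid_distribution_gdist[OF \<Omega>] F G f g by auto
    have "m.gtest \<Omega> h" using m.grid_test_gtest[OF \<Omega>] H h by simp
    from m.gtest_shadow[OF this] obtain \<phi> where \<phi>: "\<phi> \<in> test_functions \<Omega>"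
      and lim: "\<And>f. m.gdist \<Omega> f \<Longrightarrow>
        ((\<lambda>i. std_inner (n i) (f i) (h i) - std_inner (n i) (f i) (restrict_grid \<Omega> (n i) \<phi>)) \<longlongrightarrow> 0) U" by blast
    have "m.pairing \<Omega> f = m.pairing \<Omega> g"
      using eq m.grid_pairing_jf[OF \<Omega>] F G f g by simp
    then have "((\<lambda>i. std_inner (n i) (f i) (h i) - std_inner (n i) (g i) (h i)) \<longlongrightarrow> 0) U"
      using tendsto_diff[OF tendsto_add[OF lim[OF fd] m.pairing_tendsto[OF fd \<phi>]]
          tendsto_add[OF lim[OF gd] m.pairing_tendsto[OF gd \<phi>]]] by simp
    then show ?thesis
      unfolding f g h m.grid_inner_jf m.near_jr_tendsto .
  qed
  moreover have "P F = P G" if near: "\<forall>H\<in>grid_test_functions E n0 \<Omega>. near E (grid_inner E n0 F H) (grid_inner E n0 G H)"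
  proof -
    have "set [F, G] \<subseteq> internal_funs E"
      using GD_internal[OF F] GD_internal[OF G] by simp
    from ex_internal_model[OF this] obtain U :: "'u list filter" and j n where m: "grid_model E n0 U j n"
      "\<forall>L\<in>set [F, G]. \<exists>f. L = j (\<lambda>i. fun_in E (f i))" by blast
    interpret m: grid_model E n0 U j n by fact
    obtain f g where f: "F = m.jf f" and g: "G = m.jf g" using m(2) by (auto; metis)
    have fd: "m.gdist \<Omega> f" and gd: "m.gdist \<Omega> g"
      using m.grid_distribution_gdist[OF \<Omega>] F G f g by auto
    have "m.pairing \<Omega> f \<phi> = m.pairing \<Omega> g \<phi>" if \<phi>: "\<phi> \<in> test_functions \<Omega>" for \<phi>
    proof -
      let ?r = "\<lambda>i. restrict_grid \<Omega> (n i) \<phi>"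
      have "((\<lambda>i. std_inner (n i) (f i) (?r i) - std_inner (n i) (g i) (?r i)) \<longlongrightarrow> 0) U"
      proof (cases "\<Omega> = {}")
        case True
        have "std_inner m f (restrict_grid \<Omega> m \<phi>) = 0" for m f
          by (simp add: std_inner_def restrict_grid_def True)
        then show ?thesis by simp
      next
        case False
        have "m.jf ?r \<in> grid_test_functions E n0 \<Omega>"
          by (rule m.gtest_grid_test[OF \<Omega> False m.gtest_restrict_grid[OF \<phi>]])
        then show ?thesis
          using near unfolding f g m.near_jr_tendsto[symmetric] m.grid_inner_jf[symmetric] by blast
      qed
      moreover have "((\<lambda>i. std_inner (n i) (f i) (?r i) - std_inner (n i) (g i) (?r i)) \<longlongrightarrow>
          m.pairing \<Omega> f \<phi> - m.pairing \<Omega> g \<phi>) U"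
        by (intro tendsto_diff m.pairing_tendsto fd gd \<phi>)
      ultimately show ?thesis using tendsto_unique[OF m.U_nontrivial] by fastforce
    qed
    then have "m.pairing \<Omega> f = m.pairing \<Omega> g" by (auto simp: m.pairing_def restrict_def)
    then show ?thesis using m.grid_pairing_jf[OF \<Omega>] F G f g by simp
  qed
  ultimately show ?thesis using True by (auto simp: grid_equiv_def)
qed (auto simp: grid_equiv_def)

lemma equiv_grid: "equiv GD (grid_equiv E n0 \<Omega>)"
  by (intro equivI refl_onI symI transI) (auto simp: grid_equiv_iff)

lemma class_eq: "F \<in> GD \<Longrightarrow> grid_class E n0 \<Omega> F = {G \<in> GD. P G = P F}"
  by (auto simp: grid_equiv_iff)

lemma Phi_class:
  assumes F: "F \<in> GD"
  shows "Phi E n0 \<Omega> (grid_class E n0 \<Omega> F) = P F"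
proof -
  have "(\<lambda>G. st E (grid_inner E n0 G (std E (fun_in E \<phi>)))) ` {G \<in> GD. P G = P F} = {P F \<phi>}"
    if \<phi>: "\<phi> \<in> test_functions \<Omega>" for \<phi>
  proof -
    have "st E (grid_inner E n0 G (std E (fun_in E \<phi>))) = P G \<phi>" for G
      using \<phi> by (simp add: grid_pairing_def)
    then show ?thesis using F by auto
  qed
  then show ?thesis
    unfolding Phi_def class_eq[OF F] by (auto simp: grid_pairing_def restrict_def)
qed

text \<open>Two kinds of models occur: one representing F and G, for the values of \<open>P\<close>,
  and for each test function H one representing H as well, for membership in
  \<open>GD\<close>.\<close>

lemma GD_plus:
  assumes F: "F \<in> GD" and G: "G \<in> GD"
  shows "hplus E F G \<in> GD" "P (hplus E F G) = (\<lambda>\<phi>\<in>test_functions \<Omega>. P F \<phi> + P G \<phi>)"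
proof -
  have add: "std_inner n (\<lambda>x. f x + g x) h = std_inner n f h + std_inner n g h" for n and f g h :: "real ^ 'k \<Rightarrow> real"
    by (simp add: std_inner_def distrib_right distrib_left sum.distrib)
  have "set [F, G] \<subseteq> internal_funs E"
    using GD_internal[OF F] GD_internal[OF G] by simp
  from ex_internal_model[OF this] obtain U :: "'u list filter" and j n where m: "grid_model E n0 U j n"
    "\<forall>L\<in>set [F, G]. \<exists>f. L = j (\<lambda>i. fun_in E (f i))" by blast
  interpret m: grid_model E n0 U j n by fact
  obtain f g where f: "F = m.jf f" and g: "G = m.jf g" using m(2) by (auto; metis)
  have "hplus E F G \<in> grid_functions E n0 \<Omega>"
    unfolding f g m.hplus_jf
  proof (rule m.grid_functionsI)
    have "F \<in> grid_functions E n0 \<Omega>" "G \<in> grid_functions E n0 \<Omega>"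
      using F G by (auto simp: grid_distributions_def)
    from this[unfolded f g, THEN m.grid_functionsD]
    show "\<forall>\<^sub>F i in U. \<forall>x. f i x + g i x \<noteq> 0 \<longrightarrow> x \<in> \<Omega> \<inter> std_grid (n i)"
      by eventually_elim (metis add.right_neutral)
  qed
  moreover have "hfinite E (grid_inner E n0 (hplus E F G) H)" if H: "H \<in> grid_test_functions E n0 \<Omega>" for H
  proof -
    have "set [F, G, H] \<subseteq> internal_funs E"
      using GD_internal[OF F] GD_internal[OF G] test_internal[OF H] by simp
    from ex_internal_model[OF this] obtain U :: "'u list filter" and j n where m: "grid_model E n0 U j n"
      "\<forall>L\<in>set [F, G, H]. \<exists>f. L = j (\<lambda>i. fun_in E (f i))" by blast
    interpret m': grid_model E n0 U j n by fact
    obtain f g h where f: "F = m'.jf f" and g: "G = m'.jf g" and h: "H = m'.jf h" using m(2) by (auto; metis)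
    have "hfinite E (grid_inner E n0 F H)" "hfinite E (grid_inner E n0 G H)"
      using F G H by (auto simp: grid_distributions_def)
    then obtain r s where "\<forall>\<^sub>F i in U. \<bar>std_inner (n i) (f i) (h i)\<bar> \<le> r" "\<forall>\<^sub>F i in U. \<bar>std_inner (n i) (g i) (h i)\<bar> \<le> s"
      unfolding f g h m'.grid_inner_jf m'.hfinite_jr by blast
    then have "\<forall>\<^sub>F i in U. \<bar>std_inner (n i) (\<lambda>x. f i x + g i x) (h i)\<bar> \<le> r + s"
      by eventually_elim (simp add: add)
    then show ?thesis
      unfolding f g h m'.hplus_jf m'.grid_inner_jf m'.hfinite_jr by blast
  qed
  ultimately show FG: "hplus E F G \<in> GD" by (simp add: grid_distributions_def)
  have fd: "m.gdist \<Omega> f" and gd: "m.gdist \<Omega> g"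
    using m.grid_distribution_gdist[OF \<Omega>] F G f g by auto
  note FG' = FG[unfolded f g m.hplus_jf]
  have fgd: "m.gdist \<Omega> (\<lambda>i x. f i x + g i x)" by (rule m.grid_distribution_gdist[OF \<Omega> FG'])
  have "m.pairing \<Omega> (\<lambda>i x. f i x + g i x) \<phi> = m.pairing \<Omega> f \<phi> + m.pairing \<Omega> g \<phi>"
    if \<phi>: "\<phi> \<in> test_functions \<Omega>" for \<phi>
    using tendsto_unique[OF m.U_nontrivial m.pairing_tendsto[OF fgd \<phi>]
        tendsto_add[OF m.pairing_tendsto[OF fd \<phi>] m.pairing_tendsto[OF gd \<phi>], folded add]] .
  then show "P (hplus E F G) = (\<lambda>\<phi>\<in>test_functions \<Omega>. P F \<phi> + P G \<phi>)"
    unfolding f g m.hplus_jf m.grid_pairing_jf[OF \<Omega> FG'] m.grid_pairing_jf[OF \<Omega> F[unfolded f]]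
      m.grid_pairing_jf[OF \<Omega> G[unfolded g]]
    by (auto simp: m.pairing_def restrict_def)
qed

lemma GD_scale:
  assumes F: "F \<in> GD"
  shows "hscale E r F \<in> GD" "P (hscale E r F) = (\<lambda>\<phi>\<in>test_functions \<Omega>. r * P F \<phi>)"
proof -
  have scale: "std_inner n (\<lambda>x. r * f x) h = r * std_inner n f h" for n and f h :: "real ^ 'k \<Rightarrow> real"
    by (simp add: std_inner_def sum_distrib_left mult_ac)
  have "set [F] \<subseteq> internal_funs E"
    using GD_internal[OF F] by simp
  from ex_internal_model[OF this] obtain U :: "'u list filter" and j n where m: "grid_model E n0 U j n"
    "\<forall>L\<in>set [F]. \<exists>f. L = j (\<lambda>i. fun_in E (f i))" by blast
  interpret m: grid_model E n0 U j n by fact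
  obtain f where f: "F = m.jf f" using m(2) by auto
  have "hscale E r F \<in> grid_functions E n0 \<Omega>"
    unfolding f m.hscale_jf
  proof (rule m.grid_functionsI)
    have "F \<in> grid_functions E n0 \<Omega>"
      using F by (auto simp: grid_distributions_def)
    from this[unfolded f, THEN m.grid_functionsD]
    show "\<forall>\<^sub>F i in U. \<forall>x. r * f i x \<noteq> 0 \<longrightarrow> x \<in> \<Omega> \<inter> std_grid (n i)"
      by eventually_elim simp
  qed
  moreover have "hfinite E (grid_inner E n0 (hscale E r F) H)" if H: "H \<in> grid_test_functions E n0 \<Omega>" for H
  proof -
    have "set [F, H] \<subseteq> internal_funs E"
      using GD_internal[OF F] test_internal[OF H] by simp
    from ex_internal_model[OF this] obtain U :: "'u list filter" and j n where m: "grid_model E n0 U j n"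
      "\<forall>L\<in>set [F, H]. \<exists>f. L = j (\<lambda>i. fun_in E (f i))" by blast
    interpret m': grid_model E n0 U j n by fact
    obtain f h where f: "F = m'.jf f" and h: "H = m'.jf h" using m(2) by (auto; metis)
    have "hfinite E (grid_inner E n0 F H)"
      using F H by (auto simp: grid_distributions_def)
    then obtain s where "\<forall>\<^sub>F i in U. \<bar>std_inner (n i) (f i) (h i)\<bar> \<le> s"
      unfolding f h m'.grid_inner_jf m'.hfinite_jr by blast
    then have "\<forall>\<^sub>F i in U. \<bar>std_inner (n i) (\<lambda>x. r * f i x) (h i)\<bar> \<le> \<bar>r\<bar> * s"
      by eventually_elim (simp add: scale abs_mult mult_left_mono)
    then show ?thesis
      unfolding f h m'.hscale_jf m'.grid_inner_jf m'.hfinite_jr by blast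
  qed
  ultimately show rF: "hscale E r F \<in> GD" by (simp add: grid_distributions_def)
  have fd: "m.gdist \<Omega> f" using m.grid_distribution_gdist[OF \<Omega>] F f by auto
  note rF' = rF[unfolded f m.hscale_jf]
  have rd: "m.gdist \<Omega> (\<lambda>i x. r * f i x)" by (rule m.grid_distribution_gdist[OF \<Omega> rF'])
  have "m.pairing \<Omega> (\<lambda>i x. r * f i x) \<phi> = r * m.pairing \<Omega> f \<phi>"
    if \<phi>: "\<phi> \<in> test_functions \<Omega>" for \<phi>
    using tendsto_unique[OF m.U_nontrivial m.pairing_tendsto[OF rd \<phi>]
        tendsto_mult_left[OF m.pairing_tendsto[OF fd \<phi>], of r, folded scale]] .
  then show "P (hscale E r F) = (\<lambda>\<phi>\<in>test_functions \<Omega>. r * P F \<phi>)"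
    unfolding f m.hscale_jf m.grid_pairing_jf[OF \<Omega> rF'] m.grid_pairing_jf[OF \<Omega> F[unfolded f]]
    by (auto simp: m.pairing_def restrict_def)
qed

text \<open>The representing function comes from a standard family, so the property
  \<open>f = S.represent \<Omega> T n\<close> at N_0 pins F down in every model. Finiteness against
  a test function is checked in a model that represents it, the value of \<open>P F\<close> in the
  model where F was built.\<close>

lemma GD_surj:
  assumes T: "T \<in> distributions \<Omega>"
  shows "\<exists>F\<in>GD. P F = T"
proof -
  obtain H A where "\<forall>m t. (H m has_real_derivative H (Suc m) t) (at t)" "\<forall>m t. \<bar>H m t\<bar> \<le> A m"
    "mono (H 0)" "\<forall>t\<le>0. H 0 t = 0" "\<forall>t\<ge>1. H 0 t = 1"
    using smooth_step_exists by (elim exE conjE)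
  then have "smooth_step H A" by unfold_locales auto
  then interpret S: smooth_step H A .
  obtain U :: "'u list filter" and j n where "grid_model E n0 U j n"
    using ex_model[OF ne inf] by blast
  then interpret m: grid_model E n0 U j n .
  define F where "F = m.jf (\<lambda>i. S.represent \<Omega> T (n i))"
  have F: "F \<in> internal_funs E" "holds_at E n0 F (\<lambda>n f. f = S.represent \<Omega> T n)"
    by (simp_all add: F_def m.internal_funs_jf m.holds_at_jf)
  have gf: "F \<in> grid_functions E n0 \<Omega>"
    unfolding F_def by (rule m.grid_functionsI) (simp add: S.represent_def)
  have "hfinite E (grid_inner E n0 F G)" if G: "G \<in> grid_test_functions E n0 \<Omega>" for G
  proof -
    have "set [F, G] \<subseteq> internal_funs E"
      using F(1) test_internal[OF G] by simp
    from ex_internal_model[OF this] obtain U' :: "'u list filter" and j' n' where m': "grid_model E n0 U' j' n'"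
      "\<forall>L\<in>set [F, G]. \<exists>f. L = j' (\<lambda>i. fun_in E (f i))" by blast
    interpret m': grid_model E n0 U' j' n' by fact
    obtain f g where f: "F = m'.jf f" and g: "G = m'.jf g" using m'(2) by (auto; metis)
    have rep: "\<forall>\<^sub>F i in U'. f i = S.represent \<Omega> T (n' i)"
      using F(2) unfolding f m'.holds_at_jf .
    have gt: "m'.gtest \<Omega> g" using m'.grid_test_gtest[OF \<Omega>] G g by simp
    then obtain K where K: "compact K" "K \<subseteq> \<Omega>" "\<forall>\<^sub>F i in U'. supported_on K (n' i) (g i)"
      unfolding m'.gtest_def by blast
    obtain m C where C: "\<forall>\<^sub>F n in sequentially. \<forall>g. \<forall>G>0. supported_on K n g \<longrightarrow>
      (\<forall>is x. length is \<le> m \<longrightarrow> \<bar>diffs n is g x\<bar> \<le> G) \<longrightarrow>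
      \<bar>std_inner n (S.represent \<Omega> T n) g\<bar> \<le> C * G"
      using S.represent_bounded[OF T \<Omega> K(1,2)] by blast
    have "\<forall>is. \<exists>B. \<forall>\<^sub>F i in U'. \<forall>x. \<bar>diffs (n' i) is (g i) x\<bar> \<le> B"
      using gt unfolding m'.gtest_def by blast
    from choice[OF this] obtain B where B: "\<And>is. \<forall>\<^sub>F i in U'. \<forall>x. \<bar>diffs (n' i) is (g i) x\<bar> \<le> B is"
      by blast
    define J where "J = {is :: 'k list. length is \<le> m}"
    have J: "finite J" using finite_lists_length_le[of "UNIV :: 'k set" m] by (simp add: J_def)
    \<comment> \<open>\<open>represent_bounded\<close> asks for one positive bound common to all
      orders up to m; the summand 1 makes it positive.\<close>
    define M where "M = 1 + (\<Sum>is\<in>J. \<bar>B is\<bar>)"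
    have M: "M > 0" unfolding M_def by (intro add_pos_nonneg sum_nonneg) auto
    have BM: "B is \<le> M" if "is \<in> J" for "is"
    proof -
      have "\<bar>B is\<bar> \<le> (\<Sum>is\<in>J. \<bar>B is\<bar>)" using that J by (intro member_le_sum) auto
      then show ?thesis by (simp add: M_def)
    qed
    have "\<forall>\<^sub>F i in U'. \<forall>is\<in>J. \<forall>x. \<bar>diffs (n' i) is (g i) x\<bar> \<le> B is"
      using J B by (intro eventually_ball_finite) auto
    then have "\<forall>\<^sub>F i in U'. \<bar>std_inner (n' i) (f i) (g i)\<bar> \<le> C * M"
      using m'.eventually_n[OF C] K(3) rep
    proof eventually_elim
      case (elim i)
      have "\<bar>diffs (n' i) is (g i) x\<bar> \<le> M" if "length is \<le> m" for "is" x
        using elim(1) BM[of "is"] that order_trans unfolding J_def by blast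
      then show ?case using elim(2,3,4) M by simp
    qed
    then show ?thesis
      unfolding f g m'.grid_inner_jf m'.hfinite_jr by blast
  qed
  with gf have FG: "F \<in> GD" by (simp add: grid_distributions_def)
  have "m.pairing \<Omega> (\<lambda>i. S.represent \<Omega> T (n i)) \<phi> = T \<phi>" if \<phi>: "\<phi> \<in> test_functions \<Omega>" for \<phi>
  proof (rule tendsto_unique[OF m.U_nontrivial])
    show "((\<lambda>i. std_inner (n i) (S.represent \<Omega> T (n i)) (restrict_grid \<Omega> (n i) \<phi>)) \<longlongrightarrow> T \<phi>) U"
      by (rule filterlim_compose[OF S.represent_tendsto[OF T \<Omega> \<phi>] m.n_inf])
  qed (rule m.pairing_tendsto[OF m.grid_distribution_gdist[OF \<Omega> FG[unfolded F_def]] \<phi>])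
  moreover have "T \<in> extensional (test_functions \<Omega>)" using T by (simp add: distributions_def)
  ultimately have "m.pairing \<Omega> (\<lambda>i. S.represent \<Omega> T (n i)) = T"
    by (intro extensionalityI[of _ "test_functions \<Omega>"]) (auto simp: m.pairing_def)
  then have "P F = T"
    unfolding F_def m.grid_pairing_jf[OF \<Omega> FG[unfolded F_def]] .
  then show ?thesis using FG by blast
qed

lemma GD_zero:
  "std E (fun_in E (\<lambda>x. 0)) \<in> GD" "P (std E (fun_in E (\<lambda>x. 0))) = (\<lambda>\<phi>\<in>test_functions \<Omega>. 0)"
proof -
  have inner: "std_inner n (\<lambda>x. 0) h = 0" for n and h :: "real ^ 'k \<Rightarrow> real"
    by (simp add: std_inner_def)
  have hf: "hfinite E (grid_inner E n0 (std E (fun_in E (\<lambda>x. 0))) H)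
      \<and> st E (grid_inner E n0 (std E (fun_in E (\<lambda>x. 0))) H) = 0" if H: "H \<in> internal_funs E" for H
  proof -
    have "set [H] \<subseteq> internal_funs E"
      using H by simp
    from ex_internal_model[OF this] obtain U :: "'u list filter" and j n where m: "grid_model E n0 U j n"
      "\<forall>L\<in>set [H]. \<exists>f. L = j (\<lambda>i. fun_in E (f i))" by blast
    interpret m: grid_model E n0 U j n by fact
    obtain h where h: "H = m.jf h" using m(2) by auto
    have "hfinite E (m.jr (\<lambda>i. 0))" unfolding m.hfinite_jr by (intro exI[of _ 0]) simp
    moreover have "st E (m.jr (\<lambda>i. 0)) = 0" by (rule m.st_jr) simp
    ultimately show ?thesis
      unfolding h m.std_j m.grid_inner_jf inner by blast
  qed
  obtain U :: "'u list filter" and j n where "grid_model E n0 U j n"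
    using ex_model[OF ne inf] by blast
  then interpret m: grid_model E n0 U j n .
  have "std E (fun_in E (\<lambda>x. 0)) \<in> grid_functions E n0 \<Omega>"
    unfolding m.std_j by (rule m.grid_functionsI) simp
  then show "std E (fun_in E (\<lambda>x. 0)) \<in> GD"
    using hf test_internal by (simp add: grid_distributions_def)
  have "std E (fun_in E \<phi>) \<in> internal_funs E" for \<phi>
    unfolding m.std_j by (rule m.internal_funs_jf)
  then show "P (std E (fun_in E (\<lambda>x. 0))) = (\<lambda>\<phi>\<in>test_functions \<Omega>. 0)"
    using hf by (auto simp: grid_pairing_def restrict_def)
qed

lemma quotient_iso: "real_vector_space_iso (grid_quotient E n0 \<Omega>) (distribution_space \<Omega>) (Phi E n0 \<Omega>)"
proof -
  let ?V = "grid_quotient E n0 \<Omega>" and ?W = "distribution_space \<Omega>" and ?c = "grid_class E n0 \<Omega>"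
  have carrier: "x \<in> carrier ?V \<longleftrightarrow> (\<exists>F\<in>GD. x = ?c F)" for x
    by (auto simp: grid_quotient_def quotient_def)
  have cong: "?c F = ?c G" if "F \<in> GD" "G \<in> GD" "P F = P G" for F G
    using that by (simp add: class_eq)
  have nonempty: "?c F \<noteq> {}" if "F \<in> GD" for F
    using that by (auto simp: class_eq)
  have add: "?c F \<oplus>\<^bsub>?V\<^esub> ?c G = ?c (hplus E F G)" if F: "F \<in> GD" and G: "G \<in> GD" for F G
  proof -
    \<comment> \<open>All representatives give the same class, so the union in the definition of the
      sum, taken over nonempty classes, is that class.\<close>
    have "?c (hplus E F' G') = ?c (hplus E F G)" if "F' \<in> ?c F" "G' \<in> ?c G" for F' G'
      using that F G by (intro cong) (auto simp: grid_equiv_iff GD_plus)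
    then have "(\<Union>F'\<in>?c F. \<Union>G'\<in>?c G. ?c (hplus E F' G')) = ?c (hplus E F G)"
      by (intro SUP_eq_const nonempty F G) assumption+
    then show ?thesis by (simp add: grid_quotient_def)
  qed
  have smult: "r \<odot>\<^bsub>?V\<^esub> ?c F = ?c (hscale E r F)" if F: "F \<in> GD" for r F
  proof -
    have "?c (hscale E r F') = ?c (hscale E r F)" if "F' \<in> ?c F" for F'
      using that F by (intro cong) (auto simp: grid_equiv_iff GD_scale)
    then have "(\<Union>F'\<in>?c F. ?c (hscale E r F')) = ?c (hscale E r F)"
      by (intro SUP_eq_const nonempty F) assumption+
    then show ?thesis by (simp add: grid_quotient_def)
  qed
  have bij: "bij_betw (Phi E n0 \<Omega>) (carrier ?V) (carrier ?W)"
    unfolding bij_betw_def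
  proof
    show "inj_on (Phi E n0 \<Omega>) (carrier ?V)"
    proof (rule inj_onI)
      fix x y assume "x \<in> carrier ?V" "y \<in> carrier ?V" and eq: "Phi E n0 \<Omega> x = Phi E n0 \<Omega> y"
      then obtain F G where FG: "F \<in> GD" "x = ?c F" "G \<in> GD" "y = ?c G" unfolding carrier by blast
      then have "P F = P G" using eq by (simp only: Phi_class)
      then show "x = y" unfolding FG(2,4) by (rule cong[OF FG(1,3)])
    qed
    show "Phi E n0 \<Omega> ` carrier ?V = carrier ?W"
    proof
      show "Phi E n0 \<Omega> ` carrier ?V \<subseteq> carrier ?W"
        using P_distribution by (auto simp: carrier Phi_class distribution_space_def)
      show "carrier ?W \<subseteq> Phi E n0 \<Omega> ` carrier ?V"
      proof
        fix T assume "T \<in> carrier ?W"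
        then obtain F where F: "F \<in> GD" "P F = T" using GD_surj by (auto simp: distribution_space_def)
        then have "T = Phi E n0 \<Omega> (?c F)" by (simp add: Phi_class)
        moreover have "?c F \<in> carrier ?V" unfolding carrier using F(1) by blast
        ultimately show "T \<in> Phi E n0 \<Omega> ` carrier ?V" by blast
      qed
    qed
  qed
  have hadd: "x \<oplus>\<^bsub>?V\<^esub> y \<in> carrier ?V \<and> Phi E n0 \<Omega> (x \<oplus>\<^bsub>?V\<^esub> y) = Phi E n0 \<Omega> x \<oplus>\<^bsub>?W\<^esub> Phi E n0 \<Omega> y"
    if "x \<in> carrier ?V" "y \<in> carrier ?V" for x y
  proof -
    obtain F G where FG: "F \<in> GD" "x = ?c F" "G \<in> GD" "y = ?c G" using \<open>x \<in> _\<close> \<open>y \<in> _\<close> unfolding carrier by blast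
    then show ?thesis
      using GD_plus[OF FG(1,3)] by (auto simp: add carrier Phi_class distribution_space_def)
  qed
  have hsmult: "r \<odot>\<^bsub>?V\<^esub> x \<in> carrier ?V \<and> Phi E n0 \<Omega> (r \<odot>\<^bsub>?V\<^esub> x) = r \<odot>\<^bsub>?W\<^esub> Phi E n0 \<Omega> x"
    if x: "x \<in> carrier ?V" for r x
  proof -
    obtain F where F: "F \<in> GD" "x = ?c F" using x unfolding carrier by blast
    then show ?thesis
      using GD_scale[OF F(1)] by (auto simp: smult carrier Phi_class distribution_space_def)
  qed
  have zero: "\<zero>\<^bsub>?V\<^esub> = ?c (std E (fun_in E (\<lambda>x. 0)))" by (simp add: grid_quotient_def)
  have "Module.module real_field ?V"
  proof (rule module_transport[OF module_distribution_space bij])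
    show "\<zero>\<^bsub>?V\<^esub> \<in> carrier ?V" unfolding zero carrier using GD_zero(1) by blast
    show "Phi E n0 \<Omega> \<zero>\<^bsub>?V\<^esub> = \<zero>\<^bsub>?W\<^esub>"
      unfolding zero Phi_class[OF GD_zero(1)] GD_zero(2) by (simp add: distribution_space_def)
  qed (use hadd hsmult in blast)+
  then show ?thesis
    unfolding real_vector_space_iso_def using module_distribution_space bij hadd hsmult by blast
qed

end

theorem theorem3p8:
  fixes E :: "('u, 'v, 'k::finite) extension" and n0 :: 'v and \<Omega> :: "(real ^ 'k) set"
  assumes "open \<Omega>"
    and "nonstandard_extension E"
    and "saturated E |distributions \<Omega>|"
    and "infinite_hypernat E n0"
  shows "equiv (grid_distributions E n0 \<Omega>) (grid_equiv E n0 \<Omega>) \<and>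
    (\<forall>F \<in> grid_distributions E n0 \<Omega>. \<forall>\<phi> \<in> test_functions \<Omega>.
       hfinite E (grid_inner E n0 F (std E (fun_in E \<phi>))) \<and>
       Phi E n0 \<Omega> (grid_class E n0 \<Omega> F) \<phi> = st E (grid_inner E n0 F (std E (fun_in E \<phi>)))) \<and>
    real_vector_space_iso (grid_quotient E n0 \<Omega>) (distribution_space \<Omega>) (Phi E n0 \<Omega>)"
proof -
  interpret grid_setting E n0 \<Omega>
    using assms by unfold_locales
  have "Phi E n0 \<Omega> (grid_class E n0 \<Omega> F) \<phi> = st E (grid_inner E n0 F (std E (fun_in E \<phi>)))"
    if "F \<in> GD" "\<phi> \<in> test_functions \<Omega>" for F \<phi>
    unfolding Phi_class[OF that(1)] using that(2) by (simp add: grid_pairing_def)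
  then show ?thesis
    using equiv_grid GD_hfinite quotient_iso by blast
qed

end
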